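(* Let $\Gamma$ be a group with a self-similar action on a row-finite directed graph $E$ without sources, let $\mathcal G=S_{\Gamma,E}\ltimes E^\infty$ be the associated groupoid and $\mathcal B$ the inverse semigroup of its compact open bisections. The relation $\precsim$ is a preorder, while $\approx$ and $\sim$ are equivalence relations on $\mathrm C_c(E^0,\mathbb N)$. The quotients $W(\Gamma,E)=\mathrm C_c(E^0,\mathbb N)/{\approx}$ and $V(\Gamma,E)=\mathrm C_c(E^0,\mathbb N)/{\sim}$ are preordered monoids with the addition induced from $\mathrm C_c(E^0,\mathbb N)$, the partial order on $W(\Gamma,E)$ induced by $\precsim$, and the algebraic preorder on $V(\Gamma,E)$. The map $\tau\colon\mathrm C_c(E^0,\mathbb N)\to\mathrm C_c(E^\infty,\mathbb N)$, $\tau(f)=f\circ r$, descends to isomorphisms of (pre)ordered monoids $W(\Gamma,E)\cong S_{\mathcal B}(\mathcal G)$ and $V(\Gamma,E)\cong S(\mathcal G)$. In particular, $V(\Gamma,E)\cong S(\mathcal G)$ is the universal abelian monoid given by generators $\{a_v:v\in E^0\}$ subject to the relations $a_v=\sum_{e\in r^{-1}(v)}a_{s(e)}$ and $a_v=a_{gv}$ for $v\in E^0$, $g\in\Gamma$. In addition, $W(\Gamma,E)\cong S_{\mathcal B}(\mathcal G)$ is the quotient $\widetilde{V(\Gamma,E)}$ of $V(\Gamma,E)$ by the congruence generated by the algebraic preorder.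
   Context: SELF-SIMILAR ACTIONS. $E=(E^0,E^1,r,s)$; row-finite without sources means $r^{-1}(v)$ is finite and nonempty for all $v\in E^0$. $\Gamma$ acts on $E$ by graph automorphisms and there is a restriction map $\Gamma\times E^1\ni(g,e)\mapsto g|_e\in\Gamma$ with $(gh)|_e=g|_{he}\,h|_e$ and $g|_e\,s(e)=g\,s(e)$. Finite paths $E^*$ and infinite paths $E^\infty$ consist of edges with $s(e_i)=r(e_{i+1})$; $E^n$ is the set of paths of length $n$, $E^nv=\{\lambda\in E^n:s(\lambda)=v\}$. The action extends to $E^*$ and $E^\infty$ by $g(e\mu)=(ge)(g|_e\mu)$. For $\beta\in E^*$ put $Z(\beta)=\{\beta\eta\in E^\infty\}$ (compact open sets generating the topology of $E^\infty$). $S_{\Gamma,E}=\{(\alpha,g,\beta)\in E^*\times\Gamma\times E^*:s(\alpha)=g\,s(\beta)\}\cup\{0\}$ is an inverse semigroup acting on $E^\infty$, where $(\alpha,g,\beta)$ acts as the partial homeomorphism $Z(\beta)\to Z(\alpha)$, $\beta\eta\mapsto\alpha(g\eta)$; $\mathcal G=S_{\Gamma,E}\ltimes E^\infty$ is the transformation groupoid (groupoid of germs of this inverse semigroup action), an ample, possibly non-Hausdorff groupoid with unit space $E^\infty$. The product on $S_{\Gamma,E}$ is $(\alpha,g,\beta)(\beta\epsilon,h,\delta)=(\alpha(g\epsilon),g|_\epsilon h,\delta)$, $(\alpha,g,\gamma\epsilon)(\gamma,h,\delta)=(\alpha,g(h^{-1}|_\epsilon)^{-1},\delta(h^{-1}\epsilon))$,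 and $0$ in all other cases, with $(\alpha,g,\beta)^*=(\beta,g^{-1},\alpha)$; $g|_\epsilon$ for paths is defined inductively. RELATIONS ON $\mathrm C_c(E^0,\mathbb N)$ (finitely supported functions $E^0\to\mathbb N$). $\Theta^n(f)(v)=\sum_{\lambda\in E^nv}f(r(\lambda))$ (so $\Theta^n$ is additive, $\Theta^0=\mathrm{id}$). Write - $f\sim_\Theta\tilde f$ if $\Theta^p(f)=\Theta^q(\tilde f)$ for some $p,q\in\mathbb N$; - $f\sim_\Gamma\tilde f$ if there is $g\in\Gamma$ with $f(v)=\tilde f(gv)$ for all $v$; - $f\sim\tilde f$ if there are $f_i,\tilde f_i,\tilde{\tilde f}_i\in\mathrm C_c(E^0,\mathbb N)$, $i=1,\dots,n$, with $f_i\sim_\Gamma\tilde f_i\sim_\Theta\tilde{\tilde f}_i$, $f\sim_\Theta\sum_if_i$ and $\sum_i\tilde{\tilde f}_i\sim_\Theta\tilde f$; - $f\precsim\tilde f$ if there are $f_i,\tilde f_i,\tilde{\tilde f}_i$ ($i=1,\dots,n$) and $\tilde{\tilde f}$ in $\mathrm C_c(E^0,\mathbb N)$ with $f_i\sim_\Gamma\tilde f_i\sim_\Theta\tilde{\tilde f}_i$, $f\sim_\Theta\sum_if_i$ and $\sum_i\tilde{\tilde f}_i\le\tilde{\tilde f}\sim_\Theta\tilde f$; - $f\approx\tilde f$ if $f\precsim\tilde f$ and $\tilde f\precsim f$. TYPE SEMIGROUPS. For an ample groupoid $\mathcal G$ with unit space $X$ and $\mathcal B$ the compact open bisections (open $U\subseteq\mathcal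 G$, compact, with $r|_U,s|_U$ injective), let $F(\mathcal B)=\{\sum_{k=1}^n1_{W_k}:W_k\in\mathcal B\}$, $s_*(\sum_k1_{W_k})=\sum_k1_{s(W_k)}$, $r_*(\sum_k1_{W_k})=\sum_k1_{r(W_k)}$. For $f,g\in\mathrm C_c(X,\mathbb N)$ put $f\precsim_{\mathcal B}g$ if there is $b\in F(\mathcal B)$ with $f\le s_*(b)$ and $r_*(b)\le g$; $f\approx_{\mathcal B}g$ if $f\precsim_{\mathcal B}g\precsim_{\mathcal B}f$; and $f\sim_{\mathcal G}g$ if there is $b\in F(\mathcal B)$ with $f=s_*(b)$, $r_*(b)=g$. Then $S_{\mathcal B}(\mathcal G)=\mathrm C_c(X,\mathbb N)/{\approx_{\mathcal B}}$, ordered by $\precsim_{\mathcal B}$, and $S(\mathcal G)=\mathrm C_c(X,\mathbb N)/{\sim_{\mathcal G}}$ with the algebraic preorder. MONOIDS. The algebraic preorder on an abelian monoid: $x\le y$ iff $x+z=y$ for some $z$. For a preordered monoid $S$, $\widetilde S=S/{\approx}$ where $x\approx y$ iff $x\le y$ and $y\le x$, with the induced addition and order. *)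

theory Defs
  imports
    "HOL-Algebra.FiniteProduct"
    "HOL-Algebra.Group_Action"
    "HOL-Analysis.Abstract_Topology"
    "HOL-Library.Indicator_Function"
    "HOL-Library.Stream"
    "HOL-Library.Sublist"
    "Graph_Theory.Digraph"
begin

section \<open>Self-similar actions on graphs\<close>

text \<open>
  A directed graph \<open>(E\<^sup>0, E\<^sup>1, r, s)\<close> is a \<open>pre_digraph\<close> with \<open>r = head\<close> and \<open>s = tail\<close>.
  The fields \<open>vact\<close> and \<open>eact\<close> are the actions of the group on vertices and edges, and
  \<open>restr A g e\<close> is the restriction \<open>g|\<^sub>e\<close>.
\<close>

record ('v, 'e, 'g) ss_action =
  sgraph :: "('v, 'e) pre_digraph"
  sgroup :: "'g monoid"
  vact :: "'g \<Rightarrow> 'v \<Rightarrow> 'v"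
  eact :: "'g \<Rightarrow> 'e \<Rightarrow> 'e"
  restr :: "'g \<Rightarrow> 'e \<Rightarrow> 'g"

abbreviation E0 :: "('v, 'e, 'g) ss_action \<Rightarrow> 'v set" where
  "E0 A \<equiv> verts (sgraph A)"

abbreviation E1 :: "('v, 'e, 'g) ss_action \<Rightarrow> 'e set" where
  "E1 A \<equiv> arcs (sgraph A)"

abbreviation rg :: "('v, 'e, 'g) ss_action \<Rightarrow> 'e \<Rightarrow> 'v" where
  "rg A \<equiv> head (sgraph A)"

abbreviation so :: "('v, 'e, 'g) ss_action \<Rightarrow> 'e \<Rightarrow> 'v" where
  "so A \<equiv> tail (sgraph A)"

definition row_finite_no_sources :: "('v, 'e) pre_digraph \<Rightarrow> bool" where
  "row_finite_no_sources G \<longleftrightarrow> wf_digraph G \<and>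
     (\<forall>v\<in>verts G. finite {e \<in> arcs G. head G e = v} \<and> {e \<in> arcs G. head G e = v} \<noteq> {})"

definition self_similar_action :: "('v, 'e, 'g) ss_action \<Rightarrow> bool" where
  "self_similar_action A \<longleftrightarrow>
     wf_digraph (sgraph A) \<and> group (sgroup A) \<and>
     group_action (sgroup A) (E0 A) (vact A) \<and>
     group_action (sgroup A) (E1 A) (eact A) \<and>
     (\<forall>g\<in>carrier (sgroup A). \<forall>e\<in>E1 A.
        rg A (eact A g e) = vact A g (rg A e) \<and>
        so A (eact A g e) = vact A g (so A e)) \<and>
     (\<forall>g\<in>carrier (sgroup A). \<forall>e\<in>E1 A. restr A g e \<in> carrier (sgroup A)) \<and>
     (\<forall>g\<in>carrier (sgroup A). \<forall>h\<in>carrier (sgroup A). \<forall>e\<in>E1 A.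
        restr A (g \<otimes>\<^bsub>sgroup A\<^esub> h) e = restr A g (eact A h e) \<otimes>\<^bsub>sgroup A\<^esub> restr A h e) \<and>
     (\<forall>g\<in>carrier (sgroup A). \<forall>e\<in>E1 A. vact A (restr A g e) (so A e) = vact A g (so A e))"


section \<open>Paths\<close>

text \<open>
  A finite path is stored as the pair of its range and its list of edges, so that \<open>(v, [])\<close> is the
  path of length zero at \<open>v\<close>. Infinite paths are streams of edges.
\<close>

type_synonym ('v, 'e) gpath = "'v \<times> 'e list"

definition paths :: "('v, 'e, 'g) ss_action \<Rightarrow> ('v, 'e) gpath set" where
  "paths A = {(v, es). v \<in> E0 A \<and> set es \<subseteq> E1 A \<and> (es \<noteq> [] \<longrightarrow> rg A (hd es) = v) \<and>
                successively (\<lambda>e f. so A e = rg A f) es}"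

definition path_rg :: "('v, 'e) gpath \<Rightarrow> 'v" where
  "path_rg \<alpha> = fst \<alpha>"

definition path_so :: "('v, 'e, 'g) ss_action \<Rightarrow> ('v, 'e) gpath \<Rightarrow> 'v" where
  "path_so A \<alpha> = (if snd \<alpha> = [] then fst \<alpha> else so A (last (snd \<alpha>)))"

definition inf_paths :: "('v, 'e, 'g) ss_action \<Rightarrow> 'e stream set" where
  "inf_paths A = {x. sset x \<subseteq> E1 A \<and> (\<forall>i. so A (x !! i) = rg A (x !! Suc i))}"

definition inf_rg :: "('v, 'e, 'g) ss_action \<Rightarrow> 'e stream \<Rightarrow> 'v" where
  "inf_rg A x = rg A (shd x)"

definition cyl :: "('v, 'e, 'g) ss_action \<Rightarrow> ('v, 'e) gpath \<Rightarrow> 'e stream set" where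
  "cyl A \<beta> = {snd \<beta> @- \<eta> | \<eta>. \<eta> \<in> inf_paths A \<and> inf_rg A \<eta> = path_so A \<beta>}"

definition inf_top :: "('v, 'e, 'g) ss_action \<Rightarrow> 'e stream topology" where
  "inf_top A = topology_generated_by (cyl A ` paths A)"

primrec list_act :: "('v, 'e, 'g) ss_action \<Rightarrow> 'g \<Rightarrow> 'e list \<Rightarrow> 'e list" where
  "list_act A g [] = []"
| "list_act A g (e # es) = eact A g e # list_act A (restr A g e) es"

primrec list_restr :: "('v, 'e, 'g) ss_action \<Rightarrow> 'g \<Rightarrow> 'e list \<Rightarrow> 'g" where
  "list_restr A g [] = g"
| "list_restr A g (e # es) = list_restr A (restr A g e) es"

primcorec inf_act :: "('v, 'e, 'g) ss_action \<Rightarrow> 'g \<Rightarrow> 'e stream \<Rightarrow> 'e stream" where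
  "inf_act A g x = eact A g (shd x) ## inf_act A (restr A g (shd x)) (stl x)"


section \<open>The inverse semigroup and its action\<close>

text \<open>\<open>None\<close> is the zero element, \<open>Some (\<alpha>, g, \<beta>)\<close> is the triple \<open>(\<alpha>, g, \<beta>)\<close>.\<close>

type_synonym ('v, 'e, 'g) sgp = "(('v, 'e) gpath \<times> 'g \<times> ('v, 'e) gpath) option"

definition sgp_set :: "('v, 'e, 'g) ss_action \<Rightarrow> ('v, 'e, 'g) sgp set" where
  "sgp_set A = {Some (\<alpha>, g, \<beta>) | \<alpha> g \<beta>. \<alpha> \<in> paths A \<and> g \<in> carrier (sgroup A) \<and> \<beta> \<in> paths A \<and>
                  path_so A \<alpha> = vact A g (path_so A \<beta>)} \<union> {None}"

text \<open>
  The product \<open>(\<alpha>, g, \<beta>)(\<gamma>, h, \<delta>)\<close>: in the first case \<open>\<gamma> = \<beta>\<epsilon>\<close>, in the second \<open>\<beta> = \<gamma>\<epsilon>\<close>;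
  the two cases overlap only for \<open>\<epsilon>\<close> of length zero, where both give \<open>(\<alpha>, gh, \<delta>)\<close>.
\<close>

fun sgp_mult :: "('v, 'e, 'g) ss_action \<Rightarrow> ('v, 'e, 'g) sgp \<Rightarrow> ('v, 'e, 'g) sgp \<Rightarrow> ('v, 'e, 'g) sgp" where
  "sgp_mult A (Some (\<alpha>, g, \<beta>)) (Some (\<gamma>, h, \<delta>)) =
     (if fst \<beta> = fst \<gamma> \<and> prefix (snd \<beta>) (snd \<gamma>) then
        (let \<epsilon> = drop (length (snd \<beta>)) (snd \<gamma>) in
         Some ((fst \<alpha>, snd \<alpha> @ list_act A g \<epsilon>), list_restr A g \<epsilon> \<otimes>\<^bsub>sgroup A\<^esub> h, \<delta>))
      else if fst \<beta> = fst \<gamma> \<and> prefix (snd \<gamma>) (snd \<beta>) then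
        (let \<epsilon> = drop (length (snd \<gamma>)) (snd \<beta>); h' = inv\<^bsub>sgroup A\<^esub> h in
         Some (\<alpha>, g \<otimes>\<^bsub>sgroup A\<^esub> inv\<^bsub>sgroup A\<^esub> (list_restr A h' \<epsilon>), (fst \<delta>, snd \<delta> @ list_act A h' \<epsilon>)))
      else None)"
| "sgp_mult A _ _ = None"

fun sgp_star :: "('v, 'e, 'g) ss_action \<Rightarrow> ('v, 'e, 'g) sgp \<Rightarrow> ('v, 'e, 'g) sgp" where
  "sgp_star A (Some (\<alpha>, g, \<beta>)) = Some (\<beta>, inv\<^bsub>sgroup A\<^esub> g, \<alpha>)"
| "sgp_star A None = None"

fun sgp_dom :: "('v, 'e, 'g) ss_action \<Rightarrow> ('v, 'e, 'g) sgp \<Rightarrow> 'e stream set" where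
  "sgp_dom A (Some (\<alpha>, g, \<beta>)) = cyl A \<beta>"
| "sgp_dom A None = {}"

text \<open>Meaningful only on \<open>sgp_dom\<close>, where it is \<open>\<beta>\<eta> \<mapsto> \<alpha>(g\<eta>)\<close>.\<close>

fun sgp_act :: "('v, 'e, 'g) ss_action \<Rightarrow> ('v, 'e, 'g) sgp \<Rightarrow> 'e stream \<Rightarrow> 'e stream" where
  "sgp_act A (Some (\<alpha>, g, \<beta>)) x = snd \<alpha> @- inf_act A g (sdrop (length (snd \<beta>)) x)"
| "sgp_act A None x = x"


section \<open>Topological groupoids and type semigroups\<close>

text \<open>
  The unit space is a separate topological space \<open>unit_top\<close> rather than a subset of the arrows.
  The product \<open>gcomp \<gamma> \<eta>\<close> is meaningful only if \<open>gsrc \<gamma> = grng \<eta>\<close>.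
\<close>

record ('x, 'a) top_groupoid =
  unit_top :: "'x topology"
  arr_top :: "'a topology"
  gsrc :: "'a \<Rightarrow> 'x"
  grng :: "'a \<Rightarrow> 'x"
  gcomp :: "'a \<Rightarrow> 'a \<Rightarrow> 'a"
  ginv :: "'a \<Rightarrow> 'a"

definition compact_open_bisections :: "('x, 'a) top_groupoid \<Rightarrow> 'a set set" where
  "compact_open_bisections G =
     {U. openin (arr_top G) U \<and> compactin (arr_top G) U \<and> inj_on (grng G) U \<and> inj_on (gsrc G) U}"

text \<open>\<open>C\<^sub>c(X, \<nat>)\<close>, each function being extended by zero outside the space.\<close>

definition Cc :: "'x topology \<Rightarrow> ('x \<Rightarrow> nat) set" where
  "Cc X = {f. continuous_map X (discrete_topology UNIV) f \<and>
              compactin X (X closure_of {x \<in> topspace X. f x \<noteq> 0}) \<and>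
              (\<forall>x. x \<notin> topspace X \<longrightarrow> f x = 0)}"

definition FB :: "('x, 'a) top_groupoid \<Rightarrow> ('a \<Rightarrow> nat) set" where
  "FB G = {(\<lambda>\<gamma>. \<Sum>k=1..n. indicator (W k) \<gamma>) | (n::nat) W. \<forall>k\<in>{1..n}. W k \<in> compact_open_bisections G}"

text \<open>
  \<open>s\<^sub>*\<close> and \<open>r\<^sub>*\<close> are the push-forwards along \<open>gsrc\<close> and \<open>grng\<close>, i.e. sums over the fibres. Terms with
  \<open>b \<gamma> = 0\<close> are left out because the library's sum over an infinite index set is zero. Lemma
  \<open>pushforward_sum_bisections\<close> is the formula on sums of indicator functions of bisections.
\<close>

definition pushforward :: "('x, 'a) top_groupoid \<Rightarrow> ('a \<Rightarrow> 'x) \<Rightarrow> ('a \<Rightarrow> nat) \<Rightarrow> 'x \<Rightarrow> nat" where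
  "pushforward G p b x = (\<Sum>\<gamma> | \<gamma> \<in> topspace (arr_top G) \<and> p \<gamma> = x \<and> b \<gamma> \<noteq> 0. b \<gamma>)"

lemma pushforward_sum_bisections:
  fixes W :: "nat \<Rightarrow> 'a set"
  assumes W: "\<forall>k\<in>{1..n}. W k \<in> compact_open_bisections G"
    and p: "p = gsrc G \<or> p = grng G"
  shows "pushforward G p (\<lambda>\<gamma>. \<Sum>k=1..n. indicator (W k) \<gamma>) = (\<lambda>x. \<Sum>k=1..n. indicator (p ` W k) x)"
proof
  fix x
  let ?b = "\<lambda>\<gamma>. \<Sum>k=1..n. indicator (W k) \<gamma> :: nat"
  let ?F = "\<lambda>k. {\<gamma> \<in> W k. p \<gamma> = x}"
  define D where "D = (\<Union>k\<in>{1..n}. ?F k)"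
  have inj: "inj_on p (W k)" if "k \<in> {1..n}" for k
    using W p that unfolding compact_open_bisections_def by auto
  have sub: "W k \<subseteq> topspace (arr_top G)" if "k \<in> {1..n}" for k
    using W that openin_subset unfolding compact_open_bisections_def by blast
  have fibre: "?F k = {} \<and> x \<notin> p ` W k \<or> (\<exists>\<gamma>. ?F k = {\<gamma>}) \<and> x \<in> p ` W k" if "k \<in> {1..n}" for k
    using inj[OF that] unfolding inj_on_def by blast
  have finF: "finite (?F k)" if "k \<in> {1..n}" for k
    using fibre[OF that] by (metis finite.emptyI finite_insert)
  have finD: "finite D" unfolding D_def using finF by blast
  have b0: "?b \<gamma> \<noteq> 0 \<longleftrightarrow> (\<exists>k\<in>{1..n}. \<gamma> \<in> W k)" for \<gamma>
    by (auto simp: indicator_def)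
  have "{\<gamma>. \<gamma> \<in> topspace (arr_top G) \<and> p \<gamma> = x \<and> ?b \<gamma> \<noteq> 0} = D"
    unfolding D_def b0 using sub by blast
  then have "pushforward G p ?b x = (\<Sum>\<gamma>\<in>D. ?b \<gamma>)"
    unfolding pushforward_def by simp
  also have "\<dots> = (\<Sum>k=1..n. \<Sum>\<gamma>\<in>D. indicator (W k) \<gamma>)"
    by (rule sum.swap)
  also have "\<dots> = (\<Sum>k=1..n. indicator (p ` W k) x)"
  proof (rule sum.cong[OF refl])
    fix k assume k: "k \<in> {1..n}"
    have "D \<inter> W k = ?F k" unfolding D_def using k by blast
    then have "(\<Sum>\<gamma>\<in>D. indicator (W k) \<gamma> :: nat) = card (?F k)"
      using finD by (simp add: sum_indicator_eq_card)
    moreover have "card (?F k) = indicator (p ` W k) x"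
      using fibre[OF k]
    proof
      assume "?F k = {} \<and> x \<notin> p ` W k"
      then show ?thesis by (metis card.empty indicator_simps(2))
    next
      assume "(\<exists>\<gamma>. ?F k = {\<gamma>}) \<and> x \<in> p ` W k"
      then show ?thesis by (metis card_1_singleton_iff One_nat_def indicator_simps(1))
    qed
    ultimately show "(\<Sum>\<gamma>\<in>D. indicator (W k) \<gamma> :: nat) = indicator (p ` W k) x"
      by simp
  qed
  finally show "pushforward G p ?b x = (\<Sum>k=1..n. indicator (p ` W k) x)" .
qed

definition rel_precsim_B :: "('x, 'a) top_groupoid \<Rightarrow> ('x \<Rightarrow> nat) rel" where
  "rel_precsim_B G = {(f, g). f \<in> Cc (unit_top G) \<and> g \<in> Cc (unit_top G) \<and>
     (\<exists>b\<in>FB G. f \<le> pushforward G (gsrc G) b \<and> pushforward G (grng G) b \<le> g)}"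

definition rel_approx_B :: "('x, 'a) top_groupoid \<Rightarrow> ('x \<Rightarrow> nat) rel" where
  "rel_approx_B G = {(f, g). (f, g) \<in> rel_precsim_B G \<and> (g, f) \<in> rel_precsim_B G}"

definition rel_sim_G :: "('x, 'a) top_groupoid \<Rightarrow> ('x \<Rightarrow> nat) rel" where
  "rel_sim_G G = {(f, g). f \<in> Cc (unit_top G) \<and> g \<in> Cc (unit_top G) \<and>
     (\<exists>b\<in>FB G. f = pushforward G (gsrc G) b \<and> pushforward G (grng G) b = g)}"


section \<open>Preordered monoids and their quotients\<close>

text \<open>Abelian monoids are written multiplicatively, following \<open>HOL-Algebra\<close>.\<close>

record 'a preord_monoid = "'a monoid" +
  ple :: "'a \<Rightarrow> 'a \<Rightarrow> bool"

definition preordered_monoid :: "'a preord_monoid \<Rightarrow> bool" where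
  "preordered_monoid M \<longleftrightarrow> comm_monoid M \<and>
     (\<forall>x\<in>carrier M. ple M x x) \<and>
     (\<forall>x\<in>carrier M. \<forall>y\<in>carrier M. \<forall>z\<in>carrier M. ple M x y \<longrightarrow> ple M y z \<longrightarrow> ple M x z) \<and>
     (\<forall>x\<in>carrier M. \<forall>y\<in>carrier M. \<forall>z\<in>carrier M. ple M x y \<longrightarrow> ple M (x \<otimes>\<^bsub>M\<^esub> z) (y \<otimes>\<^bsub>M\<^esub> z))"

definition ordered_monoid :: "'a preord_monoid \<Rightarrow> bool" where
  "ordered_monoid M \<longleftrightarrow> preordered_monoid M \<and>
     (\<forall>x\<in>carrier M. \<forall>y\<in>carrier M. ple M x y \<longrightarrow> ple M y x \<longrightarrow> x = y)"

definition preord_iso :: "'a preord_monoid \<Rightarrow> 'b preord_monoid \<Rightarrow> ('a \<Rightarrow> 'b) set" where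
  "preord_iso M N = {h. preordered_monoid M \<and> preordered_monoid N \<and> h \<in> iso M N \<and>
     h \<one>\<^bsub>M\<^esub> = \<one>\<^bsub>N\<^esub> \<and> (\<forall>x\<in>carrier M. \<forall>y\<in>carrier M. ple M x y \<longleftrightarrow> ple N (h x) (h y))}"

definition with_preorder :: "('a, 'm) monoid_scheme \<Rightarrow> ('a \<Rightarrow> 'a \<Rightarrow> bool) \<Rightarrow> 'a preord_monoid" where
  "with_preorder M leq = \<lparr>carrier = carrier M, mult = mult M, one = one M, ple = leq\<rparr>"

definition alg_le :: "('a, 'm) monoid_scheme \<Rightarrow> 'a \<Rightarrow> 'a \<Rightarrow> bool" where
  "alg_le M x y \<longleftrightarrow> (\<exists>z\<in>carrier M. x \<otimes>\<^bsub>M\<^esub> z = y)"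

definition fun_monoid :: "('a \<Rightarrow> nat) set \<Rightarrow> ('a \<Rightarrow> nat) monoid" where
  "fun_monoid C = \<lparr>carrier = C, mult = (\<lambda>f g x. f x + g x), one = (\<lambda>x. 0)\<rparr>"

text \<open>
  If \<open>R\<close> is a congruence, the union defining the product of two classes consists of a single class.
\<close>

definition quot_monoid :: "('a, 'm) monoid_scheme \<Rightarrow> 'a rel \<Rightarrow> 'a set monoid" where
  "quot_monoid M R = \<lparr>carrier = carrier M // R,
     mult = (\<lambda>X Y. \<Union>x\<in>X. \<Union>y\<in>Y. R `` {x \<otimes>\<^bsub>M\<^esub> y}),
     one = R `` {\<one>\<^bsub>M\<^esub>}\<rparr>"

definition quot_le :: "'a rel \<Rightarrow> 'a set \<Rightarrow> 'a set \<Rightarrow> bool" where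
  "quot_le L X Y \<longleftrightarrow> (\<exists>x\<in>X. \<exists>y\<in>Y. (x, y) \<in> L)"

definition tilde_rel :: "'a preord_monoid \<Rightarrow> 'a rel" where
  "tilde_rel M = {(x, y). x \<in> carrier M \<and> y \<in> carrier M \<and> ple M x y \<and> ple M y x}"

definition tilde :: "'a preord_monoid \<Rightarrow> 'a set preord_monoid" where
  "tilde M = with_preorder (quot_monoid M (tilde_rel M)) (quot_le {(x, y). ple M x y})"

definition S_B :: "('x, 'a) top_groupoid \<Rightarrow> ('x \<Rightarrow> nat) set preord_monoid" where
  "S_B G = with_preorder (quot_monoid (fun_monoid (Cc (unit_top G))) (rel_approx_B G))
             (quot_le (rel_precsim_B G))"

definition S_typ :: "('x, 'a) top_groupoid \<Rightarrow> ('x \<Rightarrow> nat) set preord_monoid" where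
  "S_typ G = (let M = quot_monoid (fun_monoid (Cc (unit_top G))) (rel_sim_G G)
              in with_preorder M (alg_le M))"


section \<open>The groupoid of germs of a self-similar action\<close>

text \<open>
  \<open>(t, x)\<close> and \<open>(u, x)\<close> have the same germ at \<open>x\<close> iff \<open>te = ue\<close> for an idempotent \<open>e\<close> of the inverse
  semigroup with \<open>x\<close> in its domain. (This is finer than equality of \<open>t\<close> and \<open>u\<close> as maps near \<open>x\<close>.)
\<close>

definition germ_rel :: "('v, 'e, 'g) ss_action \<Rightarrow> (('v, 'e, 'g) sgp \<times> 'e stream) rel" where
  "germ_rel A = {((t, x), (u, y)). t \<in> sgp_set A \<and> u \<in> sgp_set A \<and> x = y \<and>
     x \<in> sgp_dom A t \<and> x \<in> sgp_dom A u \<and>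
     (\<exists>e\<in>sgp_set A. sgp_mult A e e = e \<and> x \<in> sgp_dom A e \<and> sgp_mult A t e = sgp_mult A u e)}"

type_synonym ('v, 'e, 'g) germ = "(('v, 'e, 'g) sgp \<times> 'e stream) set"

definition germ :: "('v, 'e, 'g) ss_action \<Rightarrow> ('v, 'e, 'g) sgp \<Rightarrow> 'e stream \<Rightarrow> ('v, 'e, 'g) germ" where
  "germ A t x = germ_rel A `` {(t, x)}"

definition germ_groupoid :: "('v, 'e, 'g) ss_action \<Rightarrow> ('e stream, ('v, 'e, 'g) germ) top_groupoid" where
  "germ_groupoid A = \<lparr>
     unit_top = inf_top A,
     arr_top = topology_generated_by
       {germ A t ` U | t U. t \<in> sgp_set A \<and> openin (inf_top A) U \<and> U \<subseteq> sgp_dom A t},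
     gsrc = (\<lambda>\<gamma>. the_elem (snd ` \<gamma>)),
     grng = (\<lambda>\<gamma>. the_elem ((\<lambda>(t, x). sgp_act A t x) ` \<gamma>)),
     gcomp = (\<lambda>\<gamma> \<eta>. \<Union>(t, y)\<in>\<gamma>. \<Union>(u, x)\<in>\<eta>. germ A (sgp_mult A t u) x),
     ginv = (\<lambda>\<gamma>. \<Union>(t, x)\<in>\<gamma>. germ A (sgp_star A t) (sgp_act A t x))\<rparr>"


section \<open>The monoids of a self-similar action\<close>

text \<open>\<open>C\<^sub>c(E\<^sup>0, \<nat>)\<close>, each function being extended by zero outside \<open>E\<^sup>0\<close>.\<close>

definition CcV :: "('v, 'e, 'g) ss_action \<Rightarrow> ('v \<Rightarrow> nat) set" where
  "CcV A = {f. finite {v. f v \<noteq> 0} \<and> {v. f v \<noteq> 0} \<subseteq> E0 A}"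

text \<open>
  There may be infinitely many paths of length \<open>n\<close> with source \<open>v\<close>, but for row-finite graphs only
  finitely many of them contribute a nonzero term; the others are left out of the sum.
\<close>

definition Theta :: "('v, 'e, 'g) ss_action \<Rightarrow> nat \<Rightarrow> ('v \<Rightarrow> nat) \<Rightarrow> 'v \<Rightarrow> nat" where
  "Theta A n f v =
     (\<Sum>\<alpha> | \<alpha> \<in> paths A \<and> length (snd \<alpha>) = n \<and> path_so A \<alpha> = v \<and> f (path_rg \<alpha>) \<noteq> 0. f (path_rg \<alpha>))"

definition sim_Theta :: "('v, 'e, 'g) ss_action \<Rightarrow> ('v \<Rightarrow> nat) \<Rightarrow> ('v \<Rightarrow> nat) \<Rightarrow> bool" where
  "sim_Theta A f f' \<longleftrightarrow> (\<exists>p q. Theta A p f = Theta A q f')"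

definition sim_Gamma :: "('v, 'e, 'g) ss_action \<Rightarrow> ('v \<Rightarrow> nat) \<Rightarrow> ('v \<Rightarrow> nat) \<Rightarrow> bool" where
  "sim_Gamma A f f' \<longleftrightarrow> (\<exists>g\<in>carrier (sgroup A). \<forall>v\<in>E0 A. f v = f' (vact A g v))"

definition rel_sim :: "('v, 'e, 'g) ss_action \<Rightarrow> ('v \<Rightarrow> nat) rel" where
  "rel_sim A = {(f, f'). f \<in> CcV A \<and> f' \<in> CcV A \<and>
     (\<exists>(n::nat) F F' F''.
        (\<forall>i\<in>{1..n}. F i \<in> CcV A \<and> F' i \<in> CcV A \<and> F'' i \<in> CcV A \<and>
                    sim_Gamma A (F i) (F' i) \<and> sim_Theta A (F' i) (F'' i)) \<and>
        sim_Theta A f (\<lambda>v. \<Sum>i=1..n. F i v) \<and>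
        sim_Theta A (\<lambda>v. \<Sum>i=1..n. F'' i v) f')}"

definition rel_precsim :: "('v, 'e, 'g) ss_action \<Rightarrow> ('v \<Rightarrow> nat) rel" where
  "rel_precsim A = {(f, f'). f \<in> CcV A \<and> f' \<in> CcV A \<and>
     (\<exists>(n::nat) F F' F''. \<exists>f''\<in>CcV A.
        (\<forall>i\<in>{1..n}. F i \<in> CcV A \<and> F' i \<in> CcV A \<and> F'' i \<in> CcV A \<and>
                    sim_Gamma A (F i) (F' i) \<and> sim_Theta A (F' i) (F'' i)) \<and>
        sim_Theta A f (\<lambda>v. \<Sum>i=1..n. F i v) \<and>
        (\<lambda>v. \<Sum>i=1..n. F'' i v) \<le> f'' \<and> sim_Theta A f'' f')}"

definition rel_approx :: "('v, 'e, 'g) ss_action \<Rightarrow> ('v \<Rightarrow> nat) rel" where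
  "rel_approx A = {(f, f'). (f, f') \<in> rel_precsim A \<and> (f', f) \<in> rel_precsim A}"

definition W_mon :: "('v, 'e, 'g) ss_action \<Rightarrow> ('v \<Rightarrow> nat) set preord_monoid" where
  "W_mon A = with_preorder (quot_monoid (fun_monoid (CcV A)) (rel_approx A)) (quot_le (rel_precsim A))"

definition V_mon :: "('v, 'e, 'g) ss_action \<Rightarrow> ('v \<Rightarrow> nat) set preord_monoid" where
  "V_mon A = (let M = quot_monoid (fun_monoid (CcV A)) (rel_sim A) in with_preorder M (alg_le M))"

definition tau :: "('v, 'e, 'g) ss_action \<Rightarrow> ('v \<Rightarrow> nat) \<Rightarrow> 'e stream \<Rightarrow> nat" where
  "tau A f x = (if x \<in> inf_paths A then f (inf_rg A x) else 0)"


section \<open>The universal abelian monoid on the vertices\<close>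

definition vertex_relations ::
    "('v, 'e, 'g) ss_action \<Rightarrow> ('m, 'k) monoid_scheme \<Rightarrow> ('v \<Rightarrow> 'm) \<Rightarrow> bool" where
  "vertex_relations A M a \<longleftrightarrow> (\<forall>v\<in>E0 A. a v \<in> carrier M) \<and>
     (\<forall>v\<in>E0 A. a v = finprod M (\<lambda>e. a (so A e)) {e \<in> E1 A. rg A e = v}) \<and>
     (\<forall>v\<in>E0 A. \<forall>g\<in>carrier (sgroup A). a v = a (vact A g v))"

text \<open>
  \<open>N\<close> with generators \<open>a\<close> has the universal property of the abelian monoid presented by
  \<open>vertex_relations\<close>, with respect to all abelian monoids \<open>M\<close> whose elements have type \<open>'m\<close>. A theorem
  with free type variable \<open>'m\<close> covers all monoids. As \<open>hom\<close> does not require preservation of the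
  neutral element, this is added.
\<close>

definition universal_vertex_monoid ::
    "'m itself \<Rightarrow> ('v, 'e, 'g) ss_action \<Rightarrow> ('n, 'k) monoid_scheme \<Rightarrow> ('v \<Rightarrow> 'n) \<Rightarrow> bool" where
  "universal_vertex_monoid T A N a \<longleftrightarrow> comm_monoid N \<and> vertex_relations A N a \<and>
     (\<forall>(M :: 'm monoid) b. comm_monoid M \<and> vertex_relations A M b \<longrightarrow>
        (\<exists>!h. h \<in> extensional (carrier N) \<and> h \<in> hom N M \<and> h \<one>\<^bsub>N\<^esub> = \<one>\<^bsub>M\<^esub> \<and>
              (\<forall>v\<in>E0 A. h (a v) = b v)))"

end

theory Submission
  imports Defs "HOL-Library.Multiset"
begin

text \<open>
  The theorem becomes a statement about finite multisets of triples \<open>(\<alpha>, g, \<beta>)\<close> with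
  \<open>s(\<alpha>) = g s(\<beta>)\<close>. The germs of such a triple at the points of \<open>Z(\<beta>)\<close> form a compact open
  bisection with source \<open>Z(\<beta>)\<close> and range \<open>Z(\<alpha>)\<close>, and every compact open bisection is a finite
  disjoint union of these (\<open>bisection_decomposition\<close>). Hence the pairs \<open>(s\<^sub>*(b), r\<^sub>*(b))\<close> with \<open>b\<close> in
  \<open>F(B)\<close> are exactly the pairs \<open>(\<Sum>\<^sub>i 1\<^bsub>Z(\<beta>\<^sub>i)\<^esub>, \<Sum>\<^sub>i 1\<^bsub>Z(\<alpha>\<^sub>i)\<^esub>)\<close> for finite families of
  triples. In the same way the functions in \<open>C\<^sub>c(E\<^sup>\<infinity>, \<nat>)\<close> are the finite sums of indicator functions
  of cylinders (\<open>Cc_eq_Cyl\<close>); the input for both is the compactness of cylinders, which is due to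
  row-finiteness.

  A triple can be replaced by the triples \<open>(\<alpha>(g\<epsilon>), g|\<^sub>\<epsilon>, \<beta>\<epsilon>)\<close> with \<open>\<epsilon>\<close> of a fixed length without
  changing either sum, so all \<open>\<beta>\<^sub>i\<close>, or all \<open>\<alpha>\<^sub>i\<close>, may be assumed to have the same length. At a single
  length the cylinders are disjoint, and nonempty because there are no sources, so a sum of their
  indicator functions determines the multiset of paths (\<open>cylsum_level_inj\<close>). This is what makes
  equality in the type semigroup transitive: two decompositions of the same function are brought to
  a common length, matched and composed (\<open>equid_trans\<close>). It also shows that \<open>F\<close> is below \<open>G\<close> for the
  relation defining the order of the type semigroup of bisections iff \<open>F + H\<close> is equidecomposable
  with \<open>G\<close> for some \<open>H\<close> (\<open>subequid_iff\<close>).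

  On the graph side, \<open>\<Theta>\<^sup>n(f)\<close> counts the sources of the paths of length \<open>n\<close>, each path \<open>\<lambda>\<close> being taken
  \<open>f(r(\<lambda>))\<close> times, and the same multiset of paths decomposes \<open>\<tau>(f)\<close>. So if \<open>\<tau>(f) = \<Sum>\<^sub>i 1\<^bsub>Z(\<beta>\<^sub>i)\<^esub>\<close>
  with all \<open>\<beta>\<^sub>i\<close> of length \<open>N\<close>, then \<open>\<Theta>\<^sup>N(f) = \<Sum>\<^sub>i 1\<^bsub>s(\<beta>\<^sub>i)\<^esub>\<close>, the group elements of the triples move
  \<open>s(\<beta>\<^sub>i)\<close> to \<open>s(\<alpha>\<^sub>i)\<close>, and powers of \<open>\<Theta>\<close> bring the \<open>\<alpha>\<^sub>i\<close> to a common length. These are the three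
  stages in the definition of the relations on \<open>C\<^sub>c(E\<^sup>0, \<nat>)\<close>; hence two functions are related there iff
  their images under \<open>\<tau>\<close> are (\<open>rel_sim_iff\<close>, \<open>rel_precsim_iff\<close>). In particular transitivity need
  only be proved on the path space.

  Every element of \<open>C\<^sub>c(E\<^sup>\<infinity>, \<nat>)\<close> is equidecomposable with some \<open>\<tau>(f)\<close>, since \<open>Z(\<beta>)\<close> is with
  \<open>Z(s(\<beta>))\<close>. The five monoids \<open>V\<close>, \<open>W\<close>, \<open>S(G)\<close>, \<open>S\<^sub>B(G)\<close> and the ordered
  quotient of \<open>V\<close> are therefore images of \<open>C\<^sub>c(E\<^sup>0, \<nat>)\<close>. For \<open>V\<close> and \<open>S(G)\<close> two functions
  have the same image iff they are related by \<open>\<sim>\<close>, for the other three iff each is \<open>\<precsim>\<close> the other, and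
  in all five cases the order pulls back to \<open>\<precsim>\<close>. The isomorphisms follow formally
  (\<open>preord_iso_of_presentations\<close>). For the universal property, elements \<open>b\<^sub>v\<close> satisfying the relations
  define the homomorphism \<open>f \<mapsto> \<Prod>\<^sub>v b\<^sub>v\<^bsup>f(v)\<^esup>\<close>, which is invariant under \<open>\<Theta>\<close> and the group and so under
  \<open>\<sim>\<close> (\<open>eval_rel_sim\<close>).
\<close>

section \<open>Finite multisets\<close>

lemma image_mset_sum_mset: "image_mset f (\<Sum>t\<in>#T. K t) = (\<Sum>t\<in>#T. image_mset f (K t))"
  by (induction T) auto

lemma sum_mset_Union: "\<Sum>\<^sub># (\<Sum>t\<in>#T. K t) = (\<Sum>t\<in>#T. \<Sum>\<^sub># (K t))"
  by (induction T) auto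

text \<open>
  The matching of two decompositions of the same function; it is the relator of the functor of
  multisets, applied to equality.
\<close>

lemma rel_mset_eq_pairing:
  assumes "image_mset f M = image_mset g N"
  obtains P where "image_mset fst P = M" "image_mset snd P = N" "\<forall>(x, y)\<in>#P. f x = g y"
proof -
  have "rel_mset (=) (image_mset f M) (image_mset g N)"
    using assms by (simp add: multiset.rel_eq)
  then have "rel_mset (\<lambda>x y. f x = g y) M N"
    by (simp add: multiset.rel_map)
  then show thesis using that by (auto simp: multiset.in_rel)
qed

lemma count_sum_mset_family: "count (\<Sum>t\<in>#T. K t) v = (\<Sum>t\<in>#T. count (K t) v)"
  by (induction T) auto

lemma count_eq_sum_indicator: "count M v = (\<Sum>x\<in>#M. indicator {x} v)"
  by (induction M) (auto simp: indicator_def)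

lemma count_single_indicator: "count {#v#} = indicator {v}"
  by (auto simp: indicator_def fun_eq_iff)

text \<open>
  Turns a multiset into a family with the index set \<open>{1..n}\<close> that the relations on
  \<open>C\<^sub>c(E\<^sup>0, \<nat>)\<close> and the definition of \<open>F(B)\<close> use.
\<close>

lemma obtain_enumeration:
  obtains n :: nat and t where "\<forall>i\<in>{1..n}. t i \<in># T"
    "\<forall>h :: 'a \<Rightarrow> nat. (\<Sum>i=1..n. h (t i)) = (\<Sum>x\<in>#T. h x)"
proof -
  obtain ts where ts: "mset ts = T" using ex_mset by blast
  \<comment> \<open>The families in the statements are indexed from 1, lists from 0.\<close>
  define t where "t i = ts ! (i - 1)" for i :: nat
  show thesis
  proof (rule that[of "length ts" t]; intro ballI allI)
    fix i assume "i \<in> {1..length ts}"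
    then have "t i \<in> set ts" unfolding t_def by (intro nth_mem) auto
    then show "t i \<in># T" using ts by auto
  next
    fix h :: "'a \<Rightarrow> nat"
    show "(\<Sum>i=1..length ts. h (t i)) = (\<Sum>x\<in>#T. h x)"
      unfolding ts[symmetric] t_def mset_map[symmetric] sum_mset_sum_list sum_list_sum_nth
      by (simp add: sum.atLeast1_atMost_eq atLeast0LessThan)
  qed
qed

lemma stream_eqI: "(\<And>n. stake n x = stake n y) \<Longrightarrow> x = y"
proof -
  assume eq: "\<And>n. stake n x = stake n y"
  have "x !! n = y !! n" for n
    using eq[of "Suc n"] stake_nth[of n "Suc n" x] stake_nth[of n "Suc n" y] by simp
  then have "smap (snth x) nats = smap (snth y) nats" by presburger
  then show "x = y" by (metis sdrop.simps(1) stream_smap_nats)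
qed

section \<open>Quotients of preordered monoids\<close>

context comm_monoid begin

definition mprod :: "('c \<Rightarrow> 'a) \<Rightarrow> 'c multiset \<Rightarrow> 'a" where
  "mprod c B = finprod G (\<lambda>x. c x [^] count B x) (set_mset B)"

lemma mprod_empty [simp]: "mprod c {#} = \<one>"
  by (simp add: mprod_def)

lemma mprod_closed: "c ` set_mset B \<subseteq> carrier G \<Longrightarrow> mprod c B \<in> carrier G"
  unfolding mprod_def by (intro finprod_closed) auto

lemma mprod_add_mset:
  assumes "c ` set_mset (add_mset x B) \<subseteq> carrier G"
  shows "mprod c (add_mset x B) = c x \<otimes> mprod c B"
proof -
  let ?S = "insert x (set_mset B)"
  have c: "c y \<in> carrier G" if "y \<in> ?S" for y using assms that by auto
  have "mprod c (add_mset x B) = finprod G (\<lambda>y. (if y = x then c y else \<one>) \<otimes> (c y [^] count B y)) ?S"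
    unfolding mprod_def using c
    by (intro finprod_cong') (auto simp: m_comm)
  also have "\<dots> = finprod G (\<lambda>y. if y = x then c y else \<one>) ?S \<otimes> finprod G (\<lambda>y. c y [^] count B y) ?S"
    using c by (intro finprod_multf) auto
  also have "finprod G (\<lambda>y. if y = x then c y else \<one>) ?S = c x"
    using c by (intro finprod_singleton_swap) auto
  also have "finprod G (\<lambda>y. c y [^] count B y) ?S = mprod c B"
    unfolding mprod_def
    by (intro finprod_mono_neutral_cong_right) (use c in \<open>auto simp: not_in_iff\<close>)
  finally show ?thesis .
qed

lemma mprod_union:
  assumes "c ` set_mset (A + B) \<subseteq> carrier G"
  shows "mprod c (A + B) = mprod c A \<otimes> mprod c B"
  using assms
proof (induction A)
  case (add x A)
  have "c x \<in> carrier G" "mprod c A \<in> carrier G" "mprod c B \<in> carrier G"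
    using add.prems by (auto intro!: mprod_closed)
  moreover have "c ` set_mset (add_mset x (A + B)) \<subseteq> carrier G" "c ` set_mset (add_mset x A) \<subseteq> carrier G"
    using add.prems by auto
  moreover have "mprod c (A + B) = mprod c A \<otimes> mprod c B"
    using add.prems by (intro add.IH) auto
  ultimately show ?case
    by (simp only: mprod_add_mset union_mset_add_mset_left m_assoc)
qed (simp add: mprod_closed)

lemma mprod_image:
  assumes "c ` f ` set_mset B \<subseteq> carrier G"
  shows "mprod c (image_mset f B) = mprod (\<lambda>x. c (f x)) B"
  using assms by (induction B) (simp_all add: mprod_add_mset image_image)

lemma mprod_cong:
  assumes "\<And>x. x \<in># B \<Longrightarrow> c x = d x" "d ` set_mset B \<subseteq> carrier G"
  shows "mprod c B = mprod d B"
  using assms by (induction B) (simp_all add: mprod_add_mset image_subset_iff)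

lemma mprod_Union:
  assumes "\<And>t. t \<in># T \<Longrightarrow> c ` set_mset (K t) \<subseteq> carrier G"
  shows "mprod c (\<Sum>t\<in>#T. K t) = mprod (\<lambda>t. mprod c (K t)) T"
  using assms
proof (induction T)
  case (add t T)
  have "mprod c (\<Sum>t\<in>#add_mset t T. K t) = mprod c (K t) \<otimes> mprod c (\<Sum>t\<in>#T. K t)"
    using add.prems by (simp, intro mprod_union) auto
  also have "\<dots> = mprod (\<lambda>t. mprod c (K t)) (add_mset t T)"
    using add by (subst mprod_add_mset) (auto intro!: mprod_closed)
  finally show ?case .
qed simp

lemma mprod_mset_set: "finite S \<Longrightarrow> c ` S \<subseteq> carrier G \<Longrightarrow> mprod c (mset_set S) = finprod G c S"
  unfolding mprod_def by (intro finprod_cong') auto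

end

lemma with_preorder_simps [simp]:
  "carrier (with_preorder M L) = carrier M" "monoid.mult (with_preorder M L) = monoid.mult M"
  "monoid.one (with_preorder M L) = monoid.one M" "ple (with_preorder M L) = L"
  by (simp_all add: with_preorder_def)

lemma comm_monoid_with_preorder [simp]: "comm_monoid (with_preorder M L) \<longleftrightarrow> comm_monoid M"
  unfolding comm_monoid_def monoid_def comm_monoid_axioms_def with_preorder_simps ..

lemma fun_monoid_simps [simp]:
  "carrier (fun_monoid C) = C" "monoid.mult (fun_monoid C) = (\<lambda>f g x. f x + g x)" "monoid.one (fun_monoid C) = (\<lambda>x. 0)"
  by (simp_all add: fun_monoid_def)

lemma comm_monoid_fun_monoid:
  assumes "(\<lambda>x. 0) \<in> C" "\<And>f g. f \<in> C \<Longrightarrow> g \<in> C \<Longrightarrow> (\<lambda>x. f x + g x) \<in> C"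
  shows "comm_monoid (fun_monoid C)"
  by (rule comm_monoidI) (use assms in \<open>auto simp: ac_simps\<close>)

lemma comm_monoid_preord_alg:
  assumes "comm_monoid M"
  shows "preordered_monoid (with_preorder M (alg_le M))"
proof -
  interpret comm_monoid M by fact
  have 1: "alg_le M x x" if "x \<in> carrier M" for x
    unfolding alg_le_def using that by (intro bexI[of _ "\<one>\<^bsub>M\<^esub>"]) auto
  have 2: "alg_le M x z" if c: "x \<in> carrier M" "alg_le M x y" "alg_le M y z" for x y z
  proof -
    obtain u v where "u \<in> carrier M" "x \<otimes>\<^bsub>M\<^esub> u = y" "v \<in> carrier M" "y \<otimes>\<^bsub>M\<^esub> v = z"
      using c by (auto simp: alg_le_def)
    then show ?thesis unfolding alg_le_def
      using c(1) by (intro bexI[of _ "u \<otimes>\<^bsub>M\<^esub> v"]) (auto simp flip: m_assoc)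
  qed
  have 3: "alg_le M (x \<otimes>\<^bsub>M\<^esub> z) (y \<otimes>\<^bsub>M\<^esub> z)" if c: "x \<in> carrier M" "z \<in> carrier M" "alg_le M x y" for x y z
  proof -
    obtain u where "u \<in> carrier M" "x \<otimes>\<^bsub>M\<^esub> u = y" using c by (auto simp: alg_le_def)
    then show ?thesis unfolding alg_le_def
      using c(1,2) by (intro bexI[of _ u]) (auto simp: m_ac)
  qed
  show ?thesis
    unfolding preordered_monoid_def using assms 1 2 3 by auto
qed

lemma quot_mult:
  assumes R: "equiv (carrier M) R"
    and cong: "\<And>x x' y y'. (x, x') \<in> R \<Longrightarrow> (y, y') \<in> R \<Longrightarrow> (x \<otimes>\<^bsub>M\<^esub> y, x' \<otimes>\<^bsub>M\<^esub> y') \<in> R"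
    and x: "x \<in> carrier M" "y \<in> carrier M"
  shows "monoid.mult (quot_monoid M R) (R `` {x}) (R `` {y}) = R `` {x \<otimes>\<^bsub>M\<^esub> y}"
proof -
  have "R `` {x' \<otimes>\<^bsub>M\<^esub> y'} = R `` {x \<otimes>\<^bsub>M\<^esub> y}" if "x' \<in> R `` {x}" "y' \<in> R `` {y}" for x' y'
    using equiv_class_eq[OF R cong[of x x' y y']] that by auto
  then have "(\<Union>x'\<in>R `` {x}. \<Union>y'\<in>R `` {y}. R `` {x' \<otimes>\<^bsub>M\<^esub> y'}) =
      (\<Union>x'\<in>R `` {x}. \<Union>y'\<in>R `` {y}. R `` {x \<otimes>\<^bsub>M\<^esub> y})"
    by (intro SUP_cong refl)
  moreover have "x \<in> R `` {x}" "y \<in> R `` {y}" using equiv_class_self[OF R] x by auto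
  ultimately show ?thesis unfolding quot_monoid_def by (simp del: Image_singleton_iff) blast
qed

lemma quot_comm_monoid:
  assumes M: "comm_monoid M" and R: "equiv (carrier M) R"
    and cong: "\<And>x x' y y'. (x, x') \<in> R \<Longrightarrow> (y, y') \<in> R \<Longrightarrow> (x \<otimes>\<^bsub>M\<^esub> y, x' \<otimes>\<^bsub>M\<^esub> y') \<in> R"
  shows "comm_monoid (quot_monoid M R)"
proof -
  interpret comm_monoid M by fact
  have c: "carrier (quot_monoid M R) = carrier M // R" and o: "monoid.one (quot_monoid M R) = R `` {\<one>\<^bsub>M\<^esub>}"
    by (simp_all add: quot_monoid_def)
  note m = quot_mult[OF R cong]
  show ?thesis
  proof (rule comm_monoidI)
    fix X Y assume "X \<in> carrier (quot_monoid M R)" "Y \<in> carrier (quot_monoid M R)"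
    then obtain x y where "x \<in> carrier M" "X = R `` {x}" "y \<in> carrier M" "Y = R `` {y}"
      unfolding c by (meson quotientE)
    then show "X \<otimes>\<^bsub>quot_monoid M R\<^esub> Y \<in> carrier (quot_monoid M R)"
      "X \<otimes>\<^bsub>quot_monoid M R\<^esub> Y = Y \<otimes>\<^bsub>quot_monoid M R\<^esub> X"
      by (simp_all add: m c quotientI m_comm)
  next
    show "\<one>\<^bsub>quot_monoid M R\<^esub> \<in> carrier (quot_monoid M R)" by (simp add: c o quotientI)
  next
    fix X Y Z assume "X \<in> carrier (quot_monoid M R)" "Y \<in> carrier (quot_monoid M R)" "Z \<in> carrier (quot_monoid M R)"
    then obtain x y z where "x \<in> carrier M" "X = R `` {x}" "y \<in> carrier M" "Y = R `` {y}" "z \<in> carrier M" "Z = R `` {z}"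
      unfolding c by (meson quotientE)
    then show "X \<otimes>\<^bsub>quot_monoid M R\<^esub> Y \<otimes>\<^bsub>quot_monoid M R\<^esub> Z = X \<otimes>\<^bsub>quot_monoid M R\<^esub> (Y \<otimes>\<^bsub>quot_monoid M R\<^esub> Z)"
      by (simp add: m m_assoc)
  next
    fix X assume "X \<in> carrier (quot_monoid M R)"
    then obtain x where "x \<in> carrier M" "X = R `` {x}" unfolding c by (meson quotientE)
    then show "\<one>\<^bsub>quot_monoid M R\<^esub> \<otimes>\<^bsub>quot_monoid M R\<^esub> X = X" by (simp add: m o)
  qed
qed

text \<open>
  \<open>N\<close> is an image of the monoid of functions \<open>C\<close> under \<open>q\<close>. The kernel of \<open>q\<close> is kept separate: it
  is what distinguishes the monoids below.
\<close>

definition presents :: "('x \<Rightarrow> nat) set \<Rightarrow> (('x \<Rightarrow> nat) \<Rightarrow> 'a) \<Rightarrow> ('a, 'm) monoid_scheme \<Rightarrow> bool" where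
  "presents C q N \<longleftrightarrow> comm_monoid N \<and> q ` C = carrier N \<and> q (\<lambda>x. 0) = \<one>\<^bsub>N\<^esub> \<and>
     (\<forall>f\<in>C. \<forall>g\<in>C. q (\<lambda>x. f x + g x) = q f \<otimes>\<^bsub>N\<^esub> q g)"

lemma presents_with_preorder [simp]: "presents C q (with_preorder N L) \<longleftrightarrow> presents C q N"
  by (simp add: presents_def)

text \<open>
  The map \<open>t\<close> has to reach each element of \<open>M\<close> only up to \<open>R\<close>. This is the situation of \<open>\<tau>\<close>, whose
  image is a small part of \<open>C\<^sub>c(E\<^sup>\<infinity>, \<nat>)\<close>.
\<close>

lemma presents_quotient:
  assumes M: "comm_monoid M" and R: "equiv (carrier M) R"
    and cong: "\<And>x x' y y'. (x, x') \<in> R \<Longrightarrow> (y, y') \<in> R \<Longrightarrow> (x \<otimes>\<^bsub>M\<^esub> y, x' \<otimes>\<^bsub>M\<^esub> y') \<in> R"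
    and t: "\<And>f. f \<in> C \<Longrightarrow> t f \<in> carrier M" "t (\<lambda>x. 0) = \<one>\<^bsub>M\<^esub>"
      "\<And>f g. f \<in> C \<Longrightarrow> g \<in> C \<Longrightarrow> t (\<lambda>x. f x + g x) = t f \<otimes>\<^bsub>M\<^esub> t g"
    and surj: "\<And>y. y \<in> carrier M \<Longrightarrow> \<exists>f\<in>C. (y, t f) \<in> R"
  shows "presents C (\<lambda>f. R `` {t f}) (quot_monoid M R)"
proof -
  have "(\<lambda>f. R `` {t f}) ` C = carrier M // R"
  proof (intro equalityI subsetI)
    fix X assume "X \<in> carrier M // R"
    then obtain y where y: "y \<in> carrier M" "X = R `` {y}" by (rule quotientE)
    then obtain f where "f \<in> C" "(y, t f) \<in> R" using surj by blast
    then show "X \<in> (\<lambda>f. R `` {t f}) ` C" using y equiv_class_eq[OF R] by blast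
  qed (use t(1) in \<open>auto intro: quotientI\<close>)
  then show ?thesis
    unfolding presents_def using quot_comm_monoid[OF M R cong] quot_mult[OF R cong] t
    by (auto simp: quot_monoid_def)
qed

text \<open>
  Two images of the same monoid are isomorphic as soon as the kernels and the pulled back orders
  agree. No computation in \<open>N1\<close> or \<open>N2\<close> is left to do.
\<close>

lemma preord_iso_of_presentations:
  assumes p1: "presents C q1 N1" and p2: "presents C q2 N2"
    and pre: "preordered_monoid N1" "preordered_monoid N2"
    and zero: "(\<lambda>x. 0) \<in> C" and add: "\<And>f g. f \<in> C \<Longrightarrow> g \<in> C \<Longrightarrow> (\<lambda>x. f x + g x) \<in> C"
    and ker: "\<And>f g. f \<in> C \<Longrightarrow> g \<in> C \<Longrightarrow> q1 f = q1 g \<longleftrightarrow> q2 f = q2 g"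
    and ord: "\<And>f g. f \<in> C \<Longrightarrow> g \<in> C \<Longrightarrow> ple N1 (q1 f) (q1 g) \<longleftrightarrow> ple N2 (q2 f) (q2 g)"
  shows "\<exists>\<phi>\<in>preord_iso N1 N2. \<forall>f\<in>C. \<phi> (q1 f) = q2 f"
proof -
  define \<phi> where "\<phi> x = q2 (SOME f. f \<in> C \<and> q1 f = x)" for x
  have \<phi>: "\<phi> (q1 f) = q2 f" if "f \<in> C" for f
  proof -
    have "(SOME g. g \<in> C \<and> q1 g = q1 f) \<in> C \<and> q1 (SOME g. g \<in> C \<and> q1 g = q1 f) = q1 f"
      by (rule someI[of _ f]) (use that in simp)
    then show ?thesis unfolding \<phi>_def using ker that by blast
  qed
  have c1: "carrier N1 = q1 ` C" and c2: "carrier N2 = q2 ` C" using p1 p2 by (auto simp: presents_def)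
  have m1: "q1 f \<otimes>\<^bsub>N1\<^esub> q1 g = q1 (\<lambda>x. f x + g x)" and m2: "q2 f \<otimes>\<^bsub>N2\<^esub> q2 g = q2 (\<lambda>x. f x + g x)"
    if "f \<in> C" "g \<in> C" for f g using p1 p2 that by (auto simp: presents_def)
  have "\<phi> \<in> hom N1 N2"
    unfolding hom_def c1 c2 using \<phi> m1 m2 add by auto
  moreover have "bij_betw \<phi> (carrier N1) (carrier N2)"
    unfolding bij_betw_def c1 c2 using \<phi> ker by (auto simp: inj_on_def image_image)
  moreover have "\<phi> \<one>\<^bsub>N1\<^esub> = \<one>\<^bsub>N2\<^esub>" using \<phi>[OF zero] p1 p2 by (simp add: presents_def)
  moreover have "\<forall>x\<in>carrier N1. \<forall>y\<in>carrier N1. ple N1 x y \<longleftrightarrow> ple N2 (\<phi> x) (\<phi> y)"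
    unfolding c1 using \<phi> ord by auto
  ultimately have "\<phi> \<in> preord_iso N1 N2" unfolding preord_iso_def iso_def using pre by blast
  then show ?thesis using \<phi> by blast
qed

lemma tilde_equiv: "preordered_monoid P \<Longrightarrow> equiv (carrier P) (tilde_rel P)"
  unfolding preordered_monoid_def tilde_rel_def
  by (intro equivI) (auto simp: refl_on_def sym_def trans_def)

lemma tilde_cong:
  assumes P: "preordered_monoid P" and xy: "(x, x') \<in> tilde_rel P" "(y, y') \<in> tilde_rel P"
  shows "(x \<otimes>\<^bsub>P\<^esub> y, x' \<otimes>\<^bsub>P\<^esub> y') \<in> tilde_rel P"
proof -
  interpret comm_monoid P using P by (simp add: preordered_monoid_def)
  have c: "x \<in> carrier P" "x' \<in> carrier P" "y \<in> carrier P" "y' \<in> carrier P"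
    and le: "ple P x x'" "ple P x' x" "ple P y y'" "ple P y' y" using xy by (auto simp: tilde_rel_def)
  have mono: "ple P (u \<otimes>\<^bsub>P\<^esub> w) (v \<otimes>\<^bsub>P\<^esub> w)" if "u \<in> carrier P" "v \<in> carrier P" "w \<in> carrier P" "ple P u v" for u v w
    using P that unfolding preordered_monoid_def by blast
  have tr: "ple P u w" if "u \<in> carrier P" "v \<in> carrier P" "w \<in> carrier P" "ple P u v" "ple P v w" for u v w
    using P that unfolding preordered_monoid_def by blast
  have "ple P (x \<otimes>\<^bsub>P\<^esub> y) (x' \<otimes>\<^bsub>P\<^esub> y')"
    using tr[of "x \<otimes>\<^bsub>P\<^esub> y" "x' \<otimes>\<^bsub>P\<^esub> y" "x' \<otimes>\<^bsub>P\<^esub> y'"] mono[of x x' y] mono[of y y' x'] c le m_comm by simp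
  moreover have "ple P (x' \<otimes>\<^bsub>P\<^esub> y') (x \<otimes>\<^bsub>P\<^esub> y)"
    using tr[of "x' \<otimes>\<^bsub>P\<^esub> y'" "x \<otimes>\<^bsub>P\<^esub> y'" "x \<otimes>\<^bsub>P\<^esub> y"] mono[of x' x y'] mono[of y' y x] c le m_comm by simp
  ultimately show ?thesis using c by (simp add: tilde_rel_def)
qed

lemma tilde_class_eq_iff:
  "preordered_monoid P \<Longrightarrow> x \<in> carrier P \<Longrightarrow> y \<in> carrier P \<Longrightarrow>
   tilde_rel P `` {x} = tilde_rel P `` {y} \<longleftrightarrow> ple P x y \<and> ple P y x"
  using eq_equiv_class_iff[OF tilde_equiv, of P x y] by (simp add: tilde_rel_def)

text \<open>
  A relation between some representatives of two classes holds between all of them, by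
  transitivity.
\<close>

lemma tilde_le:
  assumes P: "preordered_monoid P" and x: "x \<in> carrier P" "y \<in> carrier P"
  shows "ple (tilde P) (tilde_rel P `` {x}) (tilde_rel P `` {y}) \<longleftrightarrow> ple P x y"
proof -
  have tr: "ple P u w" if "u \<in> carrier P" "v \<in> carrier P" "w \<in> carrier P" "ple P u v" "ple P v w" for u v w
    using P that unfolding preordered_monoid_def by blast
  have self: "x \<in> tilde_rel P `` {x}" "y \<in> tilde_rel P `` {y}" using equiv_class_self[OF tilde_equiv[OF P]] x by auto
  show ?thesis
  proof
    assume "ple (tilde P) (tilde_rel P `` {x}) (tilde_rel P `` {y})"
    then obtain x' y' where "(x, x') \<in> tilde_rel P" "(y, y') \<in> tilde_rel P" "ple P x' y'"
      by (auto simp: tilde_def quot_le_def)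
    then have "x' \<in> carrier P" "y' \<in> carrier P" "ple P x x'" "ple P x' y'" "ple P y' y" by (auto simp: tilde_rel_def)
    then show "ple P x y" using tr[of x x' y] tr[of x' y' y] x by blast
  next
    assume "ple P x y"
    then show "ple (tilde P) (tilde_rel P `` {x}) (tilde_rel P `` {y})"
      using self by (auto simp: tilde_def quot_le_def)
  qed
qed

lemma tilde_carrier: "carrier (tilde P) = carrier P // tilde_rel P"
  by (simp add: tilde_def quot_monoid_def)

lemma tilde_mult:
  assumes "preordered_monoid P" "x \<in> carrier P" "y \<in> carrier P"
  shows "tilde_rel P `` {x} \<otimes>\<^bsub>tilde P\<^esub> tilde_rel P `` {y} = tilde_rel P `` {x \<otimes>\<^bsub>P\<^esub> y}"
  using quot_mult[OF tilde_equiv[OF assms(1)] tilde_cong[OF assms(1)] assms(2,3)] by (simp add: tilde_def)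

lemma tilde_ordered:
  assumes P: "preordered_monoid P"
  shows "ordered_monoid (tilde P)"
proof -
  interpret comm_monoid P using P by (simp add: preordered_monoid_def)
  have cm: "comm_monoid (tilde P)"
    using quot_comm_monoid[OF comm_monoid_axioms tilde_equiv[OF P] tilde_cong[OF P]] by (simp add: tilde_def)
  have rep: "\<exists>x\<in>carrier P. X = tilde_rel P `` {x}" if "X \<in> carrier (tilde P)" for X
    using that unfolding tilde_carrier by (meson quotientE)
  have P': "\<And>x. x \<in> carrier P \<Longrightarrow> ple P x x"
    "\<And>x y z. x \<in> carrier P \<Longrightarrow> y \<in> carrier P \<Longrightarrow> z \<in> carrier P \<Longrightarrow> ple P x y \<Longrightarrow> ple P y z \<Longrightarrow> ple P x z"
    "\<And>x y z. x \<in> carrier P \<Longrightarrow> y \<in> carrier P \<Longrightarrow> z \<in> carrier P \<Longrightarrow> ple P x y \<Longrightarrow> ple P (x \<otimes>\<^bsub>P\<^esub> z) (y \<otimes>\<^bsub>P\<^esub> z)"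
    using P unfolding preordered_monoid_def by blast+
  have 1: "ple (tilde P) X X" if "X \<in> carrier (tilde P)" for X
    using rep[OF that] P'(1) tilde_le[OF P] by auto
  have 2: "ple (tilde P) X Z"
    if XYZ: "X \<in> carrier (tilde P)" "Y \<in> carrier (tilde P)" "Z \<in> carrier (tilde P)" "ple (tilde P) X Y" "ple (tilde P) Y Z" for X Y Z
  proof -
    obtain x y z where "x \<in> carrier P" "X = tilde_rel P `` {x}" "y \<in> carrier P" "Y = tilde_rel P `` {y}"
      "z \<in> carrier P" "Z = tilde_rel P `` {z}" using rep XYZ(1-3) by metis
    then show ?thesis using XYZ(4,5) P'(2)[of x y z] by (simp add: tilde_le[OF P])
  qed
  have 3: "ple (tilde P) (X \<otimes>\<^bsub>tilde P\<^esub> Z) (Y \<otimes>\<^bsub>tilde P\<^esub> Z)"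
    if XYZ: "X \<in> carrier (tilde P)" "Y \<in> carrier (tilde P)" "Z \<in> carrier (tilde P)" "ple (tilde P) X Y" for X Y Z
  proof -
    obtain x y z where "x \<in> carrier P" "X = tilde_rel P `` {x}" "y \<in> carrier P" "Y = tilde_rel P `` {y}"
      "z \<in> carrier P" "Z = tilde_rel P `` {z}" using rep XYZ(1-3) by metis
    then show ?thesis using XYZ(4) P'(3)[of x y z] by (simp add: tilde_le[OF P] tilde_mult[OF P])
  qed
  have 4: "X = Y" if XY: "X \<in> carrier (tilde P)" "Y \<in> carrier (tilde P)" "ple (tilde P) X Y" "ple (tilde P) Y X" for X Y
  proof -
    obtain x y where "x \<in> carrier P" "X = tilde_rel P `` {x}" "y \<in> carrier P" "Y = tilde_rel P `` {y}"
      using rep XY(1,2) by metis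
    then show ?thesis using XY(3,4) by (simp add: tilde_le[OF P] tilde_class_eq_iff[OF P])
  qed
  show ?thesis unfolding ordered_monoid_def preordered_monoid_def using cm 1 2 3 4 by blast
qed

lemma presents_tilde:
  assumes P: "preordered_monoid P"
    and t: "\<And>f. f \<in> C \<Longrightarrow> t f \<in> carrier P" "t (\<lambda>x. 0) = \<one>\<^bsub>P\<^esub>"
      "\<And>f g. f \<in> C \<Longrightarrow> g \<in> C \<Longrightarrow> t (\<lambda>x. f x + g x) = t f \<otimes>\<^bsub>P\<^esub> t g"
    and surj: "\<And>y. y \<in> carrier P \<Longrightarrow> \<exists>f\<in>C. (y, t f) \<in> tilde_rel P"
  shows "presents C (\<lambda>f. tilde_rel P `` {t f}) (tilde P)"
proof -
  have M: "comm_monoid P" using P by (simp add: preordered_monoid_def)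
  have "presents C (\<lambda>f. tilde_rel P `` {t f}) (quot_monoid P (tilde_rel P))"
    by (rule presents_quotient[OF M tilde_equiv[OF P]]) (fact tilde_cong[OF P] t surj)+
  then show ?thesis unfolding tilde_def presents_with_preorder .
qed

section \<open>Self-similar actions\<close>

locale ss_graph =
  fixes A :: "('v, 'e, 'g) ss_action"
  assumes ss: "self_similar_action A"
    and rf: "row_finite_no_sources (sgraph A)"
begin

abbreviation Gr :: "'g monoid" where "Gr \<equiv> sgroup A"

sublocale wf_digraph "sgraph A"
  using ss by (simp add: self_similar_action_def)

sublocale Gr: group "sgroup A"
  using ss by (simp add: self_similar_action_def)

sublocale V: group_action "sgroup A" "E0 A" "vact A"
  using ss by (simp add: self_similar_action_def)

sublocale E: group_action "sgroup A" "E1 A" "eact A"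
  using ss by (simp add: self_similar_action_def)

lemma rg_eact [simp]: "g \<in> carrier Gr \<Longrightarrow> e \<in> E1 A \<Longrightarrow> rg A (eact A g e) = vact A g (rg A e)"
  and so_eact [simp]: "g \<in> carrier Gr \<Longrightarrow> e \<in> E1 A \<Longrightarrow> so A (eact A g e) = vact A g (so A e)"
  and restr_closed [simp]: "g \<in> carrier Gr \<Longrightarrow> e \<in> E1 A \<Longrightarrow> restr A g e \<in> carrier Gr"
  and restr_mult: "g \<in> carrier Gr \<Longrightarrow> h \<in> carrier Gr \<Longrightarrow> e \<in> E1 A \<Longrightarrow>
        restr A (g \<otimes>\<^bsub>Gr\<^esub> h) e = restr A g (eact A h e) \<otimes>\<^bsub>Gr\<^esub> restr A h e"
  and vact_restr_so [simp]: "g \<in> carrier Gr \<Longrightarrow> e \<in> E1 A \<Longrightarrow>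
        vact A (restr A g e) (so A e) = vact A g (so A e)"
  using ss unfolding self_similar_action_def by blast+

lemma vact_closed [simp]: "g \<in> carrier Gr \<Longrightarrow> v \<in> E0 A \<Longrightarrow> vact A g v \<in> E0 A"
  by (rule V.element_image) auto

lemma eact_closed [simp]: "g \<in> carrier Gr \<Longrightarrow> e \<in> E1 A \<Longrightarrow> eact A g e \<in> E1 A"
  by (rule E.element_image) auto

lemma vact_one [simp]: "v \<in> E0 A \<Longrightarrow> vact A \<one>\<^bsub>Gr\<^esub> v = v"
  by (metis V.id_eq_one restrict_apply')

lemma eact_one [simp]: "e \<in> E1 A \<Longrightarrow> eact A \<one>\<^bsub>Gr\<^esub> e = e"
  by (metis E.id_eq_one restrict_apply')

lemma vact_mult: "g \<in> carrier Gr \<Longrightarrow> h \<in> carrier Gr \<Longrightarrow> v \<in> E0 A \<Longrightarrow>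
    vact A (g \<otimes>\<^bsub>Gr\<^esub> h) v = vact A g (vact A h v)"
  by (rule V.composition_rule) auto

lemma eact_mult: "g \<in> carrier Gr \<Longrightarrow> h \<in> carrier Gr \<Longrightarrow> e \<in> E1 A \<Longrightarrow>
    eact A (g \<otimes>\<^bsub>Gr\<^esub> h) e = eact A g (eact A h e)"
  by (rule E.composition_rule) auto

lemma vact_inv_vact [simp]: "g \<in> carrier Gr \<Longrightarrow> v \<in> E0 A \<Longrightarrow> vact A (inv\<^bsub>Gr\<^esub> g) (vact A g v) = v"
  and vact_vact_inv [simp]: "g \<in> carrier Gr \<Longrightarrow> v \<in> E0 A \<Longrightarrow> vact A g (vact A (inv\<^bsub>Gr\<^esub> g) v) = v"
  by (simp_all flip: vact_mult)

lemma eact_inv_eact [simp]: "g \<in> carrier Gr \<Longrightarrow> e \<in> E1 A \<Longrightarrow> eact A (inv\<^bsub>Gr\<^esub> g) (eact A g e) = e"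
  and eact_eact_inv [simp]: "g \<in> carrier Gr \<Longrightarrow> e \<in> E1 A \<Longrightarrow> eact A g (eact A (inv\<^bsub>Gr\<^esub> g) e) = e"
  by (simp_all flip: eact_mult)

text \<open>
  The cocycle identity for \<open>1 = 1 \<cdot> 1\<close> says that \<open>1|\<^sub>e\<close> is idempotent.
\<close>

lemma restr_one [simp]: "e \<in> E1 A \<Longrightarrow> restr A \<one>\<^bsub>Gr\<^esub> e = \<one>\<^bsub>Gr\<^esub>"
  using restr_mult[of "\<one>\<^bsub>Gr\<^esub>" "\<one>\<^bsub>Gr\<^esub>" e] by simp

abbreviation edges_into :: "'v \<Rightarrow> 'e set" where
  "edges_into v \<equiv> {e \<in> E1 A. rg A e = v}"

lemma finite_edges_into [simp]: "v \<in> E0 A \<Longrightarrow> finite (edges_into v)"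
  and edges_into_nonempty: "v \<in> E0 A \<Longrightarrow> edges_into v \<noteq> {}"
  using rf unfolding row_finite_no_sources_def by blast+

lemma edges_into_vact:
  assumes "g \<in> carrier Gr" "v \<in> E0 A"
  shows "edges_into (vact A g v) = eact A g ` edges_into v"
proof (intro equalityI subsetI)
  fix e assume e: "e \<in> edges_into (vact A g v)"
  then have "eact A (inv\<^bsub>Gr\<^esub> g) e \<in> edges_into v" "e = eact A g (eact A (inv\<^bsub>Gr\<^esub> g) e)"
    using assms by auto
  then show "e \<in> eact A g ` edges_into v" by blast
qed (use assms in auto)

lemma inj_on_eact: "g \<in> carrier Gr \<Longrightarrow> inj_on (eact A g) (E1 A)"
  by (rule inj_on_inverseI[where g="eact A (inv\<^bsub>Gr\<^esub> g)"]) simp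

section \<open>Finite paths\<close>

lemma paths_Nil [simp]: "(v, []) \<in> paths A \<longleftrightarrow> v \<in> E0 A"
  by (simp add: paths_def)

lemma paths_Cons: "(v, e # es) \<in> paths A \<longleftrightarrow> e \<in> E1 A \<and> rg A e = v \<and> (so A e, es) \<in> paths A"
  by (cases es) (auto simp: paths_def)

lemma path_so_Nil [simp]: "path_so A (v, []) = v"
  and path_so_Cons [simp]: "path_so A (v, e # es) = path_so A (so A e, es)"
  by (simp_all add: path_so_def)

lemma path_so_in: "\<beta> \<in> paths A \<Longrightarrow> path_so A \<beta> \<in> E0 A"
proof -
  have "(v, es) \<in> paths A \<Longrightarrow> path_so A (v, es) \<in> E0 A" for v es
    by (induction es arbitrary: v) (auto simp: paths_Cons)
  then show "\<beta> \<in> paths A \<Longrightarrow> path_so A \<beta> \<in> E0 A" by (cases \<beta>) auto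
qed

lemma fst_path_in: "\<beta> \<in> paths A \<Longrightarrow> fst \<beta> \<in> E0 A"
  by (auto simp: paths_def)

lemma path_edges: "(v, es) \<in> paths A \<Longrightarrow> set es \<subseteq> E1 A"
  by (auto simp: paths_def)

lemma paths_append:
  "(v, es @ fs) \<in> paths A \<longleftrightarrow> (v, es) \<in> paths A \<and> (path_so A (v, es), fs) \<in> paths A"
proof (induction es arbitrary: v)
  case Nil
  then show ?case using fst_path_in by fastforce
qed (auto simp: paths_Cons)

lemma path_so_append: "path_so A (v, es @ fs) = path_so A (path_so A (v, es), fs)"
  by (induction es arbitrary: v) auto

lemma list_act_append:
  "list_act A g (es @ fs) = list_act A g es @ list_act A (list_restr A g es) fs"
  by (induction es arbitrary: g) auto

lemma list_restr_append: "list_restr A g (es @ fs) = list_restr A (list_restr A g es) fs"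
  by (induction es arbitrary: g) auto

lemma length_list_act [simp]: "length (list_act A g es) = length es"
  by (induction es arbitrary: g) auto

lemma list_act_one [simp]: "set es \<subseteq> E1 A \<Longrightarrow> list_act A \<one>\<^bsub>Gr\<^esub> es = es"
  and list_restr_one [simp]: "set es \<subseteq> E1 A \<Longrightarrow> list_restr A \<one>\<^bsub>Gr\<^esub> es = \<one>\<^bsub>Gr\<^esub>"
  by (induction es) auto

lemma list_restr_closed [simp]:
  "g \<in> carrier Gr \<Longrightarrow> set es \<subseteq> E1 A \<Longrightarrow> list_restr A g es \<in> carrier Gr"
  by (induction es arbitrary: g) auto

lemma list_act_path:
  assumes "g \<in> carrier Gr" "(v, es) \<in> paths A"
  shows "(vact A g v, list_act A g es) \<in> paths A"
    and "path_so A (vact A g v, list_act A g es) = vact A (list_restr A g es) (path_so A (v, es))"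
proof -
  have "(vact A g v, list_act A g es) \<in> paths A \<and>
    path_so A (vact A g v, list_act A g es) = vact A (list_restr A g es) (path_so A (v, es))"
    using assms
  proof (induction es arbitrary: g v)
    case (Cons e es)
    then have e: "e \<in> E1 A" "rg A e = v" "(so A e, es) \<in> paths A" by (auto simp: paths_Cons)
    show ?case using Cons.IH[of "restr A g e" "so A e"] e Cons.prems(1) by (simp add: paths_Cons)
  qed auto
  then show "(vact A g v, list_act A g es) \<in> paths A"
    and "path_so A (vact A g v, list_act A g es) = vact A (list_restr A g es) (path_so A (v, es))"
    by auto
qed

definition path_extend :: "('v, 'e) gpath \<Rightarrow> 'e list \<Rightarrow> ('v, 'e) gpath" where
  "path_extend \<beta> es = (fst \<beta>, snd \<beta> @ es)"

lemma path_extend_Nil [simp]: "path_extend \<beta> [] = \<beta>"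
  by (simp add: path_extend_def)

lemma path_extend_append: "path_extend \<beta> (es @ fs) = path_extend (path_extend \<beta> es) fs"
  by (simp add: path_extend_def)

lemma path_extend_simps [simp]:
  "fst (path_extend \<beta> es) = fst \<beta>" "snd (path_extend \<beta> es) = snd \<beta> @ es"
  by (simp_all add: path_extend_def)

lemma path_extend_in:
  "\<beta> \<in> paths A \<Longrightarrow> (path_so A \<beta>, es) \<in> paths A \<Longrightarrow> path_extend \<beta> es \<in> paths A"
  by (cases \<beta>) (simp add: path_extend_def paths_append)

lemma path_so_extend: "path_so A (path_extend \<beta> es) = path_so A (path_so A \<beta>, es)"
  by (cases \<beta>) (simp add: path_extend_def path_so_append)

section \<open>Infinite paths and cylinders\<close>

lemma inf_paths_SCons:
  "e ## \<eta> \<in> inf_paths A \<longleftrightarrow> e \<in> E1 A \<and> \<eta> \<in> inf_paths A \<and> so A e = inf_rg A \<eta>"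
proof
  assume "e ## \<eta> \<in> inf_paths A"
  then have *: "e \<in> E1 A" "sset \<eta> \<subseteq> E1 A" "\<And>i. so A ((e ## \<eta>) !! i) = rg A ((e ## \<eta>) !! Suc i)"
    by (auto simp: inf_paths_def)
  show "e \<in> E1 A \<and> \<eta> \<in> inf_paths A \<and> so A e = inf_rg A \<eta>"
    using * *(3)[of 0] *(3)[of "Suc i" for i] by (auto simp: inf_paths_def inf_rg_def)
next
  assume *: "e \<in> E1 A \<and> \<eta> \<in> inf_paths A \<and> so A e = inf_rg A \<eta>"
  have "so A ((e ## \<eta>) !! i) = rg A ((e ## \<eta>) !! Suc i)" for i
    using * by (cases i) (auto simp: inf_paths_def inf_rg_def)
  then show "e ## \<eta> \<in> inf_paths A" using * by (auto simp: inf_paths_def)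
qed

lemma inf_rg_SCons [simp]: "inf_rg A (e ## \<eta>) = rg A e"
  by (simp add: inf_rg_def)

lemma inf_rg_in: "x \<in> inf_paths A \<Longrightarrow> inf_rg A x \<in> E0 A"
  by (cases x) (auto simp: inf_paths_SCons)

text \<open>
  The basic fact about concatenation; everything about initial segments and tails of infinite paths
  is read off from it.
\<close>

lemma shift_inf_paths:
  "es @- \<eta> \<in> inf_paths A \<and> inf_rg A (es @- \<eta>) = v \<longleftrightarrow>
   \<eta> \<in> inf_paths A \<and> (v, es) \<in> paths A \<and> path_so A (v, es) = inf_rg A \<eta>"
proof (induction es arbitrary: v)
  case Nil
  show ?case using inf_rg_in[of \<eta>] by auto
next
  case (Cons e es)
  have "(e # es) @- \<eta> \<in> inf_paths A \<and> inf_rg A ((e # es) @- \<eta>) = v \<longleftrightarrow>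
    e \<in> E1 A \<and> rg A e = v \<and> (es @- \<eta> \<in> inf_paths A \<and> inf_rg A (es @- \<eta>) = so A e)"
    by (auto simp: inf_paths_SCons)
  then show ?case unfolding Cons.IH paths_Cons path_so_Cons by blast
qed

definition initial :: "nat \<Rightarrow> 'e stream \<Rightarrow> ('v, 'e) gpath" where
  "initial n x = (inf_rg A x, stake n x)"

lemma length_initial [simp]: "length (snd (initial n x)) = n"
  by (simp add: initial_def)

lemma initial_in: "x \<in> inf_paths A \<Longrightarrow> initial n x \<in> paths A"
  and sdrop_inf_paths: "x \<in> inf_paths A \<Longrightarrow> sdrop n x \<in> inf_paths A"
  and inf_rg_sdrop: "x \<in> inf_paths A \<Longrightarrow> inf_rg A (sdrop n x) = path_so A (initial n x)"
  using shift_inf_paths[of "stake n x" "sdrop n x" "inf_rg A x"]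
  by (auto simp: stake_sdrop initial_def)

lemma shift_in:
  "\<beta> \<in> paths A \<Longrightarrow> \<eta> \<in> inf_paths A \<Longrightarrow> inf_rg A \<eta> = path_so A \<beta> \<Longrightarrow>
   snd \<beta> @- \<eta> \<in> inf_paths A \<and> initial (length (snd \<beta>)) (snd \<beta> @- \<eta>) = \<beta>"
  using shift_inf_paths[of "snd \<beta>" \<eta> "fst \<beta>"] by (auto simp: initial_def stake_shift)

lemma mem_cyl:
  assumes "\<beta> \<in> paths A"
  shows "x \<in> cyl A \<beta> \<longleftrightarrow> x \<in> inf_paths A \<and> initial (length (snd \<beta>)) x = \<beta>"
proof
  assume "x \<in> cyl A \<beta>"
  then show "x \<in> inf_paths A \<and> initial (length (snd \<beta>)) x = \<beta>"
    using shift_in[OF assms] by (auto simp: cyl_def)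
next
  assume x: "x \<in> inf_paths A \<and> initial (length (snd \<beta>)) x = \<beta>"
  then have "x = snd \<beta> @- sdrop (length (snd \<beta>)) x"
    by (metis stake_sdrop initial_def snd_conv)
  moreover have "inf_rg A (sdrop (length (snd \<beta>)) x) = path_so A \<beta>"
    using x inf_rg_sdrop by fastforce
  ultimately show "x \<in> cyl A \<beta>" using x sdrop_inf_paths unfolding cyl_def by blast
qed

lemma mem_cyl_initial: "x \<in> inf_paths A \<Longrightarrow> y \<in> cyl A (initial n x) \<longleftrightarrow> y \<in> inf_paths A \<and> initial n y = initial n x"
  by (simp add: mem_cyl initial_in)

lemma self_mem_cyl_initial: "x \<in> inf_paths A \<Longrightarrow> x \<in> cyl A (initial n x)"
  by (simp add: mem_cyl_initial)

lemma cyl_subset: "\<beta> \<in> paths A \<Longrightarrow> cyl A \<beta> \<subseteq> inf_paths A"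
  by (auto simp: mem_cyl)

lemma cyl_Nil: "v \<in> E0 A \<Longrightarrow> cyl A (v, []) = {x \<in> inf_paths A. inf_rg A x = v}"
  by (auto simp: mem_cyl initial_def)

lemma initial_take: "n \<le> m \<Longrightarrow> initial n x = (fst (initial m x), take n (snd (initial m x)))"
  by (simp add: initial_def take_stake min_absorb1)

lemma initial_mono: "n \<le> m \<Longrightarrow> initial m x = initial m y \<Longrightarrow> initial n x = initial n y"
  using initial_take by metis

lemma initial_extend: "n \<le> m \<Longrightarrow> initial m x = path_extend (initial n x) (stake (m - n) (sdrop n x))"
  by (simp add: initial_def path_extend_def stake_add)

text \<open>
  This is where the absence of sources is used: choosing an edge into each vertex gives an infinite
  path.
\<close>

lemma ex_inf_path: 
  assumes "v \<in> E0 A"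
  shows "\<exists>x\<in>inf_paths A. inf_rg A x = v"
proof -
  define c where "c w = (SOME e. e \<in> edges_into w)" for w
  have c: "c w \<in> edges_into w" if "w \<in> E0 A" for w
    using edges_into_nonempty[OF that] unfolding c_def by (metis (mono_tags, lifting) ex_in_conv someI_ex)
  define x where "x = smap c (siterate (\<lambda>w. so A (c w)) v)"
  have w: "((\<lambda>w. so A (c w)) ^^ n) v \<in> E0 A" for n
    by (induction n) (use assms c in auto)
  have "x \<in> inf_paths A"
    unfolding inf_paths_def x_def using c[OF w] c[OF w[of "Suc i" for i]]
    by (auto simp: sset_range funpow_swap1[where f = "\<lambda>w. so A (c w)", symmetric])
  moreover have "inf_rg A x = v" unfolding x_def inf_rg_def using c assms by auto
  ultimately show ?thesis by blast
qed

lemma ex_in_cyl: "\<beta> \<in> paths A \<Longrightarrow> \<exists>x. x \<in> cyl A \<beta>"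
  using ex_inf_path[OF path_so_in] unfolding cyl_def by blast

lemma cyl_extend_iff:
  assumes "\<beta> \<in> paths A" "(path_so A \<beta>, es) \<in> paths A" "x \<in> cyl A \<beta>"
  shows "x \<in> cyl A (path_extend \<beta> es) \<longleftrightarrow> sdrop (length (snd \<beta>)) x \<in> cyl A (path_so A \<beta>, es)"
proof -
  let ?n = "length (snd \<beta>)"
  have x: "x \<in> inf_paths A" "initial ?n x = \<beta>" using assms by (auto simp: mem_cyl)
  have "path_extend \<beta> (stake (length es) (sdrop ?n x)) = path_extend \<beta> es
     \<longleftrightarrow> stake (length es) (sdrop ?n x) = es"
    by (simp add: path_extend_def)
  moreover have "inf_rg A (sdrop ?n x) = path_so A \<beta>" using inf_rg_sdrop x by metis
  ultimately show ?thesis using assms x initial_extend[of ?n "?n + length es" x]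
    by (simp add: mem_cyl path_extend_in sdrop_inf_paths) (simp add: initial_def)
qed

lemma cyl_extend_subset:
  assumes "\<beta> \<in> paths A" "(path_so A \<beta>, es) \<in> paths A"
  shows "cyl A (path_extend \<beta> es) \<subseteq> cyl A \<beta>"
proof
  fix x assume x: "x \<in> cyl A (path_extend \<beta> es)"
  then have "x \<in> inf_paths A" "initial (length (snd \<beta>) + length es) x = path_extend \<beta> es"
    using assms by (auto simp: mem_cyl path_extend_in)
  then show "x \<in> cyl A \<beta>"
    using assms initial_take[of "length (snd \<beta>)" "length (snd \<beta>) + length es" x] by (simp add: mem_cyl)
qed

section \<open>Refinement of cylinders\<close>

text \<open>
  The paths of length \<open>n\<close> with range \<open>v\<close>, as lists of edges. The recursion takes off the first edge,
  because the action on a path passes the restriction \<open>g|\<^sub>e\<close> on from the front.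
\<close>

primrec path_mset :: "nat \<Rightarrow> 'v \<Rightarrow> 'e list multiset" where
  "path_mset 0 v = {#[]#}"
| "path_mset (Suc n) v =
     (\<Sum>e\<in>#mset_set (edges_into v). image_mset (Cons e) (path_mset n (so A e)))"

lemma in_path_mset:
  "v \<in> E0 A \<Longrightarrow> es \<in># path_mset n v \<longleftrightarrow> (v, es) \<in> paths A \<and> length es = n"
proof (induction n arbitrary: v es)
  case (Suc n)
  have "es \<in># path_mset (Suc n) v \<longleftrightarrow>
      (\<exists>e\<in>edges_into v. \<exists>fs. es = e # fs \<and> fs \<in># path_mset n (so A e))"
    using Suc.prems by auto
  also have "\<dots> \<longleftrightarrow> (v, es) \<in> paths A \<and> length es = Suc n"
    by (cases es) (auto simp: Suc.IH paths_Cons)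
  finally show ?case .
qed auto

text \<open>
  A group element maps the edges into \<open>v\<close> bijectively to the edges into \<open>gv\<close>; the restrictions
  \<open>g|\<^sub>e\<close> then act on the remaining paths, which is why the induction is over all \<open>g\<close>.
\<close>

lemma path_mset_act:
  assumes "g \<in> carrier Gr" "v \<in> E0 A"
  shows "path_mset n (vact A g v) = image_mset (list_act A g) (path_mset n v)"
  using assms
proof (induction n arbitrary: g v)
  case (Suc n)
  have inj: "inj_on (eact A g) (edges_into v)"
    using inj_on_eact[OF Suc.prems(1)] by (rule inj_on_subset) auto
  have "path_mset (Suc n) (vact A g v) =
      (\<Sum>e\<in>#mset_set (edges_into v). image_mset (Cons (eact A g e)) (path_mset n (so A (eact A g e))))"
    using Suc.prems edges_into_vact[OF Suc.prems] by (simp flip: image_mset_mset_set[OF inj] add: multiset.map_comp o_def)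
  also have "\<dots> = (\<Sum>e\<in>#mset_set (edges_into v).
      image_mset (list_act A g) (image_mset (Cons e) (path_mset n (so A e))))"
  proof (intro arg_cong[where f = sum_mset] image_mset_cong)
    fix e assume "e \<in># mset_set (edges_into v)"
    then have e: "e \<in> E1 A" using Suc.prems by auto
    then have "path_mset n (so A (eact A g e)) = image_mset (list_act A (restr A g e)) (path_mset n (so A e))"
      using Suc.IH[of "restr A g e" "so A e"] Suc.prems by simp
    then show "image_mset (Cons (eact A g e)) (path_mset n (so A (eact A g e))) =
        image_mset (list_act A g) (image_mset (Cons e) (path_mset n (so A e)))"
      by (simp add: multiset.map_comp o_def)
  qed
  also have "\<dots> = image_mset (list_act A g) (path_mset (Suc n) v)"
    by (simp add: image_mset_sum_mset multiset.map_comp o_def)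
  finally show ?case .
qed simp

text \<open>
  An infinite path has exactly one initial segment of length \<open>n\<close>.
\<close>

lemma path_mset_unique:
  assumes "x \<in> inf_paths A"
  shows "(\<Sum>es\<in>#path_mset n (inf_rg A x). indicator (cyl A (inf_rg A x, es)) x) = (1::nat)"
  using assms
proof (induction n arbitrary: x)
  case 0
  then show ?case using inf_rg_in[OF 0] by (simp add: cyl_Nil)
next
  case (Suc n)
  obtain e \<eta> where x: "x = e ## \<eta>" by (cases x)
  then have e: "e \<in> E1 A" "\<eta> \<in> inf_paths A" "so A e = inf_rg A \<eta>"
    using Suc.prems by (auto simp: inf_paths_SCons)
  let ?v = "rg A e"
  have v: "?v \<in> E0 A" using e by simp
  have *: "(indicator (cyl A (?v, f # es)) x :: nat) = (if f = e then indicator (cyl A (so A e, es)) \<eta> else 0)"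
    if "f \<in> edges_into ?v" "es \<in># path_mset n (so A f)" for f es
    using that e x Suc.prems
    by (auto simp: indicator_def mem_cyl paths_Cons in_path_mset initial_def split: if_splits)
  have "(\<Sum>es\<in>#path_mset (Suc n) ?v. indicator (cyl A (?v, es)) x) =
      (\<Sum>f\<in>#mset_set (edges_into ?v). \<Sum>es\<in>#path_mset n (so A f). (indicator (cyl A (?v, f # es)) x :: nat))"
    by (simp add: image_mset_sum_mset sum_mset_Union multiset.map_comp o_def)
  also have "\<dots> = (\<Sum>f\<in>#mset_set (edges_into ?v). if f = e then
        (\<Sum>es\<in>#path_mset n (so A e). indicator (cyl A (so A e, es)) \<eta>) else 0)"
    using v by (intro arg_cong[where f = sum_mset] image_mset_cong) (auto simp: * cong: image_mset_cong)
  also have "\<dots> = 1"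
    using Suc.IH[OF e(2)] v e by (simp flip: sum_unfold_sum_mset) 
  finally show ?case using x by simp
qed

definition cylsum :: "('v, 'e) gpath multiset \<Rightarrow> 'e stream \<Rightarrow> nat" where
  "cylsum B x = (\<Sum>\<beta>\<in>#B. indicator (cyl A \<beta>) x)"

lemma cylsum_empty [simp]: "cylsum {#} = (\<lambda>x. 0)"
  and cylsum_add_mset: "cylsum (add_mset \<beta> B) = (\<lambda>x. indicator (cyl A \<beta>) x + cylsum B x)"
  and cylsum_union: "cylsum (B + B') = (\<lambda>x. cylsum B x + cylsum B' x)"
  by (auto simp: cylsum_def)

lemma cylsum_Union: "cylsum (\<Sum>t\<in>#T. K t) = (\<lambda>x. \<Sum>t\<in>#T. cylsum (K t) x)"
  by (induction T) (auto simp: cylsum_union)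

definition level :: "nat \<Rightarrow> ('v, 'e) gpath set" where
  "level N = {\<beta> \<in> paths A. length (snd \<beta>) = N}"

text \<open>
  At a single level only the initial segment of \<open>x\<close> contributes to the sum at \<open>x\<close>.
\<close>

lemma cylsum_level:
  assumes "set_mset B \<subseteq> level N"
  shows "cylsum B x = (if x \<in> inf_paths A then count B (initial N x) else 0)"
  using assms
proof (induction B)
  case (add \<beta> B)
  then have "\<beta> \<in> paths A" "length (snd \<beta>) = N" by (auto simp: level_def)
  then show ?case using add by (auto simp: cylsum_add_mset mem_cyl indicator_def)
qed simp

text \<open>
  Cylinders are nonempty, so each multiplicity can be read off at a point of the cylinder.
\<close>

lemma cylsum_level_le:
  assumes B: "set_mset B \<subseteq> level N" and B': "set_mset B' \<subseteq> level N" and le: "cylsum B \<le> cylsum B'"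
  shows "B \<subseteq># B'"
proof (rule mset_subset_eqI)
  fix \<beta>
  show "count B \<beta> \<le> count B' \<beta>"
  proof (cases "\<beta> \<in># B")
    case True
    then have \<beta>: "\<beta> \<in> paths A" "length (snd \<beta>) = N" using B by (auto simp: level_def)
    then obtain x where "x \<in> cyl A \<beta>" using ex_in_cyl by blast
    then have "x \<in> inf_paths A" "initial N x = \<beta>" using \<beta> by (auto simp: mem_cyl)
    then show ?thesis using le_funD[OF le, of x] by (simp add: cylsum_level[OF B] cylsum_level[OF B'])
  qed (simp add: not_in_iff)
qed

lemma cylsum_level_inj:
  "set_mset B \<subseteq> level N \<Longrightarrow> set_mset B' \<subseteq> level N \<Longrightarrow> cylsum B = cylsum B' \<Longrightarrow> B = B'"
  by (intro subset_mset.antisym cylsum_level_le[where N = N]) auto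

text \<open>
  The extensions of \<open>\<beta>\<close> to paths of length \<open>N\<close>. If \<open>\<beta>\<close> is already longer, the subtraction gives zero
  and only \<open>\<beta>\<close> itself remains.
\<close>

definition refine :: "nat \<Rightarrow> ('v, 'e) gpath \<Rightarrow> ('v, 'e) gpath multiset" where
  "refine N \<beta> = image_mset (path_extend \<beta>) (path_mset (N - length (snd \<beta>)) (path_so A \<beta>))"

lemma refine_level:
  assumes "\<beta> \<in> paths A" "length (snd \<beta>) \<le> N"
  shows "set_mset (refine N \<beta>) \<subseteq> level N"
  using assms path_so_in[OF assms(1)] by (auto simp: refine_def level_def in_path_mset path_extend_in)

lemma cylsum_refine:
  assumes "\<beta> \<in> paths A"
  shows "cylsum (refine N \<beta>) = indicator (cyl A \<beta>)"
proof
  fix x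
  let ?n = "length (snd \<beta>)" and ?v = "path_so A \<beta>"
  have v: "?v \<in> E0 A" using path_so_in assms by blast
  have "cylsum (refine N \<beta>) x = (\<Sum>es\<in>#path_mset (N - ?n) ?v. indicator (cyl A (path_extend \<beta> es)) x)"
    by (simp add: cylsum_def refine_def multiset.map_comp o_def)
  also have "\<dots> = indicator (cyl A \<beta>) x"
  proof (cases "x \<in> cyl A \<beta>")
    case True
    then have x: "x \<in> inf_paths A" "initial ?n x = \<beta>" using assms by (auto simp: mem_cyl)
    have "(\<Sum>es\<in>#path_mset (N - ?n) ?v. indicator (cyl A (path_extend \<beta> es)) x :: nat) =
      (\<Sum>es\<in>#path_mset (N - ?n) ?v. indicator (cyl A (?v, es)) (sdrop ?n x))"
      using cyl_extend_iff[OF assms _ True] v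
      by (intro arg_cong[where f = sum_mset] image_mset_cong) (auto simp: indicator_def in_path_mset)
    also have "\<dots> = 1"
      using path_mset_unique[OF sdrop_inf_paths[OF x(1)], of ?n "N - ?n"]
        inf_rg_sdrop[OF x(1), of ?n] x(2) by simp
    finally show ?thesis using True by simp
  next
    case False
    have "(\<Sum>es\<in>#path_mset (N - ?n) ?v. indicator (cyl A (path_extend \<beta> es)) x :: nat) = 
       (\<Sum>es\<in>#path_mset (N - ?n) ?v. 0)"
      using cyl_extend_subset[OF assms] False v
      by (intro arg_cong[where f = sum_mset] image_mset_cong) (auto simp: indicator_def in_path_mset)
    then show ?thesis using False by simp
  qed
  finally show "cylsum (refine N \<beta>) x = indicator (cyl A \<beta>) x" .
qed

lemma path_so_refine:
  "image_mset (path_so A) (refine N \<beta>) =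
   image_mset (\<lambda>es. path_so A (path_so A \<beta>, es)) (path_mset (N - length (snd \<beta>)) (path_so A \<beta>))"
  by (simp add: refine_def multiset.map_comp o_def path_so_extend)

definition refine_all :: "nat \<Rightarrow> ('v, 'e) gpath multiset \<Rightarrow> ('v, 'e) gpath multiset" where
  "refine_all N B = (\<Sum>\<beta>\<in>#B. refine N \<beta>)"

lemma refine_all_level:
  "set_mset B \<subseteq> paths A \<Longrightarrow> \<forall>\<beta>\<in>#B. length (snd \<beta>) \<le> N \<Longrightarrow> set_mset (refine_all N B) \<subseteq> level N"
  using refine_level by (fastforce simp: refine_all_def)

lemma cylsum_refine_all: "set_mset B \<subseteq> paths A \<Longrightarrow> cylsum (refine_all N B) = cylsum B"
  unfolding refine_all_def cylsum_Union
  by (auto simp: fun_eq_iff cylsum_def[of B] cylsum_refine intro!: arg_cong[where f = sum_mset] image_mset_cong)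

lemma ex_length_bound: "\<exists>N. \<forall>\<beta>\<in>#B. length (snd (f \<beta>)) \<le> N"
  using finite_nat_set_iff_bounded_le[of "(\<lambda>\<beta>. length (snd (f \<beta>))) ` set_mset B"] by auto

section \<open>Triples\<close>

definition triples :: "(('v, 'e) gpath \<times> 'g \<times> ('v, 'e) gpath) set" where
  "triples = {t. Some t \<in> sgp_set A}"

lemma mem_triples: "(\<alpha>, g, \<beta>) \<in> triples \<longleftrightarrow>
  \<alpha> \<in> paths A \<and> g \<in> carrier Gr \<and> \<beta> \<in> paths A \<and> path_so A \<alpha> = vact A g (path_so A \<beta>)"
  unfolding triples_def sgp_set_def by blast

abbreviation tsrc :: "('v, 'e) gpath \<times> 'g \<times> ('v, 'e) gpath \<Rightarrow> ('v, 'e) gpath" where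
  "tsrc t \<equiv> snd (snd t)"

abbreviation trng :: "('v, 'e) gpath \<times> 'g \<times> ('v, 'e) gpath \<Rightarrow> ('v, 'e) gpath" where
  "trng t \<equiv> fst t"

abbreviation src_sum where "src_sum T \<equiv> cylsum (image_mset tsrc T)"
abbreviation rng_sum where "rng_sum T \<equiv> cylsum (image_mset trng T)"

lemma triples_paths: "t \<in> triples \<Longrightarrow> tsrc t \<in> paths A" "t \<in> triples \<Longrightarrow> trng t \<in> paths A"
  by (cases t; simp add: mem_triples)+

fun tinv :: "('v, 'e) gpath \<times> 'g \<times> ('v, 'e) gpath \<Rightarrow> ('v, 'e) gpath \<times> 'g \<times> ('v, 'e) gpath" where
  "tinv (\<alpha>, g, \<beta>) = (\<beta>, inv\<^bsub>Gr\<^esub> g, \<alpha>)"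

lemma tsrc_tinv [simp]: "tsrc (tinv t) = trng t" and trng_tinv [simp]: "trng (tinv t) = tsrc t"
  by (cases t; simp)+

lemma tinv_in: "t \<in> triples \<Longrightarrow> tinv t \<in> triples"
  by (cases t) (auto simp: mem_triples path_so_in)

text \<open>
  Restriction of the partial homeomorphism of the triple to the cylinder of a longer path.
\<close>

fun textend :: "('v, 'e) gpath \<times> 'g \<times> ('v, 'e) gpath \<Rightarrow> 'e list \<Rightarrow> ('v, 'e) gpath \<times> 'g \<times> ('v, 'e) gpath" where
  "textend (\<alpha>, g, \<beta>) es = (path_extend \<alpha> (list_act A g es), list_restr A g es, path_extend \<beta> es)"

lemma textend_in:
  assumes "t \<in> triples" "(path_so A (tsrc t), es) \<in> paths A"
  shows "textend t es \<in> triples"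
  using assms path_edges[OF assms(2)] list_act_path[of "fst (snd t)" "path_so A (tsrc t)" es]
  by (cases t) (auto simp: mem_triples path_extend_in path_so_extend)

definition trefine where
  "trefine N t = image_mset (textend t) (path_mset (N - length (snd (tsrc t))) (path_so A (tsrc t)))"

lemma trefine_triples:
  assumes "t \<in> triples"
  shows "set_mset (trefine N t) \<subseteq> triples"
proof
  fix u assume "u \<in># trefine N t"
  then obtain es where "u = textend t es" "es \<in># path_mset (N - length (snd (tsrc t))) (path_so A (tsrc t))"
    by (auto simp: trefine_def)
  then show "u \<in> triples"
    using textend_in[OF assms] path_so_in[OF triples_paths(1)[OF assms]] by (simp add: in_path_mset)
qed

lemma tsrc_trefine: "image_mset tsrc (trefine N t) = refine N (tsrc t)"
  by (cases t) (simp add: trefine_def refine_def multiset.map_comp o_def)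

lemma trng_trefine:
  assumes "t \<in> triples"
  shows "image_mset trng (trefine N t) = refine (N - length (snd (tsrc t)) + length (snd (trng t))) (trng t)"
proof -
  obtain \<alpha> g \<beta> where t: "t = (\<alpha>, g, \<beta>)" by (cases t)
  then have "path_so A \<alpha> = vact A g (path_so A \<beta>)" "g \<in> carrier Gr" "path_so A \<beta> \<in> E0 A"
    using assms by (auto simp: mem_triples path_so_in)
  then show ?thesis
    using t by (simp add: trefine_def refine_def multiset.map_comp o_def path_mset_act)
qed

text \<open>
  Every triple is replaced by its restrictions to the extensions of its source path. On the range side
  these run through all extensions of the range path, by \<open>path_mset_act\<close>, so both sums are kept.
\<close>

lemma ex_trefine_src:
  assumes T: "set_mset T \<subseteq> triples" and N: "\<forall>t\<in>#T. length (snd (tsrc t)) \<le> N"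
  obtains T' where "set_mset T' \<subseteq> triples" "set_mset (image_mset tsrc T') \<subseteq> level N"
    "src_sum T' = src_sum T"
    "rng_sum T' = rng_sum T"
proof
  let ?T = "\<Sum>t\<in>#T. trefine N t"
  show "set_mset ?T \<subseteq> triples" using T trefine_triples by fastforce
  have src: "image_mset tsrc ?T = refine_all N (image_mset tsrc T)"
    by (simp add: image_mset_sum_mset multiset.map_comp o_def tsrc_trefine refine_all_def)
  show "set_mset (image_mset tsrc ?T) \<subseteq> level N"
    unfolding src using T N triples_paths by (intro refine_all_level) auto
  show "src_sum ?T = src_sum T"
    unfolding src using T triples_paths by (intro cylsum_refine_all) auto
  have "rng_sum ?T = (\<lambda>x. \<Sum>t\<in>#T. rng_sum (trefine N t) x)"
    by (simp add: image_mset_sum_mset multiset.map_comp o_def cylsum_Union)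
  also have "\<dots> = rng_sum T"
  proof
    fix x
    have "rng_sum (trefine N t) x = indicator (cyl A (trng t)) x" if "t \<in># T" for t
      using that T triples_paths[of t] by (subst trng_trefine) (auto simp: cylsum_refine)
    then show "(\<Sum>t\<in>#T. rng_sum (trefine N t) x) = rng_sum T x"
      by (simp add: cylsum_def multiset.map_comp o_def cong: image_mset_cong)
  qed
  finally show "rng_sum ?T = rng_sum T" .
qed

text \<open>
  By symmetry, exchanging the roles of the two paths of a triple.
\<close>

lemma ex_trefine_rng:
  assumes T: "set_mset T \<subseteq> triples" and N: "\<forall>t\<in>#T. length (snd (trng t)) \<le> N"
  obtains T' where "set_mset T' \<subseteq> triples" "set_mset (image_mset trng T') \<subseteq> level N"
    "src_sum T' = src_sum T"
    "rng_sum T' = rng_sum T"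
proof -
  have T': "set_mset (image_mset tinv T) \<subseteq> triples"
    unfolding set_image_mset using T tinv_in by blast
  have N': "\<forall>t\<in>#image_mset tinv T. length (snd (tsrc t)) \<le> N" using N by simp
  obtain S where S: "set_mset S \<subseteq> triples" "set_mset (image_mset tsrc S) \<subseteq> level N"
    "src_sum S = src_sum (image_mset tinv T)"
    "rng_sum S = rng_sum (image_mset tinv T)"
    by (rule ex_trefine_src[OF T' N'])
  show thesis
  proof (rule that[of "image_mset tinv S"])
    show "set_mset (image_mset tinv S) \<subseteq> triples"
      unfolding set_image_mset using S(1) tinv_in by blast
  qed (use S in \<open>simp_all add: multiset.map_comp o_def\<close>)
qed

section \<open>Equidecomposability\<close>

text \<open>
  The relation \<open>\<sim>\<^sub>G\<close> in terms of triples, see \<open>rel_sim_G_iff\<close>.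
\<close>

definition equid :: "('e stream \<Rightarrow> nat) \<Rightarrow> ('e stream \<Rightarrow> nat) \<Rightarrow> bool" where
  "equid F G \<longleftrightarrow> (\<exists>T. set_mset T \<subseteq> triples \<and>
     F = src_sum T \<and> G = rng_sum T)"

text \<open>
  A concrete form of \<open>C\<^sub>c(E\<^sup>\<infinity>, \<nat>)\<close>, see \<open>Cc_eq_Cyl\<close>.
\<close>

definition Cyl :: "('e stream \<Rightarrow> nat) set" where
  "Cyl = {cylsum B | B. set_mset B \<subseteq> paths A}"

lemma CylI: "set_mset B \<subseteq> paths A \<Longrightarrow> cylsum B \<in> Cyl"
  by (auto simp: Cyl_def)

lemma Cyl_zero [simp]: "(\<lambda>x. 0) \<in> Cyl"
  using CylI[of "{#}"] by simp

lemma Cyl_add: "F \<in> Cyl \<Longrightarrow> G \<in> Cyl \<Longrightarrow> (\<lambda>x. F x + G x) \<in> Cyl"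
proof -
  assume "F \<in> Cyl" "G \<in> Cyl"
  then obtain B B' where "set_mset B \<subseteq> paths A" "F = cylsum B" "set_mset B' \<subseteq> paths A" "G = cylsum B'"
    unfolding Cyl_def by blast
  then show "(\<lambda>x. F x + G x) \<in> Cyl"
    using CylI[of "B + B'"] by (simp add: cylsum_union)
qed

lemma Cyl_level:
  assumes "F \<in> Cyl"
  obtains N0 where "\<And>N. N \<ge> N0 \<Longrightarrow> \<exists>B. set_mset B \<subseteq> level N \<and> F = cylsum B"
proof -
  obtain B where B: "set_mset B \<subseteq> paths A" "F = cylsum B" using assms by (auto simp: Cyl_def)
  obtain N0 where N0: "\<forall>\<beta>\<in>#B. length (snd \<beta>) \<le> N0" using ex_length_bound[of B "\<lambda>x. x"] by auto
  show thesis
  proof (rule that[of N0])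
    fix N assume "N \<ge> N0"
    then have "\<forall>\<beta>\<in>#B. length (snd \<beta>) \<le> N" using N0 by fastforce
    then show "\<exists>B. set_mset B \<subseteq> level N \<and> F = cylsum B"
      using refine_all_level[OF B(1)] cylsum_refine_all[OF B(1)] B(2) by metis
  qed
qed

lemma level_paths: "level N \<subseteq> paths A"
  by (auto simp: level_def)

text \<open>
  The order on functions is the algebraic one: at a common level it is inclusion of multisets.
\<close>

lemma Cyl_diff:
  assumes "F \<in> Cyl" "G \<in> Cyl" "F \<le> G"
  obtains H where "H \<in> Cyl" "(\<lambda>x. F x + H x) = G"
proof -
  obtain N1 where N1: "\<And>N. N \<ge> N1 \<Longrightarrow> \<exists>B. set_mset B \<subseteq> level N \<and> F = cylsum B"
    using Cyl_level[OF assms(1)] by metis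
  obtain N2 where N2: "\<And>N. N \<ge> N2 \<Longrightarrow> \<exists>B. set_mset B \<subseteq> level N \<and> G = cylsum B"
    using Cyl_level[OF assms(2)] by metis
  define N where "N = max N1 N2"
  obtain B B' where B: "set_mset B \<subseteq> level N" "F = cylsum B" "set_mset B' \<subseteq> level N" "G = cylsum B'"
    using N1[of N] N2[of N] by (auto simp: N_def)
  then have sub: "B \<subseteq># B'" using cylsum_level_le assms(3) by blast
  then have "(\<lambda>x. F x + cylsum (B' - B) x) = G"
    using B(2,4) cylsum_union[of B "B' - B"] by (simp add: subset_mset.add_diff_inverse)
  moreover have "cylsum (B' - B) \<in> Cyl"
    using B(3) level_paths by (intro CylI) (auto dest: in_diffD)
  ultimately show thesis using that by blast
qed

lemma equid_Cyl:
  assumes "equid F G"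
  shows "F \<in> Cyl" "G \<in> Cyl"
proof -
  obtain T where T: "set_mset T \<subseteq> triples" "F = src_sum T" "G = rng_sum T"
    using assms by (auto simp: equid_def)
  have "set_mset (image_mset tsrc T) \<subseteq> paths A" "set_mset (image_mset trng T) \<subseteq> paths A"
    unfolding set_image_mset using T(1) triples_paths by blast+
  then show "F \<in> Cyl" "G \<in> Cyl" using T CylI by blast+
qed

lemma triple_path: "\<beta> \<in> paths A \<Longrightarrow> (\<beta>, \<one>\<^bsub>Gr\<^esub>, \<beta>) \<in> triples"
  by (simp add: mem_triples path_so_in)

lemma equid_refl: "F \<in> Cyl \<Longrightarrow> equid F F"
proof -
  assume "F \<in> Cyl"
  then obtain B where B: "set_mset B \<subseteq> paths A" "F = cylsum B" by (auto simp: Cyl_def)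
  show "equid F F" unfolding equid_def
    by (rule exI[of _ "image_mset (\<lambda>\<beta>. (\<beta>, \<one>\<^bsub>Gr\<^esub>, \<beta>)) B"])
      (use B triple_path in \<open>auto simp: multiset.map_comp o_def\<close>)
qed

lemma equid_sym: "equid F G \<Longrightarrow> equid G F"
proof -
  assume "equid F G"
  then obtain T where T: "set_mset T \<subseteq> triples" "F = src_sum T" "G = rng_sum T"
    by (auto simp: equid_def)
  have "set_mset (image_mset tinv T) \<subseteq> triples"
    unfolding set_image_mset using T tinv_in by blast
  then show "equid G F" unfolding equid_def
    by (intro exI[of _ "image_mset tinv T"]) (simp add: T multiset.map_comp o_def)
qed

lemma equid_add:
  assumes "equid F G" "equid F' G'"
  shows "equid (\<lambda>x. F x + F' x) (\<lambda>x. G x + G' x)"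
proof -
  obtain T where T: "set_mset T \<subseteq> triples" "F = src_sum T" "G = rng_sum T"
    using assms by (auto simp: equid_def)
  obtain S where S: "set_mset S \<subseteq> triples" "F' = src_sum S" "G' = rng_sum S"
    using assms by (auto simp: equid_def)
  show ?thesis unfolding equid_def
    by (intro exI[of _ "T + S"]) (use T S in \<open>auto simp: cylsum_union\<close>)
qed

lemma equid_sum:
  "finite I \<Longrightarrow> (\<And>i. i \<in> I \<Longrightarrow> equid (F i) (G i)) \<Longrightarrow> equid (\<lambda>x. \<Sum>i\<in>I. F i x) (\<lambda>x. \<Sum>i\<in>I. G i x)"
proof (induction I rule: finite_induct)
  case empty
  then show ?case using equid_refl[OF Cyl_zero] by simp
next
  case (insert i I)
  then show ?case using equid_add[of "F i" "G i"] by simp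
qed

text \<open>
  Both decompositions of the middle function are refined to a common level. There they consist of
  the same paths, so the triples can be paired and composed as \<open>(\<alpha>', h, \<alpha>)(\<alpha>, g, \<beta>) = (\<alpha>', hg, \<beta>)\<close>.
\<close>

lemma equid_trans:
  assumes "equid F G" "equid G H"
  shows "equid F H"
proof -
  obtain T0 where T0: "set_mset T0 \<subseteq> triples" "F = src_sum T0" "G = rng_sum T0"
    using assms by (auto simp: equid_def)
  obtain S0 where S0: "set_mset S0 \<subseteq> triples" "G = src_sum S0" "H = rng_sum S0"
    using assms by (auto simp: equid_def)
  obtain N1 where N1: "\<forall>t\<in>#T0. length (snd (trng t)) \<le> N1" using ex_length_bound[of T0 trng] by blast
  obtain N2 where N2: "\<forall>t\<in>#S0. length (snd (tsrc t)) \<le> N2" using ex_length_bound[of S0 tsrc] by blast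
  define N where "N = max N1 N2"
  have N1': "\<forall>t\<in>#T0. length (snd (trng t)) \<le> N" and N2': "\<forall>t\<in>#S0. length (snd (tsrc t)) \<le> N"
    using N1 N2 by (auto simp: N_def max.coboundedI1 max.coboundedI2)
  obtain T where T: "set_mset T \<subseteq> triples" "set_mset (image_mset trng T) \<subseteq> level N"
    "src_sum T = F" "rng_sum T = G"
    by (rule ex_trefine_rng[OF T0(1) N1', folded T0(2,3)])
  obtain S where S: "set_mset S \<subseteq> triples" "set_mset (image_mset tsrc S) \<subseteq> level N"
    "src_sum S = G" "rng_sum S = H"
    by (rule ex_trefine_src[OF S0(1) N2', folded S0(2,3)])
  have "image_mset trng T = image_mset tsrc S"
    using cylsum_level_inj[OF T(2) S(2)] T S by simp
  then obtain P where P: "image_mset fst P = T" "image_mset snd P = S" "\<forall>(t, s)\<in>#P. trng t = tsrc s"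
    by (rule rel_mset_eq_pairing)
  \<comment> \<open>The first component of a pair comes from the first decomposition and is applied first.\<close>
  define comp where "comp p = (trng (snd p), fst (snd (snd p)) \<otimes>\<^bsub>Gr\<^esub> fst (snd (fst p)), tsrc (fst p))" for p
  have "comp p \<in> triples" if "p \<in># P" for p
  proof -
    obtain \<alpha> g \<beta> \<alpha>' h \<beta>' where p: "p = ((\<alpha>, g, \<beta>), (\<alpha>', h, \<beta>'))" by (metis prod.exhaust)
    have "(\<alpha>, g, \<beta>) \<in># T" "(\<alpha>', h, \<beta>') \<in># S" "\<beta>' = \<alpha>"
      using that P p by force+
    then have "(\<alpha>, g, \<beta>) \<in> triples" "(\<alpha>', h, \<alpha>) \<in> triples" using T(1) S(1) by auto
    then show ?thesis unfolding p comp_def by (auto simp: mem_triples vact_mult path_so_in)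
  qed
  then have "set_mset (image_mset comp P) \<subseteq> triples" by auto
  moreover have "F = src_sum (image_mset comp P)"
    unfolding T(3)[symmetric] P(1)[symmetric] by (simp add: multiset.map_comp o_def comp_def)
  moreover have "H = rng_sum (image_mset comp P)"
    unfolding S(4)[symmetric] P(2)[symmetric] by (simp add: multiset.map_comp o_def comp_def)
  ultimately show ?thesis unfolding equid_def by blast
qed

text \<open>
  The relation \<open>\<precsim>\<^sub>B\<close> in terms of triples, see \<open>rel_precsim_B_iff\<close>.
\<close>

definition subequid :: "('e stream \<Rightarrow> nat) \<Rightarrow> ('e stream \<Rightarrow> nat) \<Rightarrow> bool" where
  "subequid F G \<longleftrightarrow> (\<exists>T. set_mset T \<subseteq> triples \<and>
     F \<le> src_sum T \<and> rng_sum T \<le> G)"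

text \<open>
  At a level at which \<open>F\<close> is also decomposed, the superfluous triples can be thrown away.
\<close>

lemma subequid_exact:
  assumes F: "F \<in> Cyl" and FG: "subequid F G"
  obtains T N where "set_mset T \<subseteq> triples" "set_mset (image_mset tsrc T) \<subseteq> level N"
    "F = src_sum T" "rng_sum T \<le> G"
proof -
  obtain T0 where T0: "set_mset T0 \<subseteq> triples" "F \<le> src_sum T0" "rng_sum T0 \<le> G"
    using FG by (auto simp: subequid_def)
  obtain N1 where N1: "\<forall>t\<in>#T0. length (snd (tsrc t)) \<le> N1" using ex_length_bound[of T0 tsrc] by blast
  obtain N2 where N2: "\<And>N. N \<ge> N2 \<Longrightarrow> \<exists>B. set_mset B \<subseteq> level N \<and> F = cylsum B"
    using Cyl_level[OF F] by metis
  define N where "N = max N1 N2"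
  have N1': "\<forall>t\<in>#T0. length (snd (tsrc t)) \<le> N"
    using N1 by (auto simp: N_def max.coboundedI1)
  obtain B where B: "set_mset B \<subseteq> level N" "F = cylsum B" using N2[of N] by (auto simp: N_def)
  obtain T where T: "set_mset T \<subseteq> triples" "set_mset (image_mset tsrc T) \<subseteq> level N"
    "src_sum T = src_sum T0"
    "rng_sum T = rng_sum T0"
    by (rule ex_trefine_src[OF T0(1) N1'])
  have "B \<subseteq># image_mset tsrc T"
    using cylsum_level_le[OF B(1) T(2)] B(2) T(3) T0(2) by simp
  then obtain C where "image_mset tsrc T = B + C" by (auto simp: subset_mset.le_iff_add)
  then obtain T1 T2 where T12: "T = T1 + T2" "B = image_mset tsrc T1"
    by (metis image_mset_eq_plusD)
  show thesis
  proof (rule that[of T1 N])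
    have "rng_sum T1 \<le> rng_sum T"
      by (simp add: T12 cylsum_union le_fun_def)
    then show "rng_sum T1 \<le> G" using T(4) T0(3) by simp
  qed (use T12 T B in auto)
qed

text \<open>
  With an exact decomposition of \<open>F\<close>, the difference between \<open>G\<close> and the sum of the ranges serves
  as \<open>H\<close>. Transitivity and compatibility with addition become formal consequences.
\<close>

lemma subequid_iff:
  assumes F: "F \<in> Cyl" and G: "G \<in> Cyl"
  shows "subequid F G \<longleftrightarrow> (\<exists>H\<in>Cyl. equid (\<lambda>x. F x + H x) G)"
proof
  assume FG: "subequid F G"
  obtain T N where "set_mset T \<subseteq> triples" "set_mset (image_mset tsrc T) \<subseteq> level N"
    and T: "F = src_sum T" "rng_sum T \<le> G"
    by (rule subequid_exact[OF F FG])
  have 1: "equid F (rng_sum T)" using \<open>set_mset T \<subseteq> triples\<close> T equid_def by blast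
  obtain H where H: "H \<in> Cyl" "(\<lambda>x. rng_sum T x + H x) = G"
    by (rule Cyl_diff[OF equid_Cyl(2)[OF 1] G T(2)])
  show "\<exists>H\<in>Cyl. equid (\<lambda>x. F x + H x) G"
    using equid_add[OF 1 equid_refl[OF H(1)]] H by metis
next
  assume "\<exists>H\<in>Cyl. equid (\<lambda>x. F x + H x) G"
  then obtain H T where T: "set_mset T \<subseteq> triples" "(\<lambda>x. F x + H x) = src_sum T"
      "G = rng_sum T"
    unfolding equid_def by blast
  have "F \<le> (\<lambda>x. F x + H x)" by (simp add: le_fun_def)
  then have "F \<le> src_sum T" unfolding T(2) .
  then show "subequid F G" unfolding subequid_def using T(1,3) by blast
qed

lemma subequidI: "F \<in> Cyl \<Longrightarrow> G \<in> Cyl \<Longrightarrow> H \<in> Cyl \<Longrightarrow> equid (\<lambda>x. F x + H x) G \<Longrightarrow> subequid F G"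
  using subequid_iff[of F G] by (simp add: bexI)

lemma subequidE:
  assumes "F \<in> Cyl" "G \<in> Cyl" "subequid F G"
  obtains H where "H \<in> Cyl" "equid (\<lambda>x. F x + H x) G"
proof -
  have "\<exists>H\<in>Cyl. equid (\<lambda>x. F x + H x) G" using subequid_iff[OF assms(1,2)] assms(3) by simp
  then show thesis by (elim bexE) (rule that)
qed

lemma equid_imp_subequid: "equid F G \<Longrightarrow> subequid F G"
  using subequidI[of F G "\<lambda>x. 0"] equid_Cyl[of F G] by simp

lemma subequid_refl: "F \<in> Cyl \<Longrightarrow> subequid F F"
  using equid_refl equid_imp_subequid by blast

lemma subequid_trans:
  assumes C: "F \<in> Cyl" "G \<in> Cyl" "H \<in> Cyl" and FG: "subequid F G" and GH: "subequid G H"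
  shows "subequid F H"
proof -
  obtain K where K: "K \<in> Cyl" "equid (\<lambda>x. F x + K x) G" by (rule subequidE[OF C(1,2) FG])
  obtain L where L: "L \<in> Cyl" "equid (\<lambda>x. G x + L x) H" by (rule subequidE[OF C(2,3) GH])
  have "equid (\<lambda>x. F x + K x + L x) H"
    using equid_trans[OF equid_add[OF K(2) equid_refl[OF L(1)]] L(2)] .
  then have "equid (\<lambda>x. F x + (K x + L x)) H" by (simp add: add.assoc)
  then show ?thesis by (rule subequidI[OF C(1,3) Cyl_add[OF K(1) L(1)]])
qed

lemma subequid_add:
  assumes "F \<in> Cyl" "G \<in> Cyl" "H \<in> Cyl" "subequid F G"
  shows "subequid (\<lambda>x. F x + H x) (\<lambda>x. G x + H x)"
proof -
  obtain K where K: "K \<in> Cyl" "equid (\<lambda>x. F x + K x) G" by (rule subequidE[OF assms(1,2,4)])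
  have "equid (\<lambda>x. F x + K x + H x) (\<lambda>x. G x + H x)"
    using equid_add[OF K(2) equid_refl[OF assms(3)]] .
  then have "equid (\<lambda>x. F x + H x + K x) (\<lambda>x. G x + H x)" by (simp add: ac_simps)
  then show ?thesis by (rule subequidI[OF Cyl_add[OF assms(1,3)] Cyl_add[OF assms(2,3)] K(1)])
qed

section \<open>Functions on vertices\<close>

text \<open>
  The functions of finite support are the multiplicity functions of finite multisets of vertices;
  all computations with them below are done with multisets.
\<close>

lemma CcV_count: "f \<in> CcV A \<longleftrightarrow> (\<exists>B. set_mset B \<subseteq> E0 A \<and> f = count B)"
proof
  assume "f \<in> CcV A"
  then have fin: "finite {v. f v > 0}" and sub: "{v. f v > 0} \<subseteq> E0 A" by (auto simp: CcV_def)
  have "count (Abs_multiset f) = f" using fin by (rule count_Abs_multiset)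
  then show "\<exists>B. set_mset B \<subseteq> E0 A \<and> f = count B"
    using sub by (intro exI[of _ "Abs_multiset f"]) (auto simp: set_mset_def)
next
  assume "\<exists>B. set_mset B \<subseteq> E0 A \<and> f = count B"
  then show "f \<in> CcV A" by (auto simp: CcV_def)
qed

lemma count_CcV: "set_mset B \<subseteq> E0 A \<Longrightarrow> count B \<in> CcV A"
  by (auto simp: CcV_def)

lemma indicator_CcV: "v \<in> E0 A \<Longrightarrow> indicator {v} \<in> CcV A"
  by (auto simp: CcV_def indicator_def)

lemma CcV_add: "f \<in> CcV A \<Longrightarrow> g \<in> CcV A \<Longrightarrow> (\<lambda>v. f v + g v) \<in> CcV A"
  by (auto simp: CcV_def Collect_disj_eq)

lemma CcV_zero: "(\<lambda>v. 0) \<in> CcV A"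
  by (simp add: CcV_def)

abbreviation vpaths :: "'v multiset \<Rightarrow> ('v, 'e) gpath multiset" where
  "vpaths B \<equiv> image_mset (\<lambda>v. (v, [])) B"

lemma tau_count: "set_mset B \<subseteq> E0 A \<Longrightarrow> tau A (count B) = cylsum (vpaths B)"
proof (induction B)
  case (add v B)
  then have "tau A (count B) = cylsum (vpaths B)" "v \<in> E0 A" by auto
  then have IH: "cylsum (vpaths B) x = (if x \<in> inf_paths A then count B (inf_rg A x) else 0)" for x
    by (metis tau_def)
  show ?case using \<open>v \<in> E0 A\<close>
    by (auto simp: tau_def fun_eq_iff cylsum_add_mset IH cyl_Nil indicator_def)
qed (simp add: tau_def fun_eq_iff)

lemma vpaths_in: "set_mset B \<subseteq> E0 A \<Longrightarrow> set_mset (vpaths B) \<subseteq> paths A"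
  by auto

lemma tau_Cyl: "f \<in> CcV A \<Longrightarrow> tau A f \<in> Cyl"
  unfolding CcV_count using tau_count CylI[OF vpaths_in] by auto

lemma tau_add: "tau A (\<lambda>v. f v + g v) = (\<lambda>x. tau A f x + tau A g x)"
  by (simp add: tau_def fun_eq_iff)

lemma tau_zero: "tau A (\<lambda>v. 0) = (\<lambda>x. 0)"
  by (simp add: tau_def fun_eq_iff)

lemma tau_sum: "tau A (\<lambda>v. \<Sum>i\<in>I. F i v) = (\<lambda>x. \<Sum>i\<in>I. tau A (F i) x)"
  by (auto simp: tau_def fun_eq_iff)

abbreviation paths_from :: "nat \<Rightarrow> 'v multiset \<Rightarrow> ('v, 'e) gpath multiset" where
  "paths_from n B \<equiv> refine_all n (vpaths B)"

lemma paths_from_level: "set_mset B \<subseteq> E0 A \<Longrightarrow> set_mset (paths_from n B) \<subseteq> level n"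
  by (intro refine_all_level) auto

lemma cylsum_paths_from: "set_mset B \<subseteq> E0 A \<Longrightarrow> cylsum (paths_from n B) = tau A (count B)"
  using cylsum_refine_all[OF vpaths_in] tau_count by simp

text \<open>
  Both sides of \<open>cylsum_paths_from\<close> are evaluated at an infinite path that begins with \<open>\<alpha>\<close>.
\<close>

lemma count_paths_from:
  assumes "set_mset B \<subseteq> E0 A"
  shows "count (paths_from n B) \<alpha> = (if \<alpha> \<in> level n then count B (path_rg \<alpha>) else 0)"
proof (cases "\<alpha> \<in> level n")
  case True
  then obtain x where "x \<in> cyl A \<alpha>" using ex_in_cyl level_paths by blast
  then have x: "x \<in> inf_paths A" "initial n x = \<alpha>" using True by (auto simp: mem_cyl level_def)
  then have "inf_rg A x = path_rg \<alpha>" by (auto simp: initial_def path_rg_def)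
  then show ?thesis
    using fun_cong[OF cylsum_paths_from[OF assms, of n], of x] True x
    by (simp add: cylsum_level[OF paths_from_level[OF assms]] tau_def)
next
  case False
  then show ?thesis using paths_from_level[OF assms, of n] by (meson count_inI subsetD)
qed

text \<open>
  \<open>\<Theta>\<^sup>n(f)\<close> is the push-forward along \<open>s\<close> of the multiset of paths of length \<open>n\<close> that decomposes
  \<open>\<tau>(f)\<close>. This links the operator \<open>\<Theta>\<close> to cylinders.
\<close>

lemma Theta_count:
  assumes "set_mset B \<subseteq> E0 A"
  shows "Theta A n (count B) = count (image_mset (path_so A) (paths_from n B))"
proof
  fix v
  have "{\<alpha>. \<alpha> \<in> paths A \<and> length (snd \<alpha>) = n \<and> path_so A \<alpha> = v \<and> count B (path_rg \<alpha>) \<noteq> 0}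
      = path_so A -` {v} \<inter> set_mset (paths_from n B)"
    using paths_from_level[OF assms, of n]
    by (auto simp: set_mset_def[of "paths_from n B"] count_paths_from[OF assms] level_def)
  then show "Theta A n (count B) v = count (image_mset (path_so A) (paths_from n B)) v"
    unfolding Theta_def count_image_mset
    by (intro sum.cong) (auto simp: count_paths_from[OF assms] level_def)
qed

lemma Theta_count_in:
  assumes "set_mset B \<subseteq> E0 A"
  shows "set_mset (image_mset (path_so A) (paths_from n B)) \<subseteq> E0 A"
  unfolding set_image_mset using paths_from_level[OF assms, of n] level_paths[of n] path_so_in by blast

lemma Theta_CcV: "f \<in> CcV A \<Longrightarrow> Theta A n f \<in> CcV A"
proof -
  assume "f \<in> CcV A"
  then obtain B where "set_mset B \<subseteq> E0 A" "f = count B" unfolding CcV_count by blast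
  then show ?thesis using count_CcV[OF Theta_count_in] Theta_count by simp
qed

lemma refine_self: "length (snd \<beta>) = n \<Longrightarrow> refine n \<beta> = {#\<beta>#}"
  by (simp add: refine_def)

lemma Theta_0: "f \<in> CcV A \<Longrightarrow> Theta A 0 f = f"
proof -
  assume "f \<in> CcV A"
  then obtain B where B: "set_mset B \<subseteq> E0 A" "f = count B" by (auto simp: CcV_count)
  have "image_mset (path_so A) (paths_from 0 B) = B"
    by (simp add: refine_all_def multiset.map_comp o_def refine_self image_mset_sum_mset)
  then show ?thesis using Theta_count[OF B(1), of 0] B(2) by simp
qed

text \<open>
  The equidecomposition is realized by the triples \<open>(s(\<alpha>), 1, \<alpha>)\<close> with \<open>\<alpha>\<close> of length \<open>n\<close>.
\<close>

lemma equid_Theta: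
  assumes "f \<in> CcV A"
  shows "equid (tau A f) (tau A (Theta A n f))"
proof -
  obtain B where B: "set_mset B \<subseteq> E0 A" "f = count B" using assms by (auto simp: CcV_count)
  let ?P = "paths_from n B" and ?t = "\<lambda>\<alpha>. ((path_so A \<alpha>, []), \<one>\<^bsub>Gr\<^esub>, \<alpha>)"
  have P: "set_mset ?P \<subseteq> paths A" using paths_from_level[OF B(1)] level_paths by blast
  have "set_mset (image_mset ?t ?P) \<subseteq> triples"
    using P path_so_in by (auto simp: mem_triples)
  moreover have "tau A f = src_sum (image_mset ?t ?P)"
    using cylsum_paths_from[OF B(1), of n] B(2) by (simp add: multiset.map_comp o_def)
  moreover have "tau A (Theta A n f) = rng_sum (image_mset ?t ?P)"
    using tau_count[OF Theta_count_in[OF B(1)], of n] Theta_count[OF B(1), of n] B(2)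
    by (simp add: multiset.map_comp o_def)
  ultimately show ?thesis unfolding equid_def by blast
qed

lemma equid_sim_Theta:
  assumes "f \<in> CcV A" "f' \<in> CcV A" "sim_Theta A f f'"
  shows "equid (tau A f) (tau A f')"
proof -
  obtain p q where "Theta A p f = Theta A q f'" using assms(3) unfolding sim_Theta_def by blast
  then show ?thesis
    using equid_trans[OF equid_Theta[OF assms(1), of p]] equid_sym[OF equid_Theta[OF assms(2), of q]] by simp
qed

lemma sim_Gamma_count:
  assumes B: "set_mset B \<subseteq> E0 A" and B': "set_mset B' \<subseteq> E0 A" and sim: "sim_Gamma A (count B) (count B')"
  obtains g where "g \<in> carrier Gr" "B' = image_mset (vact A g) B"
proof -
  obtain g where g: "g \<in> carrier Gr" "\<And>v. v \<in> E0 A \<Longrightarrow> count B v = count B' (vact A g v)"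
    using sim by (auto simp: sim_Gamma_def)
  have "B' = image_mset (vact A g) B"
  proof (rule multiset_eqI)
    fix w
    show "count B' w = count (image_mset (vact A g) B) w"
    proof (cases "w \<in> E0 A")
      case True
      define v where "v = vact A (inv\<^bsub>Gr\<^esub> g) w"
      have v: "v \<in> E0 A" "w = vact A g v" using True g(1) by (auto simp: v_def)
      have "w = vact A g x \<Longrightarrow> x = v" if "x \<in># B" for x
        using that B g(1) unfolding v_def by auto
      then have "{x. x \<in># B \<and> w = vact A g x} = (if v \<in># B then {v} else {})"
        using v(2) by auto
      then show ?thesis using g(2)[OF v(1)] v(2) by (simp add: count_image_mset' not_in_iff)
    next
      case False
      then have "w \<notin># B'" using B' by blast
      moreover have "w \<notin># image_mset (vact A g) B" using False B g(1) by auto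
      ultimately show ?thesis by (simp only: not_in_iff)
    qed
  qed
  with g(1) that show thesis by blast
qed

text \<open>
  The equidecomposition is realized by the triples \<open>(gv, g, v)\<close> of paths of length zero.
\<close>

lemma equid_sim_Gamma:
  assumes "f \<in> CcV A" "f' \<in> CcV A" "sim_Gamma A f f'"
  shows "equid (tau A f) (tau A f')"
proof -
  obtain B where B: "set_mset B \<subseteq> E0 A" "f = count B" using assms by (auto simp: CcV_count)
  obtain B' where B': "set_mset B' \<subseteq> E0 A" "f' = count B'" using assms by (auto simp: CcV_count)
  obtain g where g: "g \<in> carrier Gr" "B' = image_mset (vact A g) B"
    by (rule sim_Gamma_count[OF B(1) B'(1) assms(3)[unfolded B(2) B'(2)]])
  let ?t = "\<lambda>v. ((vact A g v, []), g, (v, []))"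
  have "set_mset (image_mset ?t B) \<subseteq> triples" using B(1) g(1) by (auto simp: mem_triples)
  moreover have "tau A f = src_sum (image_mset ?t B)"
    using tau_count[OF B(1)] B(2) by (simp add: multiset.map_comp o_def)
  moreover have "tau A f' = rng_sum (image_mset ?t B)"
    using tau_count[OF B'(1)] B'(2) g(2) by (simp add: multiset.map_comp o_def)
  ultimately show ?thesis unfolding equid_def by blast
qed

abbreviation fam_sum :: "nat \<Rightarrow> (nat \<Rightarrow> 'v \<Rightarrow> nat) \<Rightarrow> 'v \<Rightarrow> nat" where
  "fam_sum n F \<equiv> \<lambda>v. \<Sum>i=1..n. F i v"

text \<open>
  The condition on the families that the definitions of \<open>\<sim>\<close> and \<open>\<precsim>\<close> share.
\<close>

definition translated_families ::
    "nat \<Rightarrow> (nat \<Rightarrow> 'v \<Rightarrow> nat) \<Rightarrow> (nat \<Rightarrow> 'v \<Rightarrow> nat) \<Rightarrow> (nat \<Rightarrow> 'v \<Rightarrow> nat) \<Rightarrow> bool" where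
  "translated_families n F F' F'' \<longleftrightarrow>
     (\<forall>i\<in>{1..n}. F i \<in> CcV A \<and> F' i \<in> CcV A \<and> F'' i \<in> CcV A \<and>
                 sim_Gamma A (F i) (F' i) \<and> sim_Theta A (F' i) (F'' i))"

lemma rel_sim_translated: "(f, f') \<in> rel_sim A \<longleftrightarrow> f \<in> CcV A \<and> f' \<in> CcV A \<and>
    (\<exists>n F F' F''. translated_families n F F' F'' \<and>
       sim_Theta A f (fam_sum n F) \<and> sim_Theta A (fam_sum n F'') f')"
  unfolding rel_sim_def translated_families_def by simp

lemma rel_precsim_translated: "(f, f') \<in> rel_precsim A \<longleftrightarrow> f \<in> CcV A \<and> f' \<in> CcV A \<and>
    (\<exists>n F F' F''. \<exists>f''\<in>CcV A. translated_families n F F' F'' \<and>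
       sim_Theta A f (fam_sum n F) \<and> (fam_sum n F'') \<le> f'' \<and> sim_Theta A f'' f')"
  unfolding rel_precsim_def translated_families_def by simp

lemma equid_of_families:
  assumes "translated_families n F F' F''"
  shows "equid (tau A (fam_sum n F)) (tau A (fam_sum n F''))"
  unfolding tau_sum
proof (rule equid_sum)
  fix i assume "i \<in> {1..n}"
  then have "F i \<in> CcV A" "F' i \<in> CcV A" "F'' i \<in> CcV A" "sim_Gamma A (F i) (F' i)" "sim_Theta A (F' i) (F'' i)"
    using assms unfolding translated_families_def by blast+
  then show "equid (tau A (F i)) (tau A (F'' i))"
    using equid_trans[OF equid_sim_Gamma equid_sim_Theta] by blast
qed simp

lemma CcV_sum: "(\<And>i. i \<in> I \<Longrightarrow> F i \<in> CcV A) \<Longrightarrow> (\<lambda>v. \<Sum>i\<in>I. F i v) \<in> CcV A"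
  by (induction I rule: infinite_finite_induct) (auto simp: CcV_zero CcV_add)

lemma translated_families_CcV:
  assumes "translated_families n F F' F''"
  shows "(fam_sum n F) \<in> CcV A" "fam_sum n F'' \<in> CcV A"
  using assms unfolding translated_families_def by (auto intro!: CcV_sum)

text \<open>
  Each triple \<open>(\<alpha>, g, \<beta>)\<close> contributes the summands \<open>1\<^bsub>s(\<beta>)\<^esub>\<close>, \<open>1\<^bsub>s(\<alpha>)\<^esub>\<close> and \<open>\<Theta>\<^sup>k(1\<^bsub>s(\<alpha>)\<^esub>)\<close>, where
  \<open>k = M - |\<alpha>|\<close> compensates for the different lengths of the range paths.
\<close>

lemma families_of_triples:
  assumes T: "set_mset T \<subseteq> triples" and lev: "set_mset (image_mset tsrc T) \<subseteq> level N"
    and B: "set_mset B \<subseteq> E0 A" and eq: "tau A (count B) = src_sum T"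
  obtains n F F' F'' where
    "translated_families n F F' F''"
    "sim_Theta A (count B) (fam_sum n F)"
    "fam_sum n F'' = count (image_mset (path_so A) (refine_all M (image_mset trng T)))"
proof -
  obtain n :: nat and t where t: "\<forall>i\<in>{1..n}. t i \<in># T"
    and sum_all: "\<forall>h :: _ \<Rightarrow> nat. (\<Sum>i=1..n. h (t i)) = (\<Sum>u\<in>#T. h u)"
    by (rule obtain_enumeration)
  note sum_t = sum_all[rule_format]
  have t_in: "t i \<in> triples" if "i \<in> {1..n}" for i using t that T by blast
  let ?k = "\<lambda>u. M - length (snd (trng u))"
  define F where "F i = (indicator {path_so A (tsrc (t i))} :: 'v \<Rightarrow> nat)" for i
  define F' where "F' i = (indicator {path_so A (trng (t i))} :: 'v \<Rightarrow> nat)" for i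
  define F'' where "F'' i = Theta A (?k (t i)) (F' i)" for i
  have so: "path_so A (tsrc (t i)) \<in> E0 A" "path_so A (trng (t i)) \<in> E0 A" if "i \<in> {1..n}" for i
    using t_in[OF that] triples_paths path_so_in by blast+
  have 1: "F i \<in> CcV A \<and> F' i \<in> CcV A \<and> F'' i \<in> CcV A \<and>
                    sim_Gamma A (F i) (F' i) \<and> sim_Theta A (F' i) (F'' i)" if i: "i \<in> {1..n}" for i
  proof (intro conjI)
    show a: "F i \<in> CcV A" "F' i \<in> CcV A"
      using so[OF i] unfolding F_def F'_def count_single_indicator[symmetric] by (auto intro!: count_CcV)
    show b: "F'' i \<in> CcV A" unfolding F''_def by (rule Theta_CcV[OF a(2)])
    show "sim_Theta A (F' i) (F'' i)" unfolding sim_Theta_def using Theta_0[OF b] F''_def by metis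
    obtain \<alpha> g \<beta> where tt: "t i = (\<alpha>, g, \<beta>)" by (metis prod.exhaust)
    then have g: "g \<in> carrier Gr" "path_so A \<alpha> = vact A g (path_so A \<beta>)" "path_so A \<beta> \<in> E0 A"
      using t_in[OF i] by (auto simp: mem_triples path_so_in)
    have "F i v = F' i (vact A g v)" if "v \<in> E0 A" for v
    proof -
      have "vact A g v = vact A g (path_so A \<beta>) \<longleftrightarrow> v = path_so A \<beta>"
        using vact_inv_vact[OF g(1) that] vact_inv_vact[OF g(1) g(3)] by metis
      then show ?thesis unfolding F_def F'_def tt using g(2) by (simp add: indicator_def)
    qed
    then show "sim_Gamma A (F i) (F' i)" unfolding sim_Gamma_def using g(1) by blast
  qed
  have 0: "translated_families n F F' F''" unfolding translated_families_def using 1 by blast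
  have sumF: "(fam_sum n F) = count (image_mset (path_so A) (image_mset tsrc T))"
    unfolding F_def using sum_t[of "\<lambda>u. indicator {path_so A (tsrc u)} v" for v]
    by (simp add: fun_eq_iff count_eq_sum_indicator multiset.map_comp o_def)
  have "paths_from N B = image_mset tsrc T"
    using cylsum_level_inj[OF paths_from_level[OF B] lev] cylsum_paths_from[OF B] eq by simp
  then have "Theta A N (count B) = (fam_sum n F)"
    unfolding sumF Theta_count[OF B] by simp
  moreover have "Theta A 0 (fam_sum n F) = (fam_sum n F)"
    by (rule Theta_0[OF translated_families_CcV(1)[OF 0]])
  ultimately have 2: "sim_Theta A (count B) (fam_sum n F)"
    unfolding sim_Theta_def by metis
  have F'': "F'' i = count (image_mset (path_so A) (refine M (trng (t i))))" if "i \<in> {1..n}" for i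
  proof -
    have "F'' i = Theta A (?k (t i)) (count {#path_so A (trng (t i))#})"
      unfolding F''_def F'_def count_single_indicator ..
    also have "\<dots> = count (image_mset (path_so A) (refine M (trng (t i))))"
      using so[OF that] by (subst Theta_count) (auto simp: refine_all_def path_so_refine)
    finally show ?thesis .
  qed
  have 3: "fam_sum n F'' = count (image_mset (path_so A) (refine_all M (image_mset trng T)))"
  proof
    fix v
    have "(\<Sum>i=1..n. F'' i v) = (\<Sum>i=1..n. count (image_mset (path_so A) (refine M (trng (t i)))) v)"
      using F'' by (intro sum.cong) auto
    also have "\<dots> = (\<Sum>u\<in>#T. count (image_mset (path_so A) (refine M (trng u))) v)"
      by (rule sum_t)
    also have "\<dots> = count (image_mset (path_so A) (refine_all M (image_mset trng T))) v"
      by (simp add: refine_all_def multiset.map_comp o_def image_mset_sum_mset count_sum_mset_family)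
    finally show "(\<Sum>i=1..n. F'' i v) = count (image_mset (path_so A) (refine_all M (image_mset trng T))) v" .
  qed
  show thesis by (rule that[OF 0 2 3])
qed

text \<open>
  The reason why relations between \<open>\<tau>(f)\<close> and \<open>\<tau>(f')\<close> come from the graph. Source paths are brought to
  a common level \<open>N\<close>, where they are the paths counted by \<open>\<Theta>\<^sup>N(f)\<close>, and range paths to a common level \<open>M\<close>,
  where they are among those counted by \<open>\<Theta>\<^sup>M(f')\<close>.
\<close>

lemma obtain_translated_families:
  assumes f: "f \<in> CcV A" and f': "f' \<in> CcV A" and T: "set_mset T \<subseteq> triples"
    and src: "tau A f = src_sum T" and rng: "rng_sum T \<le> tau A f'"
  obtains n F F' F'' M where "translated_families n F F' F''"
    "sim_Theta A f (fam_sum n F)" "fam_sum n F'' \<le> Theta A M f'"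
    "rng_sum T = tau A f' \<longrightarrow> fam_sum n F'' = Theta A M f'"
proof -
  obtain N where N: "\<forall>t\<in>#T. length (snd (tsrc t)) \<le> N" using ex_length_bound[of T tsrc] by blast
  obtain S where S: "set_mset S \<subseteq> triples" "set_mset (image_mset tsrc S) \<subseteq> level N"
    "src_sum S = tau A f" "rng_sum S = rng_sum T"
    by (rule ex_trefine_src[OF T N, folded src])
  obtain M where M: "\<forall>t\<in>#S. length (snd (trng t)) \<le> M" using ex_length_bound[of S trng] by blast
  obtain B where B: "set_mset B \<subseteq> E0 A" "f = count B" using f by (auto simp: CcV_count)
  obtain B' where B': "set_mset B' \<subseteq> E0 A" "f' = count B'" using f' by (auto simp: CcV_count)
  have eq: "tau A (count B) = src_sum S" using S B by simp
  obtain n F F' F'' where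
    F: "translated_families n F F' F''"
    and 1: "sim_Theta A (count B) (fam_sum n F)"
    and 2: "fam_sum n F'' = count (image_mset (path_so A) (refine_all M (image_mset trng S)))"
    by (rule families_of_triples[OF S(1,2) B(1) eq])
  have rp: "set_mset (image_mset trng S) \<subseteq> paths A" using S(1) triples_paths by auto
  have lev: "set_mset (refine_all M (image_mset trng S)) \<subseteq> level M"
    using M by (intro refine_all_level[OF rp]) auto
  have cyl: "cylsum (refine_all M (image_mset trng S)) = rng_sum T"
      "cylsum (paths_from M B') = tau A f'"
    using cylsum_refine_all[OF rp] cylsum_paths_from[OF B'(1)] S(4) B'(2) by simp_all
  have Th: "Theta A M f' = count (image_mset (path_so A) (paths_from M B'))"
    unfolding B'(2) by (rule Theta_count[OF B'(1)])
  have "refine_all M (image_mset trng S) \<subseteq># paths_from M B'"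
    by (rule cylsum_level_le[OF lev paths_from_level[OF B'(1)]]) (use cyl rng in simp)
  then have 3: "fam_sum n F'' \<le> Theta A M f'"
    unfolding 2 Th by (auto simp: le_fun_def intro!: mset_subset_eq_count image_mset_subseteq_mono)
  have 4: "rng_sum T = tau A f' \<longrightarrow> fam_sum n F'' = Theta A M f'"
  proof
    assume eqn: "rng_sum T = tau A f'"
    have "refine_all M (image_mset trng S) = paths_from M B'"
      by (rule cylsum_level_inj[OF lev paths_from_level[OF B'(1)]]) (use cyl eqn in simp)
    then show "fam_sum n F'' = Theta A M f'" unfolding 2 Th by simp
  qed
  show thesis by (rule that[OF F 1[folded B(2)] 3 4])
qed

lemma equid_translated_families:
  assumes "f \<in> CcV A" "translated_families n F F' F''" "sim_Theta A f (fam_sum n F)"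
  shows "equid (tau A f) (tau A (fam_sum n F''))"
  using equid_trans[OF equid_sim_Theta[OF assms(1) translated_families_CcV(1)[OF assms(2)] assms(3)]
      equid_of_families[OF assms(2)]] .

lemma rel_sim_iff:
  assumes f: "f \<in> CcV A" and f': "f' \<in> CcV A"
  shows "(f, f') \<in> rel_sim A \<longleftrightarrow> equid (tau A f) (tau A f')"
proof
  assume "(f, f') \<in> rel_sim A"
  then obtain n F F' F'' where
    F: "translated_families n F F' F''"
    and 1: "sim_Theta A f (fam_sum n F)"
    and 2: "sim_Theta A (fam_sum n F'') f'"
    unfolding rel_sim_translated by blast
  show "equid (tau A f) (tau A f')"
    using equid_trans[OF equid_translated_families[OF f F 1]
        equid_sim_Theta[OF translated_families_CcV(2)[OF F] f' 2]] .
next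
  assume "equid (tau A f) (tau A f')"
  then obtain T where T: "set_mset T \<subseteq> triples" "tau A f = src_sum T"
      "tau A f' = rng_sum T"
    unfolding equid_def by blast
  have rng: "rng_sum T \<le> tau A f'" using T(3) by simp
  obtain n F F' F'' M where
    F: "translated_families n F F' F''"
    and 1: "sim_Theta A f (fam_sum n F)" and "fam_sum n F'' \<le> Theta A M f'"
    and 2: "rng_sum T = tau A f' \<longrightarrow> fam_sum n F'' = Theta A M f'"
    by (rule obtain_translated_families[OF f f' T(1,2) rng])
  have "Theta A 0 (fam_sum n F'') = (fam_sum n F'')"
    by (rule Theta_0[OF translated_families_CcV(2)[OF F]])
  then have "sim_Theta A (fam_sum n F'') f'"
    using 2 T(3) unfolding sim_Theta_def by metis
  then show "(f, f') \<in> rel_sim A"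
    using F 1 f f' unfolding rel_sim_translated by blast
qed

lemma rel_precsim_iff:
  assumes f: "f \<in> CcV A" and f': "f' \<in> CcV A"
  shows "(f, f') \<in> rel_precsim A \<longleftrightarrow> subequid (tau A f) (tau A f')"
proof
  assume "(f, f') \<in> rel_precsim A"
  then obtain n F F' F'' f'' where
    F: "translated_families n F F' F''"
    and f'': "f'' \<in> CcV A"
    and 1: "sim_Theta A f (fam_sum n F)"
    and 2: "fam_sum n F'' \<le> f''" and 3: "sim_Theta A f'' f'"
    unfolding rel_precsim_translated by blast
  let ?S = "\<lambda>v. \<Sum>i=1..n. F'' i v"
  have S: "?S \<in> CcV A" using translated_families_CcV(2)[OF F] .
  have 4: "equid (tau A f) (tau A ?S)" by (rule equid_translated_families[OF f F 1])
  have "tau A ?S \<le> tau A f''" using 2 by (auto simp: le_fun_def tau_def)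
  then obtain H where H: "H \<in> Cyl" "(\<lambda>x. tau A ?S x + H x) = tau A f''"
    by (rule Cyl_diff[OF tau_Cyl[OF S] tau_Cyl[OF f'']])
  have "equid (\<lambda>x. tau A f x + H x) (tau A f'')"
    using equid_add[OF 4 equid_refl[OF H(1)]] H(2) by simp
  then have "equid (\<lambda>x. tau A f x + H x) (tau A f')"
    using equid_sim_Theta[OF f'' f' 3] equid_trans by blast
  then show "subequid (tau A f) (tau A f')"
    by (rule subequidI[OF tau_Cyl[OF f] tau_Cyl[OF f'] H(1)])
next
  assume sub: "subequid (tau A f) (tau A f')"
  obtain T N where S: "set_mset T \<subseteq> triples" "set_mset (image_mset tsrc T) \<subseteq> level N"
    "tau A f = src_sum T" "rng_sum T \<le> tau A f'"
    by (rule subequid_exact[OF tau_Cyl[OF f] sub])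
  obtain n F F' F'' M where
    F: "translated_families n F F' F''" "sim_Theta A f (fam_sum n F)"
      "fam_sum n F'' \<le> Theta A M f'"
    by (rule obtain_translated_families[OF f f' S(1,3,4)])
  have T: "Theta A M f' \<in> CcV A" using Theta_CcV f' .
  have "sim_Theta A (Theta A M f') f'"
    unfolding sim_Theta_def using Theta_0[OF T] by metis
  then show "(f, f') \<in> rel_precsim A"
    using F T f f' unfolding rel_precsim_translated by blast
qed

text \<open>
  \<open>Z(\<beta>)\<close> is equidecomposable with \<open>Z(s(\<beta>))\<close>, so \<open>\<tau>\<close> is surjective up to equidecomposability.
\<close>

lemma Cyl_equid_tau:
  assumes "F \<in> Cyl"
  obtains f where "f \<in> CcV A" "equid F (tau A f)"
proof -
  obtain B where B: "set_mset B \<subseteq> paths A" "F = cylsum B" using assms by (auto simp: Cyl_def)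
  let ?f = "count (image_mset (path_so A) B)" and ?t = "\<lambda>\<alpha>. ((path_so A \<alpha>, []), \<one>\<^bsub>Gr\<^esub>, \<alpha>)"
  have sub: "set_mset (image_mset (path_so A) B) \<subseteq> E0 A"
    unfolding set_image_mset using B(1) path_so_in by blast
  have "set_mset (image_mset ?t B) \<subseteq> triples"
    using B(1) path_so_in by (auto simp: mem_triples)
  moreover have "F = src_sum (image_mset ?t B)"
    using B(2) by (simp add: multiset.map_comp o_def)
  moreover have "tau A ?f = rng_sum (image_mset ?t B)"
    using tau_count[OF sub] by (simp add: multiset.map_comp o_def)
  ultimately have "equid F (tau A ?f)" unfolding equid_def by blast
  then show thesis using that count_CcV[OF sub] by blast
qed

section \<open>The topology of the space of infinite paths\<close>

lemma topspace_inf_top [simp]: "topspace (inf_top A) = inf_paths A"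
proof -
  have "\<Union> (cyl A ` paths A) = inf_paths A"
    using cyl_subset initial_in[where n = 0] self_mem_cyl_initial[where n = 0] by blast
  then show ?thesis by (simp add: inf_top_def)
qed

lemma openin_cyl: "\<beta> \<in> paths A \<Longrightarrow> openin (inf_top A) (cyl A \<beta>)"
  unfolding inf_top_def by (rule topology_generated_by_Basis) blast

lemma cyl_initial_mono:
  "x \<in> inf_paths A \<Longrightarrow> n \<le> m \<Longrightarrow> cyl A (initial m x) \<subseteq> cyl A (initial n x)"
proof
  fix y assume "x \<in> inf_paths A" "n \<le> m" "y \<in> cyl A (initial m x)"
  then show "y \<in> cyl A (initial n x)"
    using initial_mono[of n m y x] by (simp add: mem_cyl_initial)
qed

text \<open>
  The cylinders of the initial segments of \<open>x\<close> form a neighbourhood basis of \<open>x\<close>, since they are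
  nested.
\<close>

lemma open_inf_top_cyl:
  assumes "openin (inf_top A) U" "x \<in> U"
  shows "\<exists>n. cyl A (initial n x) \<subseteq> U"
proof -
  have "generate_topology_on (cyl A ` paths A) U"
    using assms(1) unfolding inf_top_def by (rule openin_topology_generated_by)
  moreover have "x \<in> inf_paths A" using openin_subset[OF assms(1)] assms(2) by auto
  ultimately show ?thesis using assms(2)
  proof (induction arbitrary: x rule: generate_topology_on.induct)
    case (Int a b)
    then obtain n m where nm: "cyl A (initial n x) \<subseteq> a" "cyl A (initial m x) \<subseteq> b" by blast
    then have "cyl A (initial (max n m) x) \<subseteq> a \<inter> b"
      using cyl_initial_mono[OF Int.prems(1), of n "max n m"] cyl_initial_mono[OF Int.prems(1), of m "max n m"]
      by fastforce
    then show ?case by blast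
  next
    case (UN K)
    then obtain k where k: "k \<in> K" "x \<in> k" by blast
    then obtain n where "cyl A (initial n x) \<subseteq> k" using UN.IH[OF k(1) UN.prems(1) k(2)] by blast
    then show ?case using k(1) by blast
  next
    case (Basis s)
    then obtain \<beta> where \<beta>: "\<beta> \<in> paths A" "s = cyl A \<beta>" by blast
    then have "initial (length (snd \<beta>)) x = \<beta>" using Basis.prems by (simp add: mem_cyl)
    then show ?case using \<beta> by (intro exI[of _ "length (snd \<beta>)"]) simp
  qed simp
qed

lemma open_inf_topI:
  assumes "U \<subseteq> inf_paths A" "\<And>x. x \<in> U \<Longrightarrow> \<exists>n. cyl A (initial n x) \<subseteq> U"
  shows "openin (inf_top A) U"
proof (rule iffD2[OF openin_subopen], rule ballI)
  fix x assume x: "x \<in> U"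
  obtain n where "cyl A (initial n x) \<subseteq> U" using assms(2)[OF x] by blast
  then show "\<exists>T. openin (inf_top A) T \<and> x \<in> T \<and> T \<subseteq> U"
    using x assms(1) by (intro exI[of _ "cyl A (initial n x)"]) (auto intro!: openin_cyl initial_in self_mem_cyl_initial)
qed

lemma cyl_split:
  assumes "\<beta> \<in> paths A"
  shows "cyl A \<beta> = (\<Union>e\<in>edges_into (path_so A \<beta>). cyl A (path_extend \<beta> [e]))"
proof
  show "cyl A \<beta> \<subseteq> (\<Union>e\<in>edges_into (path_so A \<beta>). cyl A (path_extend \<beta> [e]))"
  proof
    fix x assume "x \<in> cyl A \<beta>"
    then have x: "x \<in> inf_paths A" "initial (length (snd \<beta>)) x = \<beta>" using assms by (auto simp: mem_cyl)
    let ?e = "x !! length (snd \<beta>)"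
    have ini: "initial (Suc (length (snd \<beta>))) x = path_extend \<beta> [?e]"
      using initial_extend[of "length (snd \<beta>)" "Suc (length (snd \<beta>))" x] x(2) by simp
    then have "path_extend \<beta> [?e] \<in> paths A" using initial_in[OF x(1)] by metis
    then have "?e \<in> edges_into (path_so A \<beta>)"
      by (cases \<beta>) (auto simp: path_extend_def paths_append paths_Cons)
    moreover have "x \<in> cyl A (path_extend \<beta> [?e])"
      using self_mem_cyl_initial[OF x(1), of "Suc (length (snd \<beta>))"] ini by simp
    ultimately show "x \<in> (\<Union>e\<in>edges_into (path_so A \<beta>). cyl A (path_extend \<beta> [e]))" by blast
  qed
  show "(\<Union>e\<in>edges_into (path_so A \<beta>). cyl A (path_extend \<beta> [e])) \<subseteq> cyl A \<beta>"
  proof (rule UN_least)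
    fix e assume "e \<in> edges_into (path_so A \<beta>)"
    then show "cyl A (path_extend \<beta> [e]) \<subseteq> cyl A \<beta>"
      by (intro cyl_extend_subset[OF assms]) (auto simp: paths_Cons)
  qed
qed

text \<open>
  Koenig's lemma. If a cylinder has no finite subcover, neither has the cylinder of some
  one-edge extension, because there are only finitely many of these. Iterating yields an
  infinite path, and a member of the cover that contains it also contains the cylinder of one of its
  initial segments.
\<close>

lemma compactin_cyl:
  assumes \<beta>0: "\<beta>0 \<in> paths A"
  shows "compactin (inf_top A) (cyl A \<beta>0)"
  unfolding compactin_def
proof (intro conjI allI impI)
  show "cyl A \<beta>0 \<subseteq> topspace (inf_top A)" using cyl_subset \<beta>0 by simp
  fix \<U> assume U: "(\<forall>U\<in>\<U>. openin (inf_top A) U) \<and> cyl A \<beta>0 \<subseteq> \<Union> \<U>"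
  define good where "good \<beta> \<longleftrightarrow> (\<exists>\<F>. finite \<F> \<and> \<F> \<subseteq> \<U> \<and> cyl A \<beta> \<subseteq> \<Union> \<F>)" for \<beta>
  have step: "\<exists>e. e \<in> edges_into (path_so A \<beta>) \<and> \<not> good (path_extend \<beta> [e])"
    if \<beta>: "\<beta> \<in> paths A" "\<not> good \<beta>" for \<beta>
  proof (rule ccontr)
    let ?I = "edges_into (path_so A \<beta>)"
    assume "\<not> ?thesis"
    then have "\<forall>e\<in>?I. \<exists>\<F>. finite \<F> \<and> \<F> \<subseteq> \<U> \<and> cyl A (path_extend \<beta> [e]) \<subseteq> \<Union> \<F>"
      unfolding good_def by blast
    then obtain \<F> where \<F>: "\<And>e. e \<in> ?I \<Longrightarrow> finite (\<F> e) \<and> \<F> e \<subseteq> \<U> \<and> cyl A (path_extend \<beta> [e]) \<subseteq> \<Union> (\<F> e)"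
      by metis
    have "finite (\<Union>e\<in>?I. \<F> e)" using finite_edges_into[OF path_so_in[OF \<beta>(1)]] \<F> by blast
    moreover have "(\<Union>e\<in>?I. \<F> e) \<subseteq> \<U>" using \<F> by blast
    moreover have "cyl A \<beta> \<subseteq> \<Union> (\<Union>e\<in>?I. \<F> e)"
      unfolding cyl_split[OF \<beta>(1)]
    proof (rule UN_least)
      fix e assume e: "e \<in> ?I"
      show "cyl A (path_extend \<beta> [e]) \<subseteq> \<Union> (\<Union>e\<in>?I. \<F> e)" using \<F>[OF e] e by blast
    qed
    ultimately have "good \<beta>" unfolding good_def by (intro exI[of _ "\<Union>e\<in>?I. \<F> e"]) simp
    then show False using \<beta>(2) by simp
  qed
  have "good \<beta>0"
  proof (rule ccontr)
    assume bad: "\<not> good \<beta>0"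
    define c where "c \<beta> = (SOME e. e \<in> edges_into (path_so A \<beta>) \<and> \<not> good (path_extend \<beta> [e]))" for \<beta>
    have c: "c \<beta> \<in> edges_into (path_so A \<beta>)" "\<not> good (path_extend \<beta> [c \<beta>])"
      if "\<beta> \<in> paths A" "\<not> good \<beta>" for \<beta>
      using someI_ex[OF step[OF that]] unfolding c_def by auto
    define b where "b n = ((\<lambda>\<beta>. path_extend \<beta> [c \<beta>]) ^^ n) \<beta>0" for n
    have b_Suc: "b (Suc n) = path_extend (b n) [c (b n)]" and b_0: "b 0 = \<beta>0" for n by (simp_all add: b_def)
    have b: "b n \<in> paths A \<and> \<not> good (b n)" for n
    proof (induction n)
      case (Suc n)
      then show ?case using c[of "b n"] by (auto simp: b_Suc path_extend_in paths_Cons)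
    qed (simp add: b_0 \<beta>0 bad)
    have cb: "c (b n) \<in> E1 A" "rg A (c (b n)) = path_so A (b n)" for n using c[of "b n"] b[of n] by auto
    \<comment> \<open>The infinite path along which no cylinder has a finite subcover, as a continuation of \<open>\<beta>0\<close>.\<close>
    define \<eta> where "\<eta> = smap (\<lambda>n. c (b n)) nats"
    have \<eta>_nth: "\<eta> !! n = c (b n)" for n by (simp add: \<eta>_def)
    have so_b: "path_so A (b (Suc n)) = so A (c (b n))" for n by (simp add: b_Suc path_so_extend)
    have "\<eta> \<in> inf_paths A"
      unfolding inf_paths_def using cb by (auto simp: \<eta>_nth sset_range so_b simp del: snth.simps)
    moreover have "inf_rg A \<eta> = path_so A \<beta>0"
      using \<eta>_nth[of 0] cb(2)[of 0] by (simp add: inf_rg_def b_0)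
    ultimately have x: "snd \<beta>0 @- \<eta> \<in> inf_paths A" "initial (length (snd \<beta>0)) (snd \<beta>0 @- \<eta>) = \<beta>0"
      using shift_in[OF \<beta>0] by auto
    let ?x = "snd \<beta>0 @- \<eta>"
    have bn: "b n = path_extend \<beta>0 (stake n \<eta>)" for n
      by (induction n) (simp_all add: b_0 b_Suc stake_Suc \<eta>_nth path_extend_append del: stake.simps(2))
    have ini: "initial (length (snd \<beta>0) + n) ?x = b n" for n
      using initial_extend[of "length (snd \<beta>0)" "length (snd \<beta>0) + n" ?x] x(2) bn[of n]
      by (simp add: sdrop_shift)
    have "?x \<in> cyl A \<beta>0" using x \<beta>0 by (simp add: mem_cyl)
    then obtain U1 where U1: "U1 \<in> \<U>" "?x \<in> U1" using U by blast
    then obtain n where n: "cyl A (initial n ?x) \<subseteq> U1" using U open_inf_top_cyl by blast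
    have "cyl A (b n) \<subseteq> U1"
      using n cyl_initial_mono[OF x(1), of n "length (snd \<beta>0) + n"] ini by simp
    then have "good (b n)" unfolding good_def using U1(1) by (intro exI[of _ "{U1}"]) auto
    then show False using b by blast
  qed
  then show "\<exists>\<F>. finite \<F> \<and> \<F> \<subseteq> \<U> \<and> cyl A \<beta>0 \<subseteq> \<Union> \<F>" unfolding good_def .
qed

lemma cylsum_pos: "cylsum B x \<noteq> 0 \<longleftrightarrow> (\<exists>\<beta>\<in>#B. x \<in> cyl A \<beta>)"
  by (induction B) (auto simp: cylsum_add_mset indicator_def)

text \<open>
  A property of cylinders that passes to smaller ones and holds near each point of a compact set
  holds for the members of a finite cover at a single level. It is applied to constancy of a
  function and to the existence of a basic bisection inside a given one.
\<close>

lemma compactin_level_cover: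
  assumes S: "compactin (inf_top A) S"
    and Q: "\<And>x. x \<in> S \<Longrightarrow> \<exists>\<beta>\<in>paths A. x \<in> cyl A \<beta> \<and> Q \<beta>"
    and hered: "\<And>\<beta> es. \<beta> \<in> paths A \<Longrightarrow> (path_so A \<beta>, es) \<in> paths A \<Longrightarrow> Q \<beta> \<Longrightarrow> Q (path_extend \<beta> es)"
  obtains N D where "finite D" "D \<subseteq> level N" "S \<subseteq> (\<Union>\<beta>\<in>D. cyl A \<beta>)" "\<And>\<beta>. \<beta> \<in> D \<Longrightarrow> Q \<beta>"
proof -
  let ?P = "{\<beta> \<in> paths A. Q \<beta>}"
  have "\<exists>\<F>. finite \<F> \<and> \<F> \<subseteq> cyl A ` ?P \<and> S \<subseteq> \<Union> \<F>"
    by (rule compactinD[OF S]) (use openin_cyl Q in blast)+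
  then obtain \<F> where \<F>: "finite \<F>" "\<F> \<subseteq> cyl A ` ?P" "S \<subseteq> \<Union> \<F>" by blast
  then obtain C where C: "C \<subseteq> ?P" "finite C" "\<F> = cyl A ` C" using finite_subset_image[OF \<F>(1,2)] by blast
  obtain N where N: "\<forall>\<beta>\<in>#mset_set C. length (snd \<beta>) \<le> N" using ex_length_bound[of "mset_set C" "\<lambda>x. x"] by blast
  let ?D = "refine_all N (mset_set C)"
  have Cp: "set_mset (mset_set C) \<subseteq> paths A" using C by auto
  show thesis
  proof (rule that[of "set_mset ?D" N])
    show "set_mset ?D \<subseteq> level N" by (rule refine_all_level[OF Cp N])
    show "S \<subseteq> (\<Union>\<beta>\<in>set_mset ?D. cyl A \<beta>)"
    proof
      fix x assume "x \<in> S"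
      then obtain \<beta> where "\<beta> \<in># mset_set C" "x \<in> cyl A \<beta>" using \<F>(3) C by auto
      then have "cylsum (mset_set C) x \<noteq> 0" using cylsum_pos by blast
      then have "cylsum ?D x \<noteq> 0" using cylsum_refine_all[OF Cp] by simp
      then show "x \<in> (\<Union>\<beta>\<in>set_mset ?D. cyl A \<beta>)" using cylsum_pos by blast
    qed
    fix \<beta>' assume "\<beta>' \<in># ?D"
    then obtain \<beta> es where \<beta>: "\<beta> \<in> C" "es \<in># path_mset (N - length (snd \<beta>)) (path_so A \<beta>)" "\<beta>' = path_extend \<beta> es"
      using C(2) by (auto simp: refine_all_def refine_def)
    then have "\<beta> \<in> paths A" "Q \<beta>" using C(1) by auto
    then show "Q \<beta>'" using hered \<beta> path_so_in in_path_mset by metis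
  qed simp
qed

lemma continuous_nat_iff:
  "continuous_map (inf_top A) (discrete_topology UNIV) f \<longleftrightarrow>
   (\<forall>x\<in>inf_paths A. \<exists>n. \<forall>y\<in>cyl A (initial n x). f y = f x)"
proof
  assume c: "continuous_map (inf_top A) (discrete_topology UNIV) f"
  show "\<forall>x\<in>inf_paths A. \<exists>n. \<forall>y\<in>cyl A (initial n x). f y = f x"
  proof
    fix x assume x: "x \<in> inf_paths A"
    have "openin (inf_top A) {y \<in> topspace (inf_top A). f y \<in> {f x}}"
      by (rule openin_continuous_map_preimage[OF c]) simp
    then show "\<exists>n. \<forall>y\<in>cyl A (initial n x). f y = f x"
      using open_inf_top_cyl[of "{y \<in> topspace (inf_top A). f y \<in> {f x}}" x] x by auto
  qed
next
  assume c: "\<forall>x\<in>inf_paths A. \<exists>n. \<forall>y\<in>cyl A (initial n x). f y = f x"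
  have "openin (inf_top A) {y \<in> inf_paths A. f y \<in> V}" for V
  proof (rule open_inf_topI)
    fix x assume x: "x \<in> {y \<in> inf_paths A. f y \<in> V}"
    then obtain n where "\<forall>y\<in>cyl A (initial n x). f y = f x" using c by blast
    then show "\<exists>n. cyl A (initial n x) \<subseteq> {y \<in> inf_paths A. f y \<in> V}"
      using x cyl_subset[OF initial_in, of x n] by (intro exI[of _ n]) auto
  qed auto
  then show "continuous_map (inf_top A) (discrete_topology UNIV) f"
    by (simp add: continuous_map_def)
qed

lemma support_closed:
  assumes "continuous_map (inf_top A) (discrete_topology UNIV) (f :: _ \<Rightarrow> nat)"
  shows "inf_top A closure_of {x \<in> topspace (inf_top A). f x \<noteq> 0} = {x \<in> inf_paths A. f x \<noteq> 0}"
proof -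
  have "closedin (inf_top A) {x \<in> topspace (inf_top A). f x \<in> - {0}}"
    by (rule closedin_continuous_map_preimage[OF assms]) (simp add: closedin_def)
  then show ?thesis by (simp add: closure_of_eq)
qed

text \<open>
  A continuous function to \<open>\<nat>\<close> is locally constant; compactness of the support gives a level at which
  it is constant on cylinders.
\<close>

lemma Cc_eq_Cyl: "Cc (inf_top A) = Cyl"
proof (intro equalityI subsetI)
  fix f assume fC: "f \<in> Cyl"
  obtain N0 where "\<And>N. N \<ge> N0 \<Longrightarrow> \<exists>B. set_mset B \<subseteq> level N \<and> f = cylsum B"
    using Cyl_level[OF fC] by metis
  then obtain B where B: "set_mset B \<subseteq> level N0" "f = cylsum B" by blast
  have f: "f x = (if x \<in> inf_paths A then count B (initial N0 x) else 0)" for x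
    using cylsum_level B by blast
  have cont: "continuous_map (inf_top A) (discrete_topology UNIV) f"
    unfolding continuous_nat_iff
  proof
    fix x assume x: "x \<in> inf_paths A"
    show "\<exists>n. \<forall>y\<in>cyl A (initial n x). f y = f x"
      using x by (intro exI[of _ N0]) (simp add: f mem_cyl_initial)
  qed
  have "{x \<in> inf_paths A. f x \<noteq> 0} = (\<Union>\<beta>\<in>set_mset B. cyl A \<beta>)"
  proof -
    have "f x \<noteq> 0 \<longleftrightarrow> (\<exists>\<beta>\<in>#B. x \<in> cyl A \<beta>)" for x unfolding B(2) by (rule cylsum_pos)
    moreover have "f x \<noteq> 0 \<Longrightarrow> x \<in> inf_paths A" for x using f[of x] by (auto split: if_splits)
    ultimately show ?thesis by auto
  qed
  moreover have "compactin (inf_top A) (\<Union>\<beta>\<in>set_mset B. cyl A \<beta>)"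
    using subset_trans[OF B(1) level_paths] compactin_cyl by (intro compactin_Union) blast+
  ultimately have "compactin (inf_top A) {x \<in> inf_paths A. f x \<noteq> 0}" by simp
  then show "f \<in> Cc (inf_top A)"
    unfolding Cc_def using cont support_closed[OF cont] f by simp
next
  fix f assume "f \<in> Cc (inf_top A)"
  then have cont: "continuous_map (inf_top A) (discrete_topology UNIV) f"
    and "compactin (inf_top A) (inf_top A closure_of {x \<in> topspace (inf_top A). f x \<noteq> 0})"
    and zero: "\<And>x. x \<notin> inf_paths A \<Longrightarrow> f x = 0"
    by (auto simp: Cc_def)
  then have comp: "compactin (inf_top A) {x \<in> inf_paths A. f x \<noteq> 0}"
    using support_closed by simp
  let ?Q = "\<lambda>\<beta>. \<exists>c. \<forall>y\<in>cyl A \<beta>. f y = c"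
  obtain N D where D: "finite D" "D \<subseteq> level N" "{x \<in> inf_paths A. f x \<noteq> 0} \<subseteq> (\<Union>\<beta>\<in>D. cyl A \<beta>)"
    "\<And>\<beta>. \<beta> \<in> D \<Longrightarrow> ?Q \<beta>"
  proof (rule compactin_level_cover[OF comp, of ?Q])
    fix x assume x: "x \<in> {x \<in> inf_paths A. f x \<noteq> 0}"
    then obtain n where "\<forall>y\<in>cyl A (initial n x). f y = f x" using cont continuous_nat_iff by blast
    then show "\<exists>\<beta>\<in>paths A. x \<in> cyl A \<beta> \<and> ?Q \<beta>"
      using x initial_in self_mem_cyl_initial by blast
  next
    fix \<beta> es assume "\<beta> \<in> paths A" "(path_so A \<beta>, es) \<in> paths A" "?Q \<beta>"
    then show "?Q (path_extend \<beta> es)" using cyl_extend_subset by blast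
  qed (rule that)
  obtain c where c: "\<And>\<beta> y. \<beta> \<in> D \<Longrightarrow> y \<in> cyl A \<beta> \<Longrightarrow> f y = c \<beta>" using D(4) by metis
  \<comment> \<open>Some of the cylinders may lie outside the support; they occur with multiplicity \<open>c \<beta> = 0\<close>.\<close>
  define B where "B = (\<Sum>\<beta>\<in>#mset_set D. replicate_mset (c \<beta>) \<beta>)"
  have countB: "count B \<beta> = (if \<beta> \<in> D then c \<beta> else 0)" for \<beta>
    unfolding B_def count_sum_mset_family using D(1) by (simp flip: sum_unfold_sum_mset)
  have lev: "set_mset B \<subseteq> level N" using countB D(2) by (metis (no_types, lifting) count_eq_zero_iff subset_iff)
  have "f x = cylsum B x" for x
  proof (cases "x \<in> inf_paths A")
    case True
    show ?thesis
    proof (cases "initial N x \<in> D")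
      case in_D: True
      then have "f x = c (initial N x)" using c self_mem_cyl_initial[OF True] by blast
      then show ?thesis using True in_D by (simp add: cylsum_level[OF lev] countB)
    next
      case False
      have "x \<notin> cyl A \<beta>" if "\<beta> \<in> D" for \<beta>
        using that D(2) False by (auto simp: level_def mem_cyl)
      then have "f x = 0" using D(3) True by blast
      then show ?thesis using True False by (simp add: cylsum_level[OF lev] countB)
    qed
  qed (simp add: zero cylsum_level[OF lev])
  then have "f = cylsum B" by blast
  then show "f \<in> Cyl" using lev level_paths CylI by blast
qed

section \<open>The action on infinite paths\<close>

text \<open>
  Infinite paths are controlled by their initial segments, which reduces the action on infinite
  paths to the action on lists.
\<close>

lemma inf_path_iff: "x \<in> inf_paths A \<and> inf_rg A x = v \<longleftrightarrow> (\<forall>n. (v, stake n x) \<in> paths A)"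
proof
  assume "x \<in> inf_paths A \<and> inf_rg A x = v"
  then show "\<forall>n. (v, stake n x) \<in> paths A" using initial_in unfolding initial_def by blast
next
  assume p: "\<forall>n. (v, stake n x) \<in> paths A"
  have "x !! i \<in> E1 A \<and> so A (x !! i) = rg A (x !! Suc i)" for i
  proof -
    have "stake (Suc (Suc i)) x = stake i x @ [x !! i, x !! Suc i]"
      by (simp add: stake_Suc del: stake.simps(2) snth.simps(2))
    then have "(v, stake i x @ [x !! i, x !! Suc i]) \<in> paths A" using p by metis
    then show ?thesis by (simp add: paths_append paths_Cons del: snth.simps(2))
  qed
  moreover have "inf_rg A x = v" using p[rule_format, of "Suc 0"] by (simp add: paths_Cons inf_rg_def)
  ultimately show "x \<in> inf_paths A \<and> inf_rg A x = v" by (auto simp: inf_paths_def sset_range simp del: snth.simps(2))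
qed

lemma stake_inf_act: "stake n (inf_act A g x) = list_act A g (stake n x)"
  by (induction n arbitrary: g x) auto

lemma inf_act_shift: "inf_act A g (es @- x) = list_act A g es @- inf_act A (list_restr A g es) x"
proof (induction es arbitrary: g)
  case (Cons e es)
  then show ?case by (subst inf_act.code) simp
qed simp

lemma inf_act_in:
  assumes "g \<in> carrier Gr" "x \<in> inf_paths A"
  shows "inf_act A g x \<in> inf_paths A \<and> inf_rg A (inf_act A g x) = vact A g (inf_rg A x)"
proof -
  have "\<forall>n. (inf_rg A x, stake n x) \<in> paths A" using inf_path_iff assms(2) by blast
  then show ?thesis using list_act_path(1)[OF assms(1)] unfolding inf_path_iff stake_inf_act by blast
qed

text \<open>
  The cocycle identity for \<open>1 = g\<^sup>-\<^sup>1 g\<close>.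
\<close>

lemma restr_inv: "g \<in> carrier Gr \<Longrightarrow> e \<in> E1 A \<Longrightarrow> restr A (inv\<^bsub>Gr\<^esub> g) (eact A g e) = inv\<^bsub>Gr\<^esub> (restr A g e)"
  using restr_mult[of "inv\<^bsub>Gr\<^esub> g" g e] by (simp add: Gr.inv_equality)

lemma list_act_inv:
  "g \<in> carrier Gr \<Longrightarrow> set es \<subseteq> E1 A \<Longrightarrow> list_act A (inv\<^bsub>Gr\<^esub> g) (list_act A g es) = es"
  by (induction es arbitrary: g) (auto simp: restr_inv)

lemma inf_act_inv: 
  assumes "g \<in> carrier Gr" "x \<in> inf_paths A" 
  shows "inf_act A (inv\<^bsub>Gr\<^esub> g) (inf_act A g x) = x"
proof (rule stream_eqI)
  fix n
  have "set (stake n x) \<subseteq> E1 A" using path_edges initial_in[OF assms(2)] unfolding initial_def by blast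
  then show "stake n (inf_act A (inv\<^bsub>Gr\<^esub> g) (inf_act A g x)) = stake n x"
    by (simp add: stake_inf_act list_act_inv assms(1))
qed

abbreviation tact where "tact t \<equiv> sgp_act A (Some t)"

lemma tact_in:
  assumes "t \<in> triples" "x \<in> cyl A (tsrc t)"
  shows "tact t x \<in> cyl A (trng t)" "tact (tinv t) (tact t x) = x"
proof -
  obtain \<alpha> g \<beta> where t: "t = (\<alpha>, g, \<beta>)" by (metis prod.exhaust)
  then have T: "\<alpha> \<in> paths A" "g \<in> carrier Gr" "\<beta> \<in> paths A" "path_so A \<alpha> = vact A g (path_so A \<beta>)"
    using assms(1) by (auto simp: mem_triples)
  obtain \<eta> where x: "x = snd \<beta> @- \<eta>" "\<eta> \<in> inf_paths A" "inf_rg A \<eta> = path_so A \<beta>"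
    using assms(2) by (auto simp: t cyl_def)
  have act: "tact t x = snd \<alpha> @- inf_act A g \<eta>" by (simp add: t x sdrop_shift)
  show "tact t x \<in> cyl A (trng t)"
    unfolding act using inf_act_in[OF T(2) x(2)] x(3) T(4) by (auto simp: t cyl_def)
  show "tact (tinv t) (tact t x) = x"
    unfolding act by (simp add: t sdrop_shift inf_act_inv[OF T(2) x(2)] x(1))
qed

lemma tinv_tinv [simp]: "t \<in> triples \<Longrightarrow> tinv (tinv t) = t"
  by (cases t) (auto simp: mem_triples)

lemma tact_image:
  assumes "t \<in> triples"
  shows "tact t ` cyl A (tsrc t) = cyl A (trng t)" "inj_on (tact t) (cyl A (tsrc t))"
proof
  show "tact t ` cyl A (tsrc t) \<subseteq> cyl A (trng t)" using tact_in(1)[OF assms] by blast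
  show "cyl A (trng t) \<subseteq> tact t ` cyl A (tsrc t)"
  proof
    fix y assume "y \<in> cyl A (trng t)"
    then have y: "y \<in> cyl A (tsrc (tinv t))" by simp
    have "tact (tinv t) y \<in> cyl A (tsrc t)" "tact t (tact (tinv t) y) = y"
      using tact_in[OF tinv_in[OF assms] y] assms by simp_all
    then show "y \<in> tact t ` cyl A (tsrc t)" by (metis imageI)
  qed
  show "inj_on (tact t) (cyl A (tsrc t))"
    using tact_in(2)[OF assms] by (rule inj_on_inverseI)
qed

section \<open>Germs\<close>

text \<open>
  The restriction of a triple to the cylinder of the initial segment of length \<open>n\<close> of \<open>x\<close>, or the triple
  itself if its source path is longer than that.
\<close>

definition tcut where
  "tcut n x t = textend t (drop (length (snd (tsrc t))) (stake n x))"

lemma tsrc_textend [simp]: "tsrc (textend t es) = path_extend (tsrc t) es"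
  by (cases t) simp

lemma textend_append: "textend (textend t es) fs = textend t (es @ fs)"
  by (cases t) (simp add: path_extend_append list_act_append list_restr_append)

lemma textend_Nil [simp]: "textend t [] = t"
  by (cases t) simp

lemma tcut_short: "n \<le> length (snd (tsrc t)) \<Longrightarrow> tcut n x t = t"
  by (simp add: tcut_def)

text \<open>
  Restrictions to decreasing neighbourhoods compose, so coincidence of restrictions persists when \<open>n\<close>
  grows. This gives transitivity of equality of germs.
\<close>

lemma tcut_tcut:
  assumes "n \<le> m"
  shows "tcut m x (tcut n x t) = tcut m x t"
proof (cases "length (snd (tsrc t)) \<le> n")
  case True
  let ?b = "length (snd (tsrc t))"
  have "length (snd (tsrc (tcut n x t))) = n" using True by (simp add: tcut_def)
  moreover have "drop ?b (stake n x) @ drop n (stake m x) = drop ?b (stake m x)"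
    using True assms stake_add[of n x "m - n"] by (metis drop_stake drop_append diff_is_0_eq drop0 le_add_diff_inverse length_stake)
  ultimately show ?thesis unfolding tcut_def textend_append by simp
next
  case False
  then show ?thesis by (simp add: tcut_short)
qed

lemma tcut_mono: "n \<le> m \<Longrightarrow> tcut n x t = tcut n x u \<Longrightarrow> tcut m x t = tcut m x u"
  using tcut_tcut by metis

lemma tcut_initial: "initial n x = initial n y \<Longrightarrow> tcut n x t = tcut n y t"
  by (simp add: tcut_def initial_def)

lemma tact_tcut:
  assumes "t \<in> triples" "x \<in> cyl A (tsrc t)"
  shows "tact (tcut n x t) x = tact t x"
proof (cases "length (snd (tsrc t)) \<le> n")
  case True
  obtain \<alpha> g \<beta> where t: "t = (\<alpha>, g, \<beta>)" by (metis prod.exhaust)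
  let ?b = "length (snd \<beta>)"
  have b: "?b \<le> n" using True t by simp
  then have "sdrop ?b x = stake (n - ?b) (sdrop ?b x) @- sdrop n x"
    using stake_sdrop[of "n - ?b" "sdrop ?b x"] by simp
  then show ?thesis using b
    by (simp add: t tcut_def drop_stake) (metis inf_act_shift shift_append)
next
  case False
  then show ?thesis by (simp add: tcut_short)
qed

lemma list_act_Nil_iff [simp]: "list_act A g es = [] \<longleftrightarrow> es = []"
  by (cases es) auto

text \<open>
  In a nonzero idempotent \<open>(\<alpha>, g, \<beta>)\<close> the lengths force \<open>\<alpha> = \<beta>\<close>, and then \<open>gg = g\<close>.
\<close>

lemma idempotent_unit:
  assumes "e \<in> sgp_set A" "sgp_mult A e e = e" "x \<in> sgp_dom A e"
  obtains \<delta> where "\<delta> \<in> paths A" "e = Some (\<delta>, \<one>\<^bsub>Gr\<^esub>, \<delta>)" "x \<in> cyl A \<delta>"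
proof -
  obtain \<alpha> g \<beta> where e: "e = Some (\<alpha>, g, \<beta>)" using assms(3) by (cases e) auto
  have "(\<alpha>, g, \<beta>) \<in> triples" using assms(1) by (simp add: triples_def e)
  then have T: "\<alpha> \<in> paths A" "g \<in> carrier Gr" "\<beta> \<in> paths A"
    unfolding mem_triples by auto
  have "\<alpha> = \<beta>"
    using assms(2) by (auto simp: e Let_def prod_eq_iff prefix_def split: if_splits)
  then have "g \<otimes>\<^bsub>Gr\<^esub> g = g" using assms(2) T(2) by (simp add: e)
  then have "g = \<one>\<^bsub>Gr\<^esub>" using T(2) Gr.l_cancel_one' by metis
  then show thesis using that e T \<open>\<alpha> = \<beta>\<close> assms(3) by simp
qed

text \<open>
  Multiplication by an idempotent is restriction. The two cases of the product correspond to the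
  initial segment being longer or shorter than the source path.
\<close>

lemma sgp_mult_unit:
  assumes t: "t \<in> triples" and x: "x \<in> cyl A (tsrc t)"
  shows "sgp_mult A (Some t) (Some (initial n x, \<one>\<^bsub>Gr\<^esub>, initial n x)) = Some (tcut n x t)"
proof -
  obtain \<alpha> g \<beta> where te: "t = (\<alpha>, g, \<beta>)" by (metis prod.exhaust)
  then have T: "\<alpha> \<in> paths A" "g \<in> carrier Gr" "\<beta> \<in> paths A" using t by (auto simp: mem_triples)
  define m where "m = length (snd \<beta>)"
  have xi: "x \<in> inf_paths A" and \<beta>: "\<beta> = initial m x" using x T by (auto simp: te mem_cyl m_def)
  have ed: "set (stake k (sdrop j x)) \<subseteq> E1 A" for k j
    using path_edges initial_in[OF sdrop_inf_paths[OF xi]] unfolding initial_def by blast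
  show ?thesis
  proof (cases "m \<le> n")
    case True
    then have "prefix (stake m x) (stake n x)" by (metis le_add_diff_inverse prefixI stake_add)
    then show ?thesis using True T(2) ed
      by (simp add: te \<beta> tcut_def initial_def path_extend_def drop_stake)
         (metis ed le_add_diff_inverse list_restr_closed stake_add Gr.r_one)
  next
    case False
    then have "prefix (stake n x) (stake m x)" by (metis le_add_diff_inverse nat_le_linear prefixI stake_add)
    moreover have "\<not> prefix (stake m x) (stake n x)" using False prefix_length_le by fastforce
    moreover have "stake n x @ stake (m - n) (sdrop n x) = stake m x" using False by (simp add: stake_add)
    ultimately show ?thesis using False T(2) ed[of "m - n" n]
      by (simp add: te \<beta> tcut_def initial_def path_extend_def drop_stake Let_def)
  qed
qed

text \<open>
  The idempotents with \<open>x\<close> in their domain are those of the initial segments of \<open>x\<close>, so germs are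
  compared by restricting to initial segments.
\<close>

lemma germ_rel_iff:
  "((Some t, x), (Some u, y)) \<in> germ_rel A \<longleftrightarrow>
   t \<in> triples \<and> u \<in> triples \<and> x = y \<and> x \<in> cyl A (tsrc t) \<and> x \<in> cyl A (tsrc u) \<and>
   (\<exists>n. tcut n x t = tcut n x u)"
proof -
  have dom: "sgp_dom A (Some s) = cyl A (tsrc s)" for s by (cases s) simp
  show ?thesis
  proof
    assume "((Some t, x), (Some u, y)) \<in> germ_rel A"
    then obtain e where *: "t \<in> triples" "u \<in> triples" "x = y" "x \<in> cyl A (tsrc t)" "x \<in> cyl A (tsrc u)"
      and e: "e \<in> sgp_set A" "sgp_mult A e e = e" "x \<in> sgp_dom A e"
      "sgp_mult A (Some t) e = sgp_mult A (Some u) e"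
      unfolding germ_rel_def triples_def by (auto simp: dom simp del: sgp_dom.simps sgp_mult.simps)
    obtain \<delta> where \<delta>: "\<delta> \<in> paths A" "e = Some (\<delta>, \<one>\<^bsub>Gr\<^esub>, \<delta>)" "x \<in> cyl A \<delta>"
      by (rule idempotent_unit[OF e(1-3)])
    define n where "n = length (snd \<delta>)"
    have "\<delta> = initial n x" using \<delta>(1,3) by (simp add: mem_cyl n_def)
    then have "tcut n x t = tcut n x u"
      using e(4) sgp_mult_unit[OF *(1,4), of n] sgp_mult_unit[OF *(2,5), of n] \<delta>(2) by simp
    then show "t \<in> triples \<and> u \<in> triples \<and> x = y \<and> x \<in> cyl A (tsrc t) \<and> x \<in> cyl A (tsrc u) \<and>
      (\<exists>n. tcut n x t = tcut n x u)" using * by blast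
  next
    assume *: "t \<in> triples \<and> u \<in> triples \<and> x = y \<and> x \<in> cyl A (tsrc t) \<and> x \<in> cyl A (tsrc u) \<and>
      (\<exists>n. tcut n x t = tcut n x u)"
    then obtain n where n: "tcut n x t = tcut n x u" by blast
    let ?e = "(initial n x, \<one>\<^bsub>Gr\<^esub>, initial n x)"
    have x: "x \<in> inf_paths A" using * cyl_subset[OF triples_paths(1)] by blast
    have e: "?e \<in> triples" "x \<in> cyl A (initial n x)"
      using triple_path[OF initial_in[OF x]] self_mem_cyl_initial[OF x] by auto
    have "sgp_mult A (Some t) (Some ?e) = sgp_mult A (Some u) (Some ?e)"
    proof -
      have tu: "t \<in> triples" "x \<in> cyl A (tsrc t)" "u \<in> triples" "x \<in> cyl A (tsrc u)" using * by blast+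
      show ?thesis unfolding sgp_mult_unit[OF tu(1,2)] sgp_mult_unit[OF tu(3,4)] n ..
    qed
    moreover have "sgp_mult A (Some ?e) (Some ?e) = Some ?e"
      using sgp_mult_unit[OF e(1), of x n] e(2) by (simp add: tcut_short del: sgp_mult.simps)
    ultimately show "((Some t, x), (Some u, y)) \<in> germ_rel A"
      unfolding germ_rel_def using * e
      by (auto simp: dom triples_def simp del: sgp_dom.simps sgp_mult.simps intro!: bexI[of _ "Some ?e"])
  qed
qed

abbreviation tgerm where "tgerm t x \<equiv> germ A (Some t) x"

lemma tgerm_eq: "t \<in> triples \<Longrightarrow> x \<in> cyl A (tsrc t) \<Longrightarrow>
   tgerm t x = {(Some u, x) | u. u \<in> triples \<and> x \<in> cyl A (tsrc u) \<and> (\<exists>n. tcut n x t = tcut n x u)}"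
proof -
  assume t: "t \<in> triples" "x \<in> cyl A (tsrc t)"
  have none: "((Some t, x), (None, y)) \<notin> germ_rel A" for y by (auto simp: germ_rel_def)
  show ?thesis
  proof (intro equalityI subsetI)
    fix p assume "p \<in> tgerm t x"
    then have p: "((Some t, x), p) \<in> germ_rel A" by (simp add: germ_def)
    obtain u y where pu: "p = (u, y)" by (cases p)
    obtain u' where "p = (Some u', y)" using p none pu by (cases u) auto
    then show "p \<in> {(Some u, x) | u. u \<in> triples \<and> x \<in> cyl A (tsrc u) \<and> (\<exists>n. tcut n x t = tcut n x u)}"
      using p germ_rel_iff[of t x u' y] by blast
  next
    fix p assume "p \<in> {(Some u, x) | u. u \<in> triples \<and> x \<in> cyl A (tsrc u) \<and> (\<exists>n. tcut n x t = tcut n x u)}"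
    then obtain u where "p = (Some u, x)" "u \<in> triples" "x \<in> cyl A (tsrc u)" "\<exists>n. tcut n x t = tcut n x u"
      by blast
    then show "p \<in> tgerm t x" using t germ_rel_iff[of t x u x] by (simp add: germ_def)
  qed
qed

lemma self_in_tgerm: "t \<in> triples \<Longrightarrow> x \<in> cyl A (tsrc t) \<Longrightarrow> (Some t, x) \<in> tgerm t x"
  unfolding tgerm_eq by blast

lemma tgerm_eq_iff:
  assumes t: "t \<in> triples" "x \<in> cyl A (tsrc t)" and u: "u \<in> triples" "y \<in> cyl A (tsrc u)"
  shows "tgerm t x = tgerm u y \<longleftrightarrow> x = y \<and> (\<exists>n. tcut n x t = tcut n x u)"
proof
  assume "tgerm t x = tgerm u y"
  then have "(Some t, x) \<in> tgerm u y" using self_in_tgerm[OF t] by simp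
  then show "x = y \<and> (\<exists>n. tcut n x t = tcut n x u)" using tgerm_eq[OF u] by (auto intro: sym)
next
  assume "x = y \<and> (\<exists>n. tcut n x t = tcut n x u)"
  then obtain n where xy: "x = y" and n: "tcut n x t = tcut n x u" by blast
  have "(\<exists>m. tcut m x t = tcut m x s) \<longleftrightarrow> (\<exists>m. tcut m x u = tcut m x s)" for s
  proof
    assume "\<exists>m. tcut m x t = tcut m x s"
    then obtain m where "tcut m x t = tcut m x s" by blast
    then have "tcut (max n m) x u = tcut (max n m) x s"
      using tcut_mono[OF max.cobounded1[of n m] n] tcut_mono[OF max.cobounded2[of m n]] by metis
    then show "\<exists>m. tcut m x u = tcut m x s" by blast
  next
    assume "\<exists>m. tcut m x u = tcut m x s"
    then obtain m where "tcut m x u = tcut m x s" by blast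
    then have "tcut (max n m) x t = tcut (max n m) x s"
      using tcut_mono[OF max.cobounded1[of n m] n] tcut_mono[OF max.cobounded2[of m n]] by metis
    then show "\<exists>m. tcut m x t = tcut m x s" by blast
  qed
  then show "tgerm t x = tgerm u y" using tgerm_eq[OF t] tgerm_eq[OF u] xy by simp
qed

abbreviation GG where "GG \<equiv> germ_groupoid A"

lemma gsrc_tgerm [simp]: "t \<in> triples \<Longrightarrow> x \<in> cyl A (tsrc t) \<Longrightarrow> gsrc GG (tgerm t x) = x"
proof -
  assume t: "t \<in> triples" "x \<in> cyl A (tsrc t)"
  have "snd ` tgerm t x = {x}" using self_in_tgerm[OF t] unfolding tgerm_eq[OF t] by force
  then show ?thesis by (simp add: germ_groupoid_def)
qed

lemma grng_tgerm [simp]: "t \<in> triples \<Longrightarrow> x \<in> cyl A (tsrc t) \<Longrightarrow> grng GG (tgerm t x) = tact t x"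
proof -
  assume t: "t \<in> triples" "x \<in> cyl A (tsrc t)"
  have "(\<lambda>(t, x). sgp_act A t x) p = tact t x" if pt: "p \<in> tgerm t x" for p
  proof -
    obtain u n where p: "p = (Some u, x)" "u \<in> triples" "x \<in> cyl A (tsrc u)" "tcut n x t = tcut n x u"
      using pt unfolding tgerm_eq[OF t] by blast
    then show ?thesis using tact_tcut[OF t, of n] tact_tcut[OF p(2,3), of n] by simp
  qed
  then have "(\<lambda>(t, x). sgp_act A t x) ` tgerm t x = {tact t x}"
    using self_in_tgerm[OF t] by (auto intro: rev_image_eqI)
  then show ?thesis by (simp add: germ_groupoid_def)
qed

lemma tgerm_textend:
  assumes t: "t \<in> triples" and es: "(path_so A (tsrc t), es) \<in> paths A"
    and x: "x \<in> cyl A (path_extend (tsrc t) es)"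
  shows "tgerm (textend t es) x = tgerm t x"
proof -
  have p: "tsrc t \<in> paths A" using triples_paths t by blast
  have x': "x \<in> cyl A (tsrc t)" using cyl_extend_subset[OF p es] x by blast
  let ?n = "length (snd (tsrc t)) + length es"
  have "initial ?n x = path_extend (tsrc t) es" using x p es by (simp add: mem_cyl path_extend_in)
  then have "snd (initial ?n x) = snd (tsrc t) @ es" by simp
  then have "drop (length (snd (tsrc t))) (stake ?n x) = es" unfolding initial_def by simp
  then have "textend t es = tcut ?n x t" by (simp add: tcut_def)
  then have "tcut ?n x (textend t es) = tcut ?n x t" using tcut_tcut[of ?n ?n x t] by simp
  then have "\<exists>n. tcut n x (textend t es) = tcut n x t" by blast
  then show ?thesis using tgerm_eq_iff[OF textend_in[OF t es], of x t x] x x' t by simp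
qed

section \<open>Compact open bisections\<close>

abbreviation bis where "bis t \<equiv> tgerm t ` cyl A (tsrc t)"

lemma sgp_dom_Some [simp]: "sgp_dom A (Some t) = cyl A (tsrc t)"
  by (cases t) simp

lemma germ_basis_cases:
  assumes "G \<in> {germ A t ` U | t U. t \<in> sgp_set A \<and> openin (inf_top A) U \<and> U \<subseteq> sgp_dom A t}"
  shows "G = {} \<or> (\<exists>t\<in>triples. \<exists>U. G = tgerm t ` U \<and> openin (inf_top A) U \<and> U \<subseteq> cyl A (tsrc t))"
proof -
  obtain t U where *: "G = germ A t ` U" "t \<in> sgp_set A" "openin (inf_top A) U" "U \<subseteq> sgp_dom A t"
    using assms by blast
  show ?thesis
  proof (cases t)
    case None
    then show ?thesis using * by simp
  next
    case (Some u)
    then have "u \<in> triples" "U \<subseteq> cyl A (tsrc u)" using * by (simp_all add: triples_def)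
    then show ?thesis using *(1,3) Some by blast
  qed
qed

lemma arr_top_eq: "arr_top GG = topology_generated_by
   {germ A t ` U | t U. t \<in> sgp_set A \<and> openin (inf_top A) U \<and> U \<subseteq> sgp_dom A t}"
  by (simp add: germ_groupoid_def)

lemma unit_top_eq [simp]: "unit_top GG = inf_top A"
  by (simp add: germ_groupoid_def)

lemma openin_tgerm_image:
  assumes "t \<in> triples" "openin (inf_top A) U" "U \<subseteq> cyl A (tsrc t)"
  shows "openin (arr_top GG) (tgerm t ` U)"
  unfolding arr_top_eq
proof (rule topology_generated_by_Basis)
  have "Some t \<in> sgp_set A" "U \<subseteq> sgp_dom A (Some t)" using assms by (simp_all add: triples_def)
  then show "tgerm t ` U \<in> {germ A t ` U | t U. t \<in> sgp_set A \<and> openin (inf_top A) U \<and> U \<subseteq> sgp_dom A t}"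
    using assms(2) by blast
qed

lemma arrow_cases:
  assumes "\<gamma> \<in> topspace (arr_top GG)"
  obtains t x where "t \<in> triples" "x \<in> cyl A (tsrc t)" "\<gamma> = tgerm t x"
proof -
  obtain G where G: "\<gamma> \<in> G" "G \<in> {germ A t ` U | t U. t \<in> sgp_set A \<and> openin (inf_top A) U \<and> U \<subseteq> sgp_dom A t}"
    using assms unfolding arr_top_eq topology_generated_by_topspace by (rule UnionE)
  obtain t U where "t \<in> triples" "G = tgerm t ` U" "U \<subseteq> cyl A (tsrc t)"
    using germ_basis_cases[OF G(2)] G(1) by blast
  moreover from this obtain x where "x \<in> U" "\<gamma> = tgerm t x" using G(1) by blast
  ultimately show thesis using that[of t x] by blast
qed

lemma tgerm_arrow: "t \<in> triples \<Longrightarrow> x \<in> cyl A (tsrc t) \<Longrightarrow> tgerm t x \<in> topspace (arr_top GG)"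
proof -
  assume t: "t \<in> triples" "x \<in> cyl A (tsrc t)"
  have "openin (arr_top GG) (bis t)"
    by (rule openin_tgerm_image[OF t(1) openin_cyl[OF triples_paths(1)[OF t(1)]] subset_refl])
  then show "tgerm t x \<in> topspace (arr_top GG)" using t(2) openin_subset by blast
qed

text \<open>
  Continuity of \<open>x \<mapsto> [t, x]\<close>. On a basic open set the point is that a coincidence of germs at \<open>x\<close> is
  witnessed by an initial segment of \<open>x\<close>, and hence persists on a cylinder around \<open>x\<close>.
\<close>

lemma openin_tgerm_preimage:
  assumes "openin (arr_top GG) W" "t \<in> triples"
  shows "openin (inf_top A) {x \<in> cyl A (tsrc t). tgerm t x \<in> W}"
proof -
  have cyl_open: "openin (inf_top A) (cyl A (tsrc t))" using openin_cyl triples_paths(1) assms(2) by blast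
  have "generate_topology_on {germ A t ` U | t U. t \<in> sgp_set A \<and> openin (inf_top A) U \<and> U \<subseteq> sgp_dom A t} W"
    using assms(1) unfolding arr_top_eq by (rule openin_topology_generated_by)
  then show ?thesis
  proof (induction rule: generate_topology_on.induct)
    case (Int a b)
    have "{x \<in> cyl A (tsrc t). tgerm t x \<in> a \<inter> b} =
      {x \<in> cyl A (tsrc t). tgerm t x \<in> a} \<inter> {x \<in> cyl A (tsrc t). tgerm t x \<in> b}" by blast
    then show ?case using openin_Int[OF Int.IH] by simp
  next
    case (UN K)
    have "{x \<in> cyl A (tsrc t). tgerm t x \<in> \<Union>K} = \<Union> ((\<lambda>k. {x \<in> cyl A (tsrc t). tgerm t x \<in> k}) ` K)" by blast
    moreover have "openin (inf_top A) (\<Union> ((\<lambda>k. {x \<in> cyl A (tsrc t). tgerm t x \<in> k}) ` K))"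
      using UN.IH by (intro openin_Union) blast
    ultimately show ?case by simp
  next
    case (Basis G)
    show ?case
    proof (rule open_inf_topI)
      show "{x \<in> cyl A (tsrc t). tgerm t x \<in> G} \<subseteq> inf_paths A"
        using cyl_subset[OF triples_paths(1)[OF assms(2)]] by blast
      fix x assume "x \<in> {x \<in> cyl A (tsrc t). tgerm t x \<in> G}"
      then have x: "x \<in> cyl A (tsrc t)" "tgerm t x \<in> G" by auto
      have xi: "x \<in> inf_paths A" using x cyl_subset[OF triples_paths(1)[OF assms(2)]] by blast
      obtain u U where u: "u \<in> triples" "G = tgerm u ` U" "openin (inf_top A) U" "U \<subseteq> cyl A (tsrc u)"
        using germ_basis_cases[OF Basis] x(2) by blast
      obtain y where y: "y \<in> U" "tgerm t x = tgerm u y" using x(2) u(2) by blast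
      have yu: "y \<in> cyl A (tsrc u)" using y(1) u(4) by blast
      obtain n where n: "x = y" "tcut n x t = tcut n x u" using tgerm_eq_iff[OF assms(2) x(1) u(1) yu] y(2) by blast
      obtain k where k: "cyl A (initial k x) \<subseteq> U" using open_inf_top_cyl[OF u(3) y(1)] n(1) by blast
      obtain j where j: "cyl A (initial j x) \<subseteq> cyl A (tsrc t)" using open_inf_top_cyl[OF cyl_open x(1)] by blast
      \<comment> \<open>Long enough for the germs to coincide, for the cylinder to lie in \<open>U\<close> and in the domain of \<open>t\<close>.\<close>
      define m where "m = max n (max k j)"
      have m: "n \<le> m" "k \<le> m" "j \<le> m" by (auto simp: m_def)
      have "cyl A (initial m x) \<subseteq> {x \<in> cyl A (tsrc t). tgerm t x \<in> G}"
      proof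
        fix z assume z: "z \<in> cyl A (initial m x)"
        then have zU: "z \<in> U" and zt: "z \<in> cyl A (tsrc t)"
          using cyl_initial_mono[OF xi m(2)] cyl_initial_mono[OF xi m(3)] k j by blast+
        have "initial m z = initial m x" using z xi by (simp add: mem_cyl_initial)
        then have "initial n x = initial n z" using initial_mono[OF m(1)] by metis
        then have "tcut n z t = tcut n z u" using n(2) tcut_initial[of n x z] by simp
        then have "tgerm t z = tgerm u z" using tgerm_eq_iff[OF assms(2) zt u(1), of z] zU u(4) by blast
        then show "z \<in> {x \<in> cyl A (tsrc t). tgerm t x \<in> G}" using zt zU u(2) by blast
      qed
      then show "\<exists>n. cyl A (initial n x) \<subseteq> {x \<in> cyl A (tsrc t). tgerm t x \<in> G}" by blast
    qed
  qed simp
qed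

text \<open>
  Compactness is inherited from the cylinder of the source path, along \<open>x \<mapsto> [t, x]\<close>.
\<close>

lemma bis_compact_open_bisection:
  assumes t: "t \<in> triples"
  shows "bis t \<in> compact_open_bisections GG"
proof -
  let ?C = "cyl A (tsrc t)"
  have C: "openin (inf_top A) ?C" "compactin (inf_top A) ?C"
    using openin_cyl compactin_cyl triples_paths(1)[OF t] by blast+
  have "continuous_map (subtopology (inf_top A) ?C) (arr_top GG) (tgerm t)"
    unfolding continuous_map_def
  proof (intro conjI allI impI)
    have top: "topspace (subtopology (inf_top A) ?C) = ?C" using openin_subset[OF C(1)] by auto
    show "tgerm t \<in> topspace (subtopology (inf_top A) ?C) \<rightarrow> topspace (arr_top GG)"
      unfolding top using tgerm_arrow[OF t] by blast
    fix W assume "openin (arr_top GG) W"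
    then have "openin (inf_top A) {x \<in> ?C. tgerm t x \<in> W}" using t by (rule openin_tgerm_preimage)
    then show "openin (subtopology (inf_top A) ?C)
        {x \<in> topspace (subtopology (inf_top A) ?C). tgerm t x \<in> W}"
      unfolding top openin_open_subtopology[OF C(1)] by blast
  qed
  moreover have "compactin (subtopology (inf_top A) ?C) ?C" using C(2) by (simp add: compactin_subtopology)
  ultimately have "compactin (arr_top GG) (bis t)" using image_compactin by blast
  moreover have "openin (arr_top GG) (bis t)" by (rule openin_tgerm_image[OF t C(1) subset_refl])
  moreover have "inj_on (gsrc GG) (bis t)" using t by (auto simp: inj_on_def)
  moreover have "inj_on (grng GG) (bis t)" using tact_image(2)[OF t] t by (auto simp: inj_on_def)
  ultimately show ?thesis by (simp add: compact_open_bisections_def)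
qed

lemma gsrc_bis: "t \<in> triples \<Longrightarrow> gsrc GG ` bis t = cyl A (tsrc t)"
  by (force simp: image_image)

lemma grng_bis: "t \<in> triples \<Longrightarrow> grng GG ` bis t = cyl A (trng t)"
proof -
  assume t: "t \<in> triples"
  have "grng GG ` bis t = tact t ` cyl A (tsrc t)"
    unfolding image_image using t by (intro image_cong) auto
  then show ?thesis using tact_image(1)[OF t] by simp
qed

lemma continuous_gsrc: "continuous_map (arr_top GG) (inf_top A) (gsrc GG)"
  unfolding continuous_map_def
proof (intro conjI allI impI)
  show "gsrc GG \<in> topspace (arr_top GG) \<rightarrow> topspace (inf_top A)"
  proof
    fix \<gamma> assume "\<gamma> \<in> topspace (arr_top GG)"
    then obtain t x where "t \<in> triples" "x \<in> cyl A (tsrc t)" "\<gamma> = tgerm t x" by (rule arrow_cases)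
    then show "gsrc GG \<gamma> \<in> topspace (inf_top A)" using cyl_subset[OF triples_paths(1)[of t]] by auto
  qed
  fix V assume V: "openin (inf_top A) V"
  have "{\<gamma> \<in> topspace (arr_top GG). gsrc GG \<gamma> \<in> V} = (\<Union>t\<in>triples. tgerm t ` (V \<inter> cyl A (tsrc t)))"
  proof (intro equalityI subsetI)
    fix \<gamma> assume \<gamma>: "\<gamma> \<in> {\<gamma> \<in> topspace (arr_top GG). gsrc GG \<gamma> \<in> V}"
    then have "\<gamma> \<in> topspace (arr_top GG)" by blast
    then obtain t x where "t \<in> triples" "x \<in> cyl A (tsrc t)" "\<gamma> = tgerm t x" by (rule arrow_cases)
    then show "\<gamma> \<in> (\<Union>t\<in>triples. tgerm t ` (V \<inter> cyl A (tsrc t)))" using \<gamma> by auto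
  next
    fix \<gamma> assume "\<gamma> \<in> (\<Union>t\<in>triples. tgerm t ` (V \<inter> cyl A (tsrc t)))"
    then obtain t x where "t \<in> triples" "x \<in> V" "x \<in> cyl A (tsrc t)" "\<gamma> = tgerm t x" by blast
    then show "\<gamma> \<in> {\<gamma> \<in> topspace (arr_top GG). gsrc GG \<gamma> \<in> V}" using tgerm_arrow by simp
  qed
  moreover have "openin (arr_top GG) (\<Union>t\<in>triples. tgerm t ` (V \<inter> cyl A (tsrc t)))"
  proof (rule openin_Union)
    fix S assume "S \<in> (\<lambda>t. tgerm t ` (V \<inter> cyl A (tsrc t))) ` triples"
    then obtain t where t: "t \<in> triples" "S = tgerm t ` (V \<inter> cyl A (tsrc t))" by blast
    have "openin (inf_top A) (V \<inter> cyl A (tsrc t))"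
      by (rule openin_Int[OF V openin_cyl[OF triples_paths(1)[OF t(1)]]])
    then show "openin (arr_top GG) S" unfolding t(2) using openin_tgerm_image[OF t(1)] by blast
  qed
  ultimately show "openin (arr_top GG) {\<gamma> \<in> topspace (arr_top GG). gsrc GG \<gamma> \<in> V}" by simp
qed

lemma bis_textend:
  assumes t: "t \<in> triples" and es: "(path_so A (tsrc t), es) \<in> paths A"
  shows "bis (textend t es) = tgerm t ` cyl A (path_extend (tsrc t) es)" "bis (textend t es) \<subseteq> bis t"
proof -
  show eq: "bis (textend t es) = tgerm t ` cyl A (path_extend (tsrc t) es)"
    unfolding tsrc_textend using tgerm_textend[OF t es] by (rule image_cong[OF refl])
  show "bis (textend t es) \<subseteq> bis t"
    unfolding eq by (rule image_mono[OF cyl_extend_subset[OF triples_paths(1)[OF t] es]])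
qed

text \<open>
  By continuity of \<open>x \<mapsto> [t, x]\<close> an open set that contains \<open>[t, x]\<close> contains all germs of \<open>t\<close> over some
  cylinder around \<open>x\<close>, and these are the germs of a restriction of \<open>t\<close>. So the basic bisections form a
  base.
\<close>

lemma bis_base:
  assumes W: "openin (arr_top GG) W" and \<gamma>: "\<gamma> \<in> W"
  obtains t where "t \<in> triples" "gsrc GG \<gamma> \<in> cyl A (tsrc t)" "bis t \<subseteq> W"
proof -
  have "\<gamma> \<in> topspace (arr_top GG)" using \<gamma> openin_subset[OF W] by blast
  then obtain t x where t: "t \<in> triples" "x \<in> cyl A (tsrc t)" "\<gamma> = tgerm t x" by (rule arrow_cases)
  have p: "tsrc t \<in> paths A" using triples_paths(1)[OF t(1)] .
  have xi: "x \<in> inf_paths A" using t(2) cyl_subset[OF p] by blast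
  have "x \<in> {x \<in> cyl A (tsrc t). tgerm t x \<in> W}" using t \<gamma> by blast
  then obtain k where k: "cyl A (initial k x) \<subseteq> {x \<in> cyl A (tsrc t). tgerm t x \<in> W}"
    using open_inf_top_cyl[OF openin_tgerm_preimage[OF W t(1)]] by blast
  let ?b = "length (snd (tsrc t))"
  \<comment> \<open>Long enough for the cylinder to be small and for \<open>t\<close> to be restricted to it.\<close>
  define n where "n = max k ?b"
  have n: "k \<le> n" "?b \<le> n" by (auto simp: n_def)
  let ?es = "stake (n - ?b) (sdrop ?b x)"
  have b: "initial ?b x = tsrc t" using t(2) p by (simp add: mem_cyl)
  have ini: "initial n x = path_extend (tsrc t) ?es" using initial_extend[OF n(2), of x] b by simp
  have es: "(path_so A (tsrc t), ?es) \<in> paths A"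
    using initial_in[OF sdrop_inf_paths[OF xi, of ?b], of "n - ?b"] inf_rg_sdrop[OF xi, of ?b] b
    by (simp add: initial_def)
  show thesis
  proof (rule that[of "textend t ?es"])
    show "textend t ?es \<in> triples" by (rule textend_in[OF t(1) es])
    show "gsrc GG \<gamma> \<in> cyl A (tsrc (textend t ?es))"
      using t self_mem_cyl_initial[OF xi, of n] by (simp add: ini)
    show "bis (textend t ?es) \<subseteq> W"
      unfolding bis_textend(1)[OF t(1) es] ini[symmetric]
      using cyl_initial_mono[OF xi n(1)] k by blast
  qed
qed

text \<open>
  The source of \<open>U\<close> is compact and is covered, at some level, by finitely many cylinders over which \<open>U\<close>
  contains a basic bisection. Since the source map is injective on \<open>U\<close>, there is nothing else in \<open>U\<close> over
  these cylinders, so one basic bisection for each of them exhausts \<open>U\<close>.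
\<close>

lemma bisection_decomposition:
  assumes U: "U \<in> compact_open_bisections GG"
  obtains T where "set_mset T \<subseteq> triples"
    "indicator (gsrc GG ` U) = src_sum T"
    "indicator (grng GG ` U) = rng_sum T"
proof -
  have op: "openin (arr_top GG) U" and comp: "compactin (arr_top GG) U"
    and injr: "inj_on (grng GG) U" and injs: "inj_on (gsrc GG) U"
    using U by (auto simp: compact_open_bisections_def)
  define Q where "Q \<beta> \<longleftrightarrow> (\<exists>t\<in>triples. tsrc t = \<beta> \<and> bis t \<subseteq> U)" for \<beta>
  obtain N D where D: "finite D" "D \<subseteq> level N" "gsrc GG ` U \<subseteq> (\<Union>\<beta>\<in>D. cyl A \<beta>)" "\<And>\<beta>. \<beta> \<in> D \<Longrightarrow> Q \<beta>"
  proof (rule compactin_level_cover[OF image_compactin[OF comp continuous_gsrc], of Q])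
    fix x assume "x \<in> gsrc GG ` U"
    then obtain \<gamma> where \<gamma>: "x = gsrc GG \<gamma>" "\<gamma> \<in> U" by (rule imageE)
    obtain t where "t \<in> triples" "gsrc GG \<gamma> \<in> cyl A (tsrc t)" "bis t \<subseteq> U" by (rule bis_base[OF op \<gamma>(2)])
    then show "\<exists>\<beta>\<in>paths A. x \<in> cyl A \<beta> \<and> Q \<beta>"
      unfolding Q_def \<gamma>(1) using triples_paths(1) by (intro bexI[of _ "tsrc t"]) auto
  next
    fix \<beta> es assume \<beta>: "\<beta> \<in> paths A" "(path_so A \<beta>, es) \<in> paths A" "Q \<beta>"
    then obtain t where t: "t \<in> triples" "tsrc t = \<beta>" "bis t \<subseteq> U" unfolding Q_def by blast
    have es: "(path_so A (tsrc t), es) \<in> paths A" using \<beta>(2) t(2) by simp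
    have "bis (textend t es) \<subseteq> U" using bis_textend(2)[OF t(1) es] t(3) by (rule subset_trans)
    moreover have "tsrc (textend t es) = path_extend \<beta> es" using t(2) by simp
    ultimately show "Q (path_extend \<beta> es)" unfolding Q_def using textend_in[OF t(1) es] by blast
  qed (rule that)
  define u where "u \<beta> = (SOME t. t \<in> triples \<and> tsrc t = \<beta> \<and> bis t \<subseteq> U)" for \<beta>
  have u: "u \<beta> \<in> triples" "tsrc (u \<beta>) = \<beta>" "bis (u \<beta>) \<subseteq> U" if "\<beta> \<in> D" for \<beta>
  proof -
    have "\<exists>t. t \<in> triples \<and> tsrc t = \<beta> \<and> bis t \<subseteq> U" using D(4)[OF that] unfolding Q_def by blast
    then have "u \<beta> \<in> triples \<and> tsrc (u \<beta>) = \<beta> \<and> bis (u \<beta>) \<subseteq> U" unfolding u_def by (rule someI_ex)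
    then show "u \<beta> \<in> triples" "tsrc (u \<beta>) = \<beta>" "bis (u \<beta>) \<subseteq> U" by auto
  qed
  have U_eq: "U = (\<Union>\<beta>\<in>D. bis (u \<beta>))"
  proof
    show "(\<Union>\<beta>\<in>D. bis (u \<beta>)) \<subseteq> U" using u(3) by (rule UN_least)
    show "U \<subseteq> (\<Union>\<beta>\<in>D. bis (u \<beta>))"
    proof
      fix \<gamma> assume \<gamma>: "\<gamma> \<in> U"
      then obtain \<beta> where \<beta>: "\<beta> \<in> D" "gsrc GG \<gamma> \<in> cyl A \<beta>" using D(3) by blast
      let ?\<delta> = "tgerm (u \<beta>) (gsrc GG \<gamma>)"
      have \<delta>: "?\<delta> \<in> bis (u \<beta>)" "gsrc GG ?\<delta> = gsrc GG \<gamma>" using \<beta>(2) u[OF \<beta>(1)] by auto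
      then have "?\<delta> = \<gamma>" using inj_onD[OF injs] u(3)[OF \<beta>(1)] \<gamma> by blast
      then show "\<gamma> \<in> (\<Union>\<beta>\<in>D. bis (u \<beta>))" using \<delta>(1) \<beta>(1) by auto
    qed
  qed
  have disj_cyl: "cyl A \<beta> \<inter> cyl A \<beta>' = {}" if "\<beta> \<in> D" "\<beta>' \<in> D" "\<beta> \<noteq> \<beta>'" for \<beta> \<beta>'
  proof -
    have "\<beta> \<in> level N" "\<beta>' \<in> level N" using that D(2) by blast+
    then show ?thesis using that(3) by (auto simp: level_def mem_cyl)
  qed
  have disj: "disjoint_family_on (\<lambda>\<beta>. bis (u \<beta>)) D"
    unfolding disjoint_family_on_def
  proof (intro ballI impI)
    fix \<beta> \<beta>' assume \<beta>: "\<beta> \<in> D" "\<beta>' \<in> D" "\<beta> \<noteq> \<beta>'"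
    have "gsrc GG ` (bis (u \<beta>) \<inter> bis (u \<beta>')) \<subseteq> cyl A \<beta> \<inter> cyl A \<beta>'"
      using gsrc_bis[OF u(1)[OF \<beta>(1)]] gsrc_bis[OF u(1)[OF \<beta>(2)]] u(2)[OF \<beta>(1)] u(2)[OF \<beta>(2)]
        image_Int_subset[of "gsrc GG" "bis (u \<beta>)" "bis (u \<beta>')"] by simp
    then show "bis (u \<beta>) \<inter> bis (u \<beta>') = {}" using disj_cyl[OF \<beta>] by simp
  qed
  \<comment> \<open>The source and range maps are injective on \<open>U\<close>, so they keep the pieces disjoint.\<close>
  have image: "indicator (p ` U) x = (\<Sum>\<beta>\<in>D. indicator (p ` bis (u \<beta>)) x :: nat)"
    if p: "inj_on p U" for p :: "_ \<Rightarrow> 'e stream" and x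
  proof -
    have "disjoint_family_on (\<lambda>\<beta>. p ` bis (u \<beta>)) D"
      unfolding disjoint_family_on_def
    proof (intro ballI impI)
      fix \<beta> \<beta>' assume \<beta>: "\<beta> \<in> D" "\<beta>' \<in> D" "\<beta> \<noteq> \<beta>'"
      have "p ` bis (u \<beta>) \<inter> p ` bis (u \<beta>') = p ` (bis (u \<beta>) \<inter> bis (u \<beta>'))"
        by (rule inj_on_image_Int[OF p u(3)[OF \<beta>(1)] u(3)[OF \<beta>(2)], symmetric])
      then show "p ` bis (u \<beta>) \<inter> p ` bis (u \<beta>') = {}" using disj \<beta> by (simp add: disjoint_family_on_def)
    qed
    then show ?thesis unfolding U_eq image_UN by (rule indicator_UN_disjoint[OF D(1)])
  qed
  let ?T = "image_mset u (mset_set D)"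
  have T_sum: "cylsum (image_mset q ?T) x = (\<Sum>\<beta>\<in>D. indicator (cyl A (q (u \<beta>))) x)" for q x
    unfolding cylsum_def sum_unfold_sum_mset by (simp add: multiset.map_comp o_def)
  show thesis
  proof (rule that[of ?T])
    show "set_mset ?T \<subseteq> triples" using u(1) D(1) by auto
    show "indicator (gsrc GG ` U) = src_sum ?T"
      unfolding fun_eq_iff image[OF injs] T_sum using gsrc_bis u(1) by simp
    show "indicator (grng GG ` U) = rng_sum ?T"
      unfolding fun_eq_iff image[OF injr] T_sum using grng_bis u(1) by simp
  qed
qed

lemma FB_decomposition:
  assumes "b \<in> FB GG"
  obtains T where "set_mset T \<subseteq> triples"
    "pushforward GG (gsrc GG) b = src_sum T"
    "pushforward GG (grng GG) b = rng_sum T"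
proof -
  obtain n W where b: "b = (\<lambda>\<gamma>. \<Sum>k=1..n. indicator (W k) \<gamma>)"
    and W: "\<forall>k\<in>{1..n::nat}. W k \<in> compact_open_bisections GG"
    using assms unfolding FB_def by blast
  have "\<exists>T. set_mset T \<subseteq> triples \<and> indicator (gsrc GG ` W k) = src_sum T \<and>
     indicator (grng GG ` W k) = rng_sum T" if "k \<in> {1..n}" for k
    using bisection_decomposition[of "W k"] W that by metis
  then obtain T where T: "\<And>k. k \<in> {1..n} \<Longrightarrow> set_mset (T k) \<subseteq> triples"
    "\<And>k. k \<in> {1..n} \<Longrightarrow> indicator (gsrc GG ` W k) = src_sum (T k)"
    "\<And>k. k \<in> {1..n} \<Longrightarrow> indicator (grng GG ` W k) = rng_sum (T k)"
    by metis
  let ?T = "\<Sum>k\<in>#mset_set {1..n}. T k"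
  have cs: "cylsum (image_mset p ?T) = (\<lambda>x. \<Sum>k=1..n. cylsum (image_mset p (T k)) x)" for p
    by (simp only: image_mset_sum_mset cylsum_Union sum_unfold_sum_mset)
  show thesis
  proof (rule that[of ?T])
    show "set_mset ?T \<subseteq> triples"
    proof
      fix t assume "t \<in># ?T"
      then obtain k where "k \<in> {1..n}" "t \<in># T k" by auto
      then show "t \<in> triples" using T(1) by blast
    qed
    show "pushforward GG (gsrc GG) b = src_sum ?T"
      unfolding b pushforward_sum_bisections[OF W disjI1[OF refl]]
      unfolding cs by (intro ext sum.cong) (simp_all only: T(2))
    show "pushforward GG (grng GG) b = rng_sum ?T"
      unfolding b pushforward_sum_bisections[OF W disjI2[OF refl]]
      unfolding cs by (intro ext sum.cong) (simp_all only: T(3))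
  qed
qed

lemma FB_of_triples:
  assumes T: "set_mset T \<subseteq> triples"
  obtains b where "b \<in> FB GG"
    "pushforward GG (gsrc GG) b = src_sum T"
    "pushforward GG (grng GG) b = rng_sum T"
proof -
  obtain n :: nat and t where t: "\<forall>i\<in>{1..n}. t i \<in># T"
    and sum_all: "\<forall>h :: _ \<Rightarrow> nat. (\<Sum>i=1..n. h (t i)) = (\<Sum>u\<in>#T. h u)"
    by (rule obtain_enumeration)
  note sum_t = sum_all[rule_format]
  have t_in: "t i \<in> triples" if "i \<in> {1..n}" for i using t that T by blast
  have W: "\<forall>k\<in>{1..n}. bis (t k) \<in> compact_open_bisections GG"
    using bis_compact_open_bisection t_in by blast
  let ?b = "\<lambda>\<gamma>. \<Sum>k=1..n. indicator (bis (t k)) \<gamma> :: nat"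
  show thesis
  proof (rule that[of ?b])
    show "?b \<in> FB GG" unfolding FB_def
      by (rule CollectI, rule exI[of _ n], rule exI[of _ "\<lambda>k. bis (t k)"]) (use W in simp)
    have "(\<Sum>k=1..n. indicator (gsrc GG ` bis (t k)) x) = src_sum T x" for x
    proof -
      have "(\<Sum>k=1..n. indicator (gsrc GG ` bis (t k)) x :: nat) = (\<Sum>k=1..n. indicator (cyl A (tsrc (t k))) x)"
        using gsrc_bis t_in by (intro sum.cong) auto
      then show ?thesis unfolding sum_t[of "\<lambda>u. indicator (cyl A (tsrc u)) x"]
        by (simp add: cylsum_def multiset.map_comp o_def)
    qed
    then show "pushforward GG (gsrc GG) ?b = src_sum T"
      unfolding pushforward_sum_bisections[OF W disjI1[OF refl]] by blast
    have "(\<Sum>k=1..n. indicator (grng GG ` bis (t k)) x) = rng_sum T x" for x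
    proof -
      have "(\<Sum>k=1..n. indicator (grng GG ` bis (t k)) x :: nat) = (\<Sum>k=1..n. indicator (cyl A (trng (t k))) x)"
        using grng_bis t_in by (intro sum.cong) auto
      then show ?thesis unfolding sum_t[of "\<lambda>u. indicator (cyl A (trng u)) x"]
        by (simp add: cylsum_def multiset.map_comp o_def)
    qed
    then show "pushforward GG (grng GG) ?b = rng_sum T"
      unfolding pushforward_sum_bisections[OF W disjI2[OF refl]] by blast
  qed
qed

lemma rel_sim_G_iff: "(F, G) \<in> rel_sim_G GG \<longleftrightarrow> equid F G"
proof
  assume "(F, G) \<in> rel_sim_G GG"
  then obtain b where b: "b \<in> FB GG" "F = pushforward GG (gsrc GG) b" "pushforward GG (grng GG) b = G"
    unfolding rel_sim_G_def by blast
  obtain T where "set_mset T \<subseteq> triples" "pushforward GG (gsrc GG) b = src_sum T"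
    "pushforward GG (grng GG) b = rng_sum T" by (rule FB_decomposition[OF b(1)])
  then show "equid F G" unfolding equid_def using b(2,3) by (intro exI[of _ T]) simp
next
  assume eq: "equid F G"
  then obtain T where T: "set_mset T \<subseteq> triples" "F = src_sum T" "G = rng_sum T"
    unfolding equid_def by blast
  obtain b where "b \<in> FB GG" "pushforward GG (gsrc GG) b = src_sum T"
    "pushforward GG (grng GG) b = rng_sum T" by (rule FB_of_triples[OF T(1)])
  then have "\<exists>b\<in>FB GG. F = pushforward GG (gsrc GG) b \<and> pushforward GG (grng GG) b = G"
    using T(2,3) by (intro bexI[of _ b]) simp_all
  then show "(F, G) \<in> rel_sim_G GG" unfolding rel_sim_G_def using equid_Cyl[OF eq] by (simp add: Cc_eq_Cyl)
qed

lemma rel_precsim_B_iff: "(F, G) \<in> rel_precsim_B GG \<longleftrightarrow> F \<in> Cyl \<and> G \<in> Cyl \<and> subequid F G"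
proof
  assume "(F, G) \<in> rel_precsim_B GG"
  then obtain b where b: "b \<in> FB GG" "F \<le> pushforward GG (gsrc GG) b" "pushforward GG (grng GG) b \<le> G"
    and C: "F \<in> Cyl" "G \<in> Cyl"
    unfolding rel_precsim_B_def by (auto simp: Cc_eq_Cyl)
  obtain T where "set_mset T \<subseteq> triples" "pushforward GG (gsrc GG) b = src_sum T"
    "pushforward GG (grng GG) b = rng_sum T" by (rule FB_decomposition[OF b(1)])
  then have "subequid F G" unfolding subequid_def using b(2,3) by (intro exI[of _ T]) simp
  then show "F \<in> Cyl \<and> G \<in> Cyl \<and> subequid F G" using C by blast
next
  assume C: "F \<in> Cyl \<and> G \<in> Cyl \<and> subequid F G"
  then obtain T where T: "set_mset T \<subseteq> triples" "F \<le> src_sum T" "rng_sum T \<le> G"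
    unfolding subequid_def by blast
  obtain b where "b \<in> FB GG" "pushforward GG (gsrc GG) b = src_sum T"
    "pushforward GG (grng GG) b = rng_sum T" by (rule FB_of_triples[OF T(1)])
  then have "\<exists>b\<in>FB GG. F \<le> pushforward GG (gsrc GG) b \<and> pushforward GG (grng GG) b \<le> G"
    using T(2,3) by (intro bexI[of _ b]) simp_all
  then show "(F, G) \<in> rel_precsim_B GG" unfolding rel_precsim_B_def using C by (simp add: Cc_eq_Cyl)
qed

section \<open>The monoids as quotients\<close>

lemma CcV_comm_monoid: "comm_monoid (fun_monoid (CcV A))"
  by (rule comm_monoid_fun_monoid) (use CcV_zero CcV_add in blast)+

lemma Cyl_comm_monoid: "comm_monoid (fun_monoid Cyl)"
  by (rule comm_monoid_fun_monoid) (use Cyl_zero Cyl_add in blast)+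

lemma rel_sim_add:
  assumes "(f, f') \<in> rel_sim A" "(g, g') \<in> rel_sim A"
  shows "((\<lambda>v. f v + g v), (\<lambda>v. f' v + g' v)) \<in> rel_sim A"
proof -
  have c: "f \<in> CcV A" "f' \<in> CcV A" "g \<in> CcV A" "g' \<in> CcV A" using assms by (auto simp: rel_sim_def)
  show ?thesis
    using assms equid_add[of "tau A f" "tau A f'" "tau A g" "tau A g'"] c CcV_add
    by (simp add: rel_sim_iff tau_add)
qed

lemma rel_sim_CcV: "(f, f') \<in> rel_sim A \<Longrightarrow> f \<in> CcV A \<and> f' \<in> CcV A"
  by (simp add: rel_sim_def)

lemma rel_precsim_CcV: "(f, f') \<in> rel_precsim A \<Longrightarrow> f \<in> CcV A \<and> f' \<in> CcV A"
  by (simp add: rel_precsim_def)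

lemma equiv_rel_sim: "equiv (CcV A) (rel_sim A)"
proof (rule equivI)
  show "rel_sim A \<subseteq> CcV A \<times> CcV A" using rel_sim_CcV by auto
  show "refl_on (CcV A) (rel_sim A)"
    using rel_sim_iff equid_refl tau_Cyl by (simp add: refl_on_def)
  show "sym (rel_sim A)"
    using rel_sim_iff rel_sim_CcV equid_sym by (intro symI) blast
  show "trans (rel_sim A)"
  proof (rule transI)
    fix f g h assume fg: "(f, g) \<in> rel_sim A" and gh: "(g, h) \<in> rel_sim A"
    then have c: "f \<in> CcV A" "g \<in> CcV A" "h \<in> CcV A" using rel_sim_CcV by blast+
    then show "(f, h) \<in> rel_sim A" using fg gh equid_trans[of "tau A f" "tau A g" "tau A h"] by (simp add: rel_sim_iff)
  qed
qed

lemma equiv_rel_sim_G: "equiv Cyl (rel_sim_G GG)"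
proof (rule equivI)
  show "rel_sim_G GG \<subseteq> Cyl \<times> Cyl" using rel_sim_G_iff equid_Cyl by auto
  show "refl_on Cyl (rel_sim_G GG)" using rel_sim_G_iff equid_refl by (simp add: refl_on_def)
  show "sym (rel_sim_G GG)" using rel_sim_G_iff equid_sym by (intro symI) blast
  show "trans (rel_sim_G GG)" using rel_sim_G_iff equid_trans by (intro transI) blast
qed

lemma rel_sim_G_add:
  "(F, F') \<in> rel_sim_G GG \<Longrightarrow> (G, G') \<in> rel_sim_G GG \<Longrightarrow>
   ((\<lambda>x. F x + G x), (\<lambda>x. F' x + G' x)) \<in> rel_sim_G GG"
  unfolding rel_sim_G_iff by (rule equid_add)

lemma preorder_rel_precsim: "preorder_on (CcV A) (rel_precsim A)"
  unfolding preorder_on_def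
proof (intro conjI)
  show "rel_precsim A \<subseteq> CcV A \<times> CcV A" using rel_precsim_CcV by auto
  show "refl_on (CcV A) (rel_precsim A)"
    using rel_precsim_iff subequid_refl tau_Cyl by (simp add: refl_on_def)
  show "trans (rel_precsim A)"
  proof (rule transI)
    fix f g h assume fg: "(f, g) \<in> rel_precsim A" and gh: "(g, h) \<in> rel_precsim A"
    then have c: "f \<in> CcV A" "g \<in> CcV A" "h \<in> CcV A" using rel_precsim_CcV by blast+
    show "(f, h) \<in> rel_precsim A"
      using fg gh subequid_trans[OF tau_Cyl[OF c(1)] tau_Cyl[OF c(2)] tau_Cyl[OF c(3)]] c by (simp add: rel_precsim_iff)
  qed
qed

text \<open>
  \<open>preV\<close> and \<open>preX\<close> carry the preorders of which \<open>W\<close> and \<open>S\<^sub>B\<close> are the associated ordered monoids.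
  This makes one construction serve for \<open>W\<close>, for \<open>S\<^sub>B\<close> and for the quotient of \<open>V\<close>.
\<close>

definition preV where "preV = with_preorder (fun_monoid (CcV A)) (\<lambda>f g. (f, g) \<in> rel_precsim A)"
definition preX where "preX = with_preorder (fun_monoid Cyl) (\<lambda>F G. (F, G) \<in> rel_precsim_B GG)"

lemma preordered_preV: "preordered_monoid preV"
proof -
  have "((\<lambda>v. f v + h v), (\<lambda>v. g v + h v)) \<in> rel_precsim A"
    if c: "f \<in> CcV A" "g \<in> CcV A" "h \<in> CcV A" "(f, g) \<in> rel_precsim A" for f g h
    using c(4) subequid_add[OF tau_Cyl[OF c(1)] tau_Cyl[OF c(2)] tau_Cyl[OF c(3)]] c(1-3)
    by (simp add: rel_precsim_iff CcV_add tau_add)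
  moreover have "(f, f) \<in> rel_precsim A" if "f \<in> CcV A" for f
    using preorder_rel_precsim that by (auto simp: preorder_on_def refl_on_def)
  moreover have "(f, h) \<in> rel_precsim A" if "(f, g) \<in> rel_precsim A" "(g, h) \<in> rel_precsim A" for f g h
    using preorder_rel_precsim that unfolding preorder_on_def by (auto dest: transD)
  ultimately show ?thesis
    unfolding preordered_monoid_def preV_def using CcV_comm_monoid by auto
qed

lemma preordered_preX: "preordered_monoid preX"
proof -
  have "((\<lambda>v. f v + h v), (\<lambda>v. g v + h v)) \<in> rel_precsim_B GG"
    if c: "f \<in> Cyl" "g \<in> Cyl" "h \<in> Cyl" "(f, g) \<in> rel_precsim_B GG" for f g h
    using c(4) subequid_add[OF c(1-3)] c(1-3) by (simp add: rel_precsim_B_iff Cyl_add)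
  moreover have "(f, f) \<in> rel_precsim_B GG" if "f \<in> Cyl" for f
    using that subequid_refl by (simp add: rel_precsim_B_iff)
  moreover have "(f, h) \<in> rel_precsim_B GG" if "(f, g) \<in> rel_precsim_B GG" "(g, h) \<in> rel_precsim_B GG" for f g h
    using that subequid_trans[of f g h] by (simp add: rel_precsim_B_iff)
  ultimately show ?thesis
    unfolding preordered_monoid_def preX_def using Cyl_comm_monoid by auto
qed

lemma tilde_rel_preV: "tilde_rel preV = rel_approx A"
  using rel_precsim_CcV by (auto simp: tilde_rel_def preV_def rel_approx_def)

lemma tilde_rel_preX: "tilde_rel preX = rel_approx_B GG"
  by (auto simp: tilde_rel_def preX_def rel_approx_B_def rel_precsim_B_iff)

lemma quot_monoid_with_preorder: "quot_monoid (with_preorder M L) R = quot_monoid M R"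
  by (simp add: quot_monoid_def)

lemma W_mon_tilde: "W_mon A = tilde preV"
  unfolding W_mon_def tilde_def tilde_rel_preV by (simp add: preV_def quot_monoid_with_preorder)

lemma S_B_tilde: "S_B GG = tilde preX"
  unfolding S_B_def tilde_def tilde_rel_preX by (simp add: preX_def quot_monoid_with_preorder Cc_eq_Cyl)

abbreviation MV where "MV \<equiv> quot_monoid (fun_monoid (CcV A)) (rel_sim A)"
abbreviation MX where "MX \<equiv> quot_monoid (fun_monoid Cyl) (rel_sim_G GG)"

lemma V_mon_eq: "V_mon A = with_preorder MV (alg_le MV)"
  by (simp add: V_mon_def Let_def)

lemma S_typ_eq: "S_typ GG = with_preorder MX (alg_le MX)"
  by (simp add: S_typ_def Cc_eq_Cyl Let_def)

lemma presents_MV: "presents (CcV A) (\<lambda>f. rel_sim A `` {f}) MV"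
proof (rule presents_quotient[OF CcV_comm_monoid, where t = "\<lambda>f. f"])
  show "equiv (carrier (fun_monoid (CcV A))) (rel_sim A)" using equiv_rel_sim by simp
  show "\<exists>f\<in>CcV A. (y, f) \<in> rel_sim A" if "y \<in> carrier (fun_monoid (CcV A))" for y
    using equiv_rel_sim that by (auto simp: equiv_def refl_on_def)
qed (simp_all add: rel_sim_add)

lemma presents_MX: "presents (CcV A) (\<lambda>f. rel_sim_G GG `` {tau A f}) MX"
proof (rule presents_quotient[OF Cyl_comm_monoid])
  show "equiv (carrier (fun_monoid Cyl)) (rel_sim_G GG)" using equiv_rel_sim_G by simp
  show "\<exists>f\<in>CcV A. (F, tau A f) \<in> rel_sim_G GG" if "F \<in> carrier (fun_monoid Cyl)" for F
    using Cyl_equid_tau[of F] that rel_sim_G_iff by (metis fun_monoid_simps(1))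
qed (simp_all add: rel_sim_G_add tau_Cyl tau_zero tau_add)

lemma kernel_MV: "f \<in> CcV A \<Longrightarrow> g \<in> CcV A \<Longrightarrow>
    rel_sim A `` {f} = rel_sim A `` {g} \<longleftrightarrow> (f, g) \<in> rel_sim A"
  using eq_equiv_class_iff[OF equiv_rel_sim] by blast

lemma kernel_MX: "f \<in> CcV A \<Longrightarrow> g \<in> CcV A \<Longrightarrow>
    rel_sim_G GG `` {tau A f} = rel_sim_G GG `` {tau A g} \<longleftrightarrow> (f, g) \<in> rel_sim A"
  using eq_equiv_class_iff[OF equiv_rel_sim_G tau_Cyl tau_Cyl] by (simp add: rel_sim_G_iff rel_sim_iff)

lemma preordered_V: "preordered_monoid (V_mon A)"
  unfolding V_mon_eq using presents_MV by (intro comm_monoid_preord_alg) (simp add: presents_def)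

lemma preordered_S: "preordered_monoid (S_typ GG)"
  unfolding S_typ_eq using presents_MX by (intro comm_monoid_preord_alg) (simp add: presents_def)

lemma alg_le_presents:
  assumes "presents C q N" "f \<in> C"
  shows "alg_le N (q f) y \<longleftrightarrow> (\<exists>h\<in>C. q (\<lambda>x. f x + h x) = y)"
  using assms unfolding presents_def alg_le_def by (metis (no_types, lifting) imageE imageI)

text \<open>
  The algebraic preorder of \<open>V\<close> is \<open>\<precsim>\<close>: the complement, a function on infinite paths, is replaced by
  an equidecomposable one of the form \<open>\<tau>(h)\<close>.
\<close>

lemma precsim_iff_sim_add:
  assumes f: "f \<in> CcV A" and g: "g \<in> CcV A"
  shows "(f, g) \<in> rel_precsim A \<longleftrightarrow> (\<exists>h\<in>CcV A. ((\<lambda>v. f v + h v), g) \<in> rel_sim A)"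
proof
  assume "(f, g) \<in> rel_precsim A"
  then have sub: "subequid (tau A f) (tau A g)" using f g rel_precsim_iff by blast
  obtain H where H: "H \<in> Cyl" "equid (\<lambda>x. tau A f x + H x) (tau A g)"
    by (rule subequidE[OF tau_Cyl[OF f] tau_Cyl[OF g] sub])
  obtain h where h: "h \<in> CcV A" "equid H (tau A h)" by (rule Cyl_equid_tau[OF H(1)])
  have "equid (\<lambda>x. tau A f x + tau A h x) (tau A g)"
    using equid_trans[OF equid_sym[OF equid_add[OF equid_refl[OF tau_Cyl[OF f]] h(2)]] H(2)] .
  then show "\<exists>h\<in>CcV A. ((\<lambda>v. f v + h v), g) \<in> rel_sim A"
    using h(1) f g CcV_add by (intro bexI[of _ h]) (simp_all add: rel_sim_iff tau_add)
next
  assume "\<exists>h\<in>CcV A. ((\<lambda>v. f v + h v), g) \<in> rel_sim A"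
  then obtain h where h: "h \<in> CcV A" "((\<lambda>v. f v + h v), g) \<in> rel_sim A" by blast
  then have "equid (\<lambda>x. tau A f x + tau A h x) (tau A g)" using f g CcV_add by (simp add: rel_sim_iff tau_add)
  then have "subequid (tau A f) (tau A g)" by (rule subequidI[OF tau_Cyl[OF f] tau_Cyl[OF g] tau_Cyl[OF h(1)]])
  then show "(f, g) \<in> rel_precsim A" using f g by (simp add: rel_precsim_iff)
qed

lemma order_V:
  assumes "f \<in> CcV A" "g \<in> CcV A"
  shows "ple (V_mon A) (rel_sim A `` {f}) (rel_sim A `` {g}) \<longleftrightarrow> (f, g) \<in> rel_precsim A"
  unfolding V_mon_eq using alg_le_presents[OF presents_MV assms(1)] kernel_MV CcV_add assms
  by (simp add: precsim_iff_sim_add)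

lemma order_S:
  assumes "f \<in> CcV A" "g \<in> CcV A"
  shows "ple (S_typ GG) (rel_sim_G GG `` {tau A f}) (rel_sim_G GG `` {tau A g}) \<longleftrightarrow> (f, g) \<in> rel_precsim A"
  unfolding S_typ_eq using alg_le_presents[OF presents_MX assms(1)] kernel_MX CcV_add assms
  by (simp add: precsim_iff_sim_add)

lemma presents_W: "presents (CcV A) (\<lambda>f. rel_approx A `` {f}) (W_mon A)"
  unfolding W_mon_tilde tilde_rel_preV[symmetric]
proof (rule presents_tilde[OF preordered_preV, where t = "\<lambda>f. f"])
  show "\<exists>f\<in>CcV A. (y, f) \<in> tilde_rel preV" if "y \<in> carrier preV" for y
    using tilde_equiv[OF preordered_preV] that by (auto simp: equiv_def refl_on_def preV_def)
qed (simp_all add: preV_def)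

lemma order_W:
  assumes "f \<in> CcV A" "g \<in> CcV A"
  shows "ple (W_mon A) (rel_approx A `` {f}) (rel_approx A `` {g}) \<longleftrightarrow> (f, g) \<in> rel_precsim A"
  unfolding W_mon_tilde tilde_rel_preV[symmetric]
  using tilde_le[OF preordered_preV, of f g] assms by (simp add: preV_def)

lemma kernel_W:
  assumes "f \<in> CcV A" "g \<in> CcV A"
  shows "rel_approx A `` {f} = rel_approx A `` {g} \<longleftrightarrow> (f, g) \<in> rel_precsim A \<and> (g, f) \<in> rel_precsim A"
  unfolding tilde_rel_preV[symmetric]
  using tilde_class_eq_iff[OF preordered_preV, of f g] assms by (simp add: preV_def)

lemma precsim_tau: "f \<in> CcV A \<Longrightarrow> g \<in> CcV A \<Longrightarrow>
    (tau A f, tau A g) \<in> rel_precsim_B GG \<longleftrightarrow> (f, g) \<in> rel_precsim A"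
  by (simp add: rel_precsim_B_iff rel_precsim_iff tau_Cyl)

lemma presents_SB: "presents (CcV A) (\<lambda>f. rel_approx_B GG `` {tau A f}) (S_B GG)"
  unfolding S_B_tilde tilde_rel_preX[symmetric]
proof (rule presents_tilde[OF preordered_preX])
  show "\<exists>f\<in>CcV A. (F, tau A f) \<in> tilde_rel preX" if "F \<in> carrier preX" for F
  proof -
    have F: "F \<in> Cyl" using that by (simp add: preX_def)
    obtain f where f: "f \<in> CcV A" "equid F (tau A f)" by (rule Cyl_equid_tau[OF F])
    then have "(F, tau A f) \<in> tilde_rel preX"
      using equid_imp_subequid[OF f(2)] equid_imp_subequid[OF equid_sym[OF f(2)]] F tau_Cyl[OF f(1)]
      by (simp add: tilde_rel_def preX_def rel_precsim_B_iff)
    then show ?thesis using f(1) by blast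
  qed
qed (simp_all add: preX_def tau_Cyl tau_zero tau_add)

lemma order_SB:
  assumes "f \<in> CcV A" "g \<in> CcV A"
  shows "ple (S_B GG) (rel_approx_B GG `` {tau A f}) (rel_approx_B GG `` {tau A g}) \<longleftrightarrow> (f, g) \<in> rel_precsim A"
  unfolding S_B_tilde tilde_rel_preX[symmetric]
  using tilde_le[OF preordered_preX, of "tau A f" "tau A g"] assms tau_Cyl precsim_tau by (simp add: preX_def)

lemma kernel_SB:
  assumes "f \<in> CcV A" "g \<in> CcV A"
  shows "rel_approx_B GG `` {tau A f} = rel_approx_B GG `` {tau A g} \<longleftrightarrow> (f, g) \<in> rel_precsim A \<and> (g, f) \<in> rel_precsim A"
  unfolding tilde_rel_preX[symmetric]
  using tilde_class_eq_iff[OF preordered_preX, of "tau A f" "tau A g"] assms tau_Cyl precsim_tau by (simp add: preX_def)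

lemma class_in_V: "f \<in> CcV A \<Longrightarrow> rel_sim A `` {f} \<in> carrier (V_mon A)"
  using presents_MV by (auto simp: presents_def V_mon_eq)

lemma presents_tilde_V:
  "presents (CcV A) (\<lambda>f. tilde_rel (V_mon A) `` {rel_sim A `` {f}}) (tilde (V_mon A))"
proof (rule presents_tilde[OF preordered_V])
  have p: "presents (CcV A) (\<lambda>f. rel_sim A `` {f}) (V_mon A)" using presents_MV by (simp add: V_mon_eq)
  show "rel_sim A `` {\<lambda>x. 0} = \<one>\<^bsub>V_mon A\<^esub>" using p by (simp add: presents_def)
  show "rel_sim A `` {\<lambda>x. f x + g x} = rel_sim A `` {f} \<otimes>\<^bsub>V_mon A\<^esub> rel_sim A `` {g}"
    if "f \<in> CcV A" "g \<in> CcV A" for f g using p that by (simp add: presents_def)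
  show "\<exists>f\<in>CcV A. (y, rel_sim A `` {f}) \<in> tilde_rel (V_mon A)" if y: "y \<in> carrier (V_mon A)" for y
  proof -
    have im: "(\<lambda>f. rel_sim A `` {f}) ` CcV A = carrier (V_mon A)" using p by (simp add: presents_def)
    obtain f where "f \<in> CcV A" "y = rel_sim A `` {f}" using y unfolding im[symmetric] by blast
    moreover have "(y, y) \<in> tilde_rel (V_mon A)"
      using tilde_equiv[OF preordered_V] y by (simp add: equiv_def refl_on_def)
    ultimately show ?thesis by blast
  qed
qed (rule class_in_V)

lemma order_tilde_V:
  assumes "f \<in> CcV A" "g \<in> CcV A"
  shows "ple (tilde (V_mon A)) (tilde_rel (V_mon A) `` {rel_sim A `` {f}}) (tilde_rel (V_mon A) `` {rel_sim A `` {g}})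
    \<longleftrightarrow> (f, g) \<in> rel_precsim A"
  using tilde_le[OF preordered_V class_in_V class_in_V] order_V assms by simp

lemma kernel_tilde_V:
  assumes "f \<in> CcV A" "g \<in> CcV A"
  shows "tilde_rel (V_mon A) `` {rel_sim A `` {f}} = tilde_rel (V_mon A) `` {rel_sim A `` {g}}
    \<longleftrightarrow> (f, g) \<in> rel_precsim A \<and> (g, f) \<in> rel_precsim A"
  using tilde_class_eq_iff[OF preordered_V class_in_V class_in_V] order_V assms by simp

lemma preordered_tilde: "preordered_monoid P \<Longrightarrow> preordered_monoid (tilde P)"
  using tilde_ordered by (auto simp: ordered_monoid_def)

lemmas preord_iso_CcV = preord_iso_of_presentations[where C = "CcV A", OF _ _ _ _ CcV_zero CcV_add]

lemma iso_V_S: "\<exists>\<phi>\<in>preord_iso (V_mon A) (S_typ GG). \<forall>f\<in>CcV A. \<phi> (rel_sim A `` {f}) = rel_sim_G GG `` {tau A f}"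
  by (rule preord_iso_CcV[OF _ _ preordered_V preordered_S])
    (use presents_MV presents_MX kernel_MV kernel_MX order_V order_S in \<open>simp_all add: V_mon_eq S_typ_eq\<close>)

lemma iso_W_SB: "\<exists>\<phi>\<in>preord_iso (W_mon A) (S_B GG). \<forall>f\<in>CcV A. \<phi> (rel_approx A `` {f}) = rel_approx_B GG `` {tau A f}"
  by (rule preord_iso_CcV[OF presents_W presents_SB])
    (simp_all add: preordered_tilde W_mon_tilde S_B_tilde preordered_preV preordered_preX
      kernel_W kernel_SB order_W[unfolded W_mon_tilde] order_SB[unfolded S_B_tilde])

lemma iso_tilde_W: "\<exists>\<psi>\<in>preord_iso (tilde (V_mon A)) (W_mon A).
    \<forall>f\<in>CcV A. \<psi> (tilde_rel (V_mon A) `` {rel_sim A `` {f}}) = rel_approx A `` {f}"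
  by (rule preord_iso_CcV[OF presents_tilde_V presents_W preordered_tilde[OF preordered_V]])
    (simp_all add: preordered_tilde W_mon_tilde preordered_preV
      kernel_W kernel_tilde_V order_W[unfolded W_mon_tilde] order_tilde_V)

lemma iso_tilde_SB: "\<exists>\<psi>\<in>preord_iso (tilde (V_mon A)) (S_B GG).
    \<forall>f\<in>CcV A. \<psi> (tilde_rel (V_mon A) `` {rel_sim A `` {f}}) = rel_approx_B GG `` {tau A f}"
  by (rule preord_iso_CcV[OF presents_tilde_V presents_SB preordered_tilde[OF preordered_V]])
    (simp_all add: preordered_tilde S_B_tilde preordered_preX
      kernel_SB kernel_tilde_V order_SB[unfolded S_B_tilde] order_tilde_V)

section \<open>The universal property\<close>

lemma path_mset_one: "path_mset (Suc 0) v = image_mset (\<lambda>e. [e]) (mset_set (edges_into v))"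
proof -
  have "(\<Sum>e\<in>#M. {#[e]#}) = image_mset (\<lambda>e. [e]) M" for M :: "'e multiset"
    by (induction M) auto
  then show ?thesis by simp
qed

lemma path_so_paths_from:
  "image_mset (path_so A) (paths_from n B) =
   (\<Sum>v\<in>#B. image_mset (\<lambda>es. path_so A (v, es)) (path_mset n v))"
  by (simp add: refine_all_def image_mset_sum_mset multiset.map_comp o_def path_so_refine)

context
  fixes M :: "'m monoid" and b
  assumes M: "comm_monoid M" and rel: "vertex_relations A M b"
begin

interpretation M: comm_monoid M by (rule M)

lemma b_in: "v \<in> E0 A \<Longrightarrow> b v \<in> carrier M"
  and b_edges: "v \<in> E0 A \<Longrightarrow> b v = finprod M (\<lambda>e. b (so A e)) (edges_into v)"
  and b_act: "v \<in> E0 A \<Longrightarrow> g \<in> carrier Gr \<Longrightarrow> b (vact A g v) = b v"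
  using rel unfolding vertex_relations_def by auto

text \<open>
  Iterating the relation for the edges into \<open>v\<close> expresses \<open>b\<^sub>v\<close> by the paths of length \<open>n\<close> with range
  \<open>v\<close>.
\<close>

lemma mprod_path_mset:
  "v \<in> E0 A \<Longrightarrow> M.mprod (\<lambda>es. b (path_so A (v, es))) (path_mset n v) = b v"
proof (induction n arbitrary: v)
  case 0
  then show ?case using b_in[OF 0] M.mprod_add_mset[of "\<lambda>es. b (path_so A (v, es))" "[]" "{#}"] by simp
next
  case (Suc n)
  let ?c = "\<lambda>es. b (path_so A (v, es))"
  have fin: "finite (edges_into v)" using Suc.prems by simp
  have closed: "?c ` set_mset (image_mset (Cons e) (path_mset n (so A e))) \<subseteq> carrier M" if "e \<in> edges_into v" for e
  proof -
    have "so A e \<in> E0 A" using that by simp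
    then show ?thesis using that by (auto simp: in_path_mset paths_Cons intro!: b_in path_so_in)
  qed
  have inner: "M.mprod ?c (image_mset (Cons e) (path_mset n (so A e))) = b (so A e)" if "e \<in> edges_into v" for e
  proof -
    have "so A e \<in> E0 A" using that by simp
    then show ?thesis using Suc.IH[of "so A e"] closed[OF that] by (subst M.mprod_image) (auto simp: image_image)
  qed
  have "M.mprod ?c (path_mset (Suc n) v) = M.mprod (\<lambda>e. M.mprod ?c (image_mset (Cons e) (path_mset n (so A e)))) (mset_set (edges_into v))"
    using closed fin by (simp only: path_mset.simps) (rule M.mprod_Union, simp)
  also have "\<dots> = M.mprod (\<lambda>e. b (so A e)) (mset_set (edges_into v))"
    using inner fin by (intro M.mprod_cong) (auto intro: b_in)
  also have "\<dots> = b v"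
    using fin b_edges[OF Suc.prems] by (subst M.mprod_mset_set) (auto intro: b_in)
  finally show ?case .
qed

lemma mprod_paths_from:
  assumes B: "set_mset B \<subseteq> E0 A"
  shows "M.mprod b (image_mset (path_so A) (paths_from n B)) = M.mprod b B"
proof -
  have closed: "b ` set_mset (image_mset (\<lambda>es. path_so A (v, es)) (path_mset n v)) \<subseteq> carrier M" if "v \<in> E0 A" for v
    using that by (auto simp: in_path_mset intro!: b_in path_so_in)
  have "M.mprod b (image_mset (path_so A) (paths_from n B)) =
      M.mprod (\<lambda>v. M.mprod b (image_mset (\<lambda>es. path_so A (v, es)) (path_mset n v))) B"
    unfolding path_so_paths_from using closed B by (intro M.mprod_Union) blast
  also have "\<dots> = M.mprod b B"
  proof (rule M.mprod_cong)
    fix v assume "v \<in># B"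
    then have v: "v \<in> E0 A" using B by blast
    show "M.mprod b (image_mset (\<lambda>es. path_so A (v, es)) (path_mset n v)) = b v"
      using closed[OF v] mprod_path_mset[OF v] by (subst M.mprod_image) (auto simp: image_image)
  qed (use B b_in in blast)
  finally show ?thesis .
qed

text \<open>
  The homomorphism \<open>f \<mapsto> \<Prod>\<^sub>v b\<^sub>v\<^bsup>f(v)\<^esup>\<close>. A function of finite support is turned into the multiset with
  these multiplicities, where products are available.
\<close>

definition eval_on :: "('v \<Rightarrow> nat) \<Rightarrow> 'm" where
  "eval_on f = M.mprod b (Abs_multiset f)"

lemma eval_count: "eval_on (count B) = M.mprod b B"
  by (simp add: eval_on_def count_inverse)

lemma mprod_in: "set_mset B \<subseteq> E0 A \<Longrightarrow> M.mprod b B \<in> carrier M"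
  using b_in by (intro M.mprod_closed) blast

lemma eval_closed: "f \<in> CcV A \<Longrightarrow> eval_on f \<in> carrier M"
  using mprod_in eval_count by (auto simp: CcV_count)

lemma eval_add:
  assumes "f \<in> CcV A" "g \<in> CcV A"
  shows "eval_on (\<lambda>v. f v + g v) = eval_on f \<otimes>\<^bsub>M\<^esub> eval_on g"
proof -
  obtain B B' where B: "set_mset B \<subseteq> E0 A" "f = count B" "set_mset B' \<subseteq> E0 A" "g = count B'"
    using assms unfolding CcV_count by blast
  have "(\<lambda>v. f v + g v) = count (B + B')" using B by auto
  moreover have "b ` set_mset (B + B') \<subseteq> carrier M" using B b_in by auto
  ultimately show ?thesis using B M.mprod_union by (simp add: eval_count)
qed

lemma eval_zero: "eval_on (\<lambda>v. 0) = \<one>\<^bsub>M\<^esub>"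
proof -
  have "count {#} = (\<lambda>v::'v. 0)" by auto
  then show ?thesis using eval_count[of "{#}"] by simp
qed

lemma eval_Theta: "f \<in> CcV A \<Longrightarrow> eval_on (Theta A n f) = eval_on f"
  unfolding CcV_count using Theta_count mprod_paths_from eval_count by auto

lemma eval_sim_Theta: "f \<in> CcV A \<Longrightarrow> f' \<in> CcV A \<Longrightarrow> sim_Theta A f f' \<Longrightarrow> eval_on f = eval_on f'"
  unfolding sim_Theta_def using eval_Theta by metis

lemma eval_sim_Gamma:
  assumes "f \<in> CcV A" "f' \<in> CcV A" "sim_Gamma A f f'"
  shows "eval_on f = eval_on f'"
proof -
  obtain B B' where B: "set_mset B \<subseteq> E0 A" "f = count B" "set_mset B' \<subseteq> E0 A" "f' = count B'"
    using assms unfolding CcV_count by blast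
  obtain g where g: "g \<in> carrier Gr" "B' = image_mset (vact A g) B"
    by (rule sim_Gamma_count[OF B(1,3) assms(3)[unfolded B(2,4)]])
  have v: "v \<in> E0 A" if "v \<in># B" for v using that B(1) by blast
  have "M.mprod b B' = M.mprod (\<lambda>v. b (vact A g v)) B"
    unfolding g(2) using v g(1) b_in by (intro M.mprod_image) auto
  also have "\<dots> = M.mprod b B"
    using v g(1) b_act b_in by (intro M.mprod_cong) auto
  finally show ?thesis by (simp add: B eval_count)
qed

lemma eval_sum:
  assumes "finite I" "\<And>i. i \<in> I \<Longrightarrow> F i \<in> CcV A \<and> F' i \<in> CcV A \<and> eval_on (F i) = eval_on (F' i)"
  shows "eval_on (\<lambda>v. \<Sum>i\<in>I. F i v) = eval_on (\<lambda>v. \<Sum>i\<in>I. F' i v)"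
  using assms
proof (induction I rule: finite_induct)
  case (insert i I)
  have "(\<lambda>v. \<Sum>i\<in>I. F i v) \<in> CcV A" "(\<lambda>v. \<Sum>i\<in>I. F' i v) \<in> CcV A"
    using insert.prems by (auto intro!: CcV_sum)
  then show ?case using insert eval_add by simp
qed simp

text \<open>
  Each of the three stages in the definition of \<open>\<sim>\<close> preserves the value: \<open>\<Theta>\<close> by the relations for
  edges, translation by those for the group, and the sums by additivity.
\<close>

lemma eval_rel_sim:
  assumes "(f, f') \<in> rel_sim A"
  shows "eval_on f = eval_on f'"
proof -
  obtain n F F' F'' where F: "translated_families n F F' F''"
    and 1: "sim_Theta A f (fam_sum n F)" and 2: "sim_Theta A (fam_sum n F'') f'"
    using assms unfolding rel_sim_translated by blast
  have f: "f \<in> CcV A" "f' \<in> CcV A" using rel_sim_CcV[OF assms] by auto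
  have "eval_on (fam_sum n F) = eval_on (fam_sum n F'')"
  proof (rule eval_sum)
    fix i assume "i \<in> {1..n}"
    then have "F i \<in> CcV A" "F' i \<in> CcV A" "F'' i \<in> CcV A" "sim_Gamma A (F i) (F' i)" "sim_Theta A (F' i) (F'' i)"
      using F unfolding translated_families_def by blast+
    then show "F i \<in> CcV A \<and> F'' i \<in> CcV A \<and> eval_on (F i) = eval_on (F'' i)"
      using eval_sim_Gamma eval_sim_Theta by metis
  qed simp
  then show ?thesis
    using eval_sim_Theta[OF f(1) translated_families_CcV(1)[OF F] 1]
      eval_sim_Theta[OF translated_families_CcV(2)[OF F] f(2) 2] by simp
qed

end

lemma presents_mprod:
  assumes "presents (CcV A) q N" "set_mset B \<subseteq> E0 A"
  shows "q (count B) = comm_monoid.mprod N (\<lambda>v. q (indicator {v})) B"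
  using assms(2)
proof (induction B)
  case empty
  interpret N: comm_monoid N using assms(1) by (simp add: presents_def)
  show ?case using assms(1) by (simp add: presents_def)
next
  case (add v B)
  interpret N: comm_monoid N using assms(1) by (simp add: presents_def)
  have q: "q (indicator {w}) \<in> carrier N" if "w \<in> E0 A" for w
    using indicator_CcV[OF that] assms(1) by (auto simp: presents_def)
  have "count (add_mset v B) = (\<lambda>w. indicator {v} w + count B w)"
    by (auto simp: indicator_def)
  then have "q (count (add_mset v B)) = q (indicator {v}) \<otimes>\<^bsub>N\<^esub> q (count B)"
    using assms(1) indicator_CcV count_CcV add.prems by (simp add: presents_def)
  also have "\<dots> = N.mprod (\<lambda>v. q (indicator {v})) (add_mset v B)"
    using add q by (subst N.mprod_add_mset) auto
  finally show ?case .
qed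

text \<open>
  The relation for the edges into \<open>v\<close> is \<open>1\<^sub>v \<sim> \<Theta>(1\<^sub>v)\<close>.
\<close>

lemma vertex_relations_of_presentation:
  assumes p: "presents (CcV A) q N"
    and ker: "\<And>f g. f \<in> CcV A \<Longrightarrow> g \<in> CcV A \<Longrightarrow> q f = q g \<longleftrightarrow> (f, g) \<in> rel_sim A"
  shows "vertex_relations A N (\<lambda>v. q (indicator {v}))"
proof -
  interpret N: comm_monoid N using p by (simp add: presents_def)
  have qi: "q (indicator {w}) \<in> carrier N" if "w \<in> E0 A" for w
    using indicator_CcV[OF that] p by (auto simp: presents_def)
  show "vertex_relations A N (\<lambda>v. q (indicator {v}))"
    unfolding vertex_relations_def
  proof (intro conjI ballI)
    fix v assume v: "v \<in> E0 A"
    show "q (indicator {v}) \<in> carrier N" by (rule qi[OF v])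
    let ?B = "image_mset (so A) (mset_set (edges_into v))"
    have B: "set_mset ?B \<subseteq> E0 A" using v by auto
    have "Theta A (Suc 0) (indicator {v}) = count ?B"
      using Theta_count[of "{#v#}" "Suc 0"] v path_so_paths_from[of "Suc 0" "{#v#}"]
      by (simp add: count_single_indicator path_mset_one multiset.map_comp o_def del: path_mset.simps)
    then have "equid (tau A (indicator {v})) (tau A (count ?B))" using equid_Theta[OF indicator_CcV[OF v], of "Suc 0"] by simp
    then have "q (indicator {v}) = q (count ?B)" using ker indicator_CcV[OF v] count_CcV[OF B] rel_sim_iff by blast
    also have "\<dots> = N.mprod (\<lambda>v. q (indicator {v})) ?B" by (rule presents_mprod[OF p B])
    also have "\<dots> = N.mprod (\<lambda>e. q (indicator {so A e})) (mset_set (edges_into v))"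
      using v qi by (intro N.mprod_image) auto
    also have "\<dots> = finprod N (\<lambda>e. q (indicator {so A e})) (edges_into v)"
      using v qi by (intro N.mprod_mset_set) auto
    finally show "q (indicator {v}) = finprod N (\<lambda>e. q (indicator {so A e})) (edges_into v)" .
    fix g assume g: "g \<in> carrier Gr"
    let ?t = "((vact A g v, []), g, (v, []))"
    have "?t \<in> triples" using v g by (simp add: mem_triples)
    moreover have "tau A (indicator {w}) = cylsum {#(w, [])#}" if "w \<in> E0 A" for w
      using tau_count[of "{#w#}"] that by (simp add: count_single_indicator)
    ultimately have "equid (tau A (indicator {v})) (tau A (indicator {vact A g v}))"
      unfolding equid_def using v g by (intro exI[of _ "{#?t#}"]) simp
    then show "q (indicator {v}) = q (indicator {vact A g v})"
      using ker[OF indicator_CcV[OF v] indicator_CcV[OF vact_closed[OF g v]]] rel_sim_iff[OF indicator_CcV[OF v] indicator_CcV[OF vact_closed[OF g v]]]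
      by simp
  qed
qed

text \<open>
  Stated for an arbitrary image of \<open>C\<^sub>c(E\<^sup>0, \<nat>)\<close> with kernel \<open>\<sim>\<close>, so that it applies to \<open>V\<close> and to
  \<open>S(G)\<close> alike.
\<close>

lemma universal_of_presentation:
  assumes p: "presents (CcV A) q N"
    and ker: "\<And>f g. f \<in> CcV A \<Longrightarrow> g \<in> CcV A \<Longrightarrow> q f = q g \<longleftrightarrow> (f, g) \<in> rel_sim A"
  shows "universal_vertex_monoid TYPE('m) A N (\<lambda>v. q (indicator {v}))"
proof -
  interpret N: comm_monoid N using p by (simp add: presents_def)
  have carr: "carrier N = q ` CcV A" and q0: "q (\<lambda>x. 0) = \<one>\<^bsub>N\<^esub>"
    and q_add: "\<And>f g. f \<in> CcV A \<Longrightarrow> g \<in> CcV A \<Longrightarrow> q (\<lambda>x. f x + g x) = q f \<otimes>\<^bsub>N\<^esub> q g"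
    using p by (auto simp: presents_def)
  have qi: "q (indicator {w}) \<in> carrier N" if "w \<in> E0 A" for w
    using indicator_CcV[OF that] carr by blast
  have "vertex_relations A N (\<lambda>v. q (indicator {v}))" using p ker by (rule vertex_relations_of_presentation)
  moreover have "\<exists>!h. h \<in> extensional (carrier N) \<and> h \<in> hom N M \<and> h \<one>\<^bsub>N\<^esub> = \<one>\<^bsub>M\<^esub> \<and>
              (\<forall>v\<in>E0 A. h (q (indicator {v})) = b v)"
    if M: "comm_monoid M" and rel: "vertex_relations A M b" for M :: "'m monoid" and b
  proof -
    interpret M: comm_monoid M by (rule M)
    let ?H = "eval_on M b"
    define h where "h = restrict (\<lambda>x. ?H (SOME f. f \<in> CcV A \<and> q f = x)) (carrier N)"
    have hq: "h (q f) = ?H f" if "f \<in> CcV A" for f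
    proof -
      have "(SOME g. g \<in> CcV A \<and> q g = q f) \<in> CcV A \<and> q (SOME g. g \<in> CcV A \<and> q g = q f) = q f"
        by (rule someI[of _ f]) (use that in simp)
      then have "?H (SOME g. g \<in> CcV A \<and> q g = q f) = ?H f"
        using ker that eval_rel_sim[OF M rel] by blast
      then show ?thesis using that carr by (simp add: h_def)
    qed
    show ?thesis
    proof (rule ex1I[of _ h])
      have "h \<in> extensional (carrier N)" by (simp add: h_def)
      moreover have "h \<in> hom N M"
        unfolding hom_def carr using hq eval_closed[OF M rel] eval_add[OF M rel] CcV_add
        by (auto simp flip: q_add)
      moreover have "h \<one>\<^bsub>N\<^esub> = \<one>\<^bsub>M\<^esub>" using hq[OF CcV_zero] eval_zero[OF M rel] q0 by simp
      moreover have "h (q (indicator {v})) = b v" if "v \<in> E0 A" for v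
      proof -
        have bv: "b v \<in> carrier M" by (rule b_in[OF M rel that])
        have "?H (indicator {v}) = M.mprod b {#v#}"
          using eval_count[OF M rel, of "{#v#}"] by (simp add: count_single_indicator)
        also have "\<dots> = b v" using M.mprod_add_mset[of b v "{#}"] bv by simp
        finally show ?thesis using hq[OF indicator_CcV[OF that]] by simp
      qed
      ultimately show "h \<in> extensional (carrier N) \<and> h \<in> hom N M \<and> h \<one>\<^bsub>N\<^esub> = \<one>\<^bsub>M\<^esub> \<and>
              (\<forall>v\<in>E0 A. h (q (indicator {v})) = b v)" by blast
    next
      fix k assume k: "k \<in> extensional (carrier N) \<and> k \<in> hom N M \<and> k \<one>\<^bsub>N\<^esub> = \<one>\<^bsub>M\<^esub> \<and>
              (\<forall>v\<in>E0 A. k (q (indicator {v})) = b v)"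
      have "k (q (count B)) = M.mprod b B" if "set_mset B \<subseteq> E0 A" for B
        using that
      proof (induction B)
        case empty
        then show ?case using k q0 by simp
      next
        case (add v B)
        then have v: "v \<in> E0 A" and B: "set_mset B \<subseteq> E0 A" by auto
        have "count (add_mset v B) = (\<lambda>w. indicator {v} w + count B w)" by (auto simp: indicator_def)
        then have "k (q (count (add_mset v B))) = k (q (indicator {v}) \<otimes>\<^bsub>N\<^esub> q (count B))"
          using q_add[OF indicator_CcV[OF v] count_CcV[OF B]] by simp
        also have "\<dots> = k (q (indicator {v})) \<otimes>\<^bsub>M\<^esub> k (q (count B))"
          using k qi[OF v] count_CcV[OF B] carr by (auto simp: hom_def)
        also have "\<dots> = M.mprod b (add_mset v B)"
          using k v B add.IH b_in[OF M rel] by (subst M.mprod_add_mset) auto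
        finally show ?case .
      qed
      then have kq: "k (q f) = h (q f)" if "f \<in> CcV A" for f
        using that hq[OF that] eval_count[OF M rel] unfolding CcV_count by auto
      show "k = h"
        by (rule extensionalityI[of _ "carrier N"]) (use k kq carr in \<open>auto simp: h_def\<close>)
    qed
  qed
  ultimately show ?thesis unfolding universal_vertex_monoid_def using N.comm_monoid_axioms by blast
qed

end

section \<open>Comparison of the monoids\<close>

theorem corollary7p4:
  fixes A :: "('v, 'e, 'g) ss_action"
  assumes "self_similar_action A"
    and "row_finite_no_sources (sgraph A)"
  shows
    "preorder_on (CcV A) (rel_precsim A) \<and>
     equiv (CcV A) (rel_approx A) \<and>
     equiv (CcV A) (rel_sim A) \<and>

     ordered_monoid (W_mon A) \<and>
     (\<forall>f\<in>CcV A. \<forall>g\<in>CcV A.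
        rel_approx A `` {f} \<otimes>\<^bsub>W_mon A\<^esub> rel_approx A `` {g} = rel_approx A `` {\<lambda>v. f v + g v} \<and>
        (ple (W_mon A) (rel_approx A `` {f}) (rel_approx A `` {g}) \<longleftrightarrow> (f, g) \<in> rel_precsim A)) \<and>

     preordered_monoid (V_mon A) \<and>
     (\<forall>f\<in>CcV A. \<forall>g\<in>CcV A.
        rel_sim A `` {f} \<otimes>\<^bsub>V_mon A\<^esub> rel_sim A `` {g} = rel_sim A `` {\<lambda>v. f v + g v}) \<and>

     (\<forall>f\<in>CcV A. tau A f \<in> Cc (inf_top A)) \<and>
     (\<exists>\<phi>\<in>preord_iso (W_mon A) (S_B (germ_groupoid A)).
        \<forall>f\<in>CcV A. \<phi> (rel_approx A `` {f}) = rel_approx_B (germ_groupoid A) `` {tau A f}) \<and>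
     (\<exists>\<phi>\<in>preord_iso (V_mon A) (S_typ (germ_groupoid A)).
        \<forall>f\<in>CcV A. \<phi> (rel_sim A `` {f}) = rel_sim_G (germ_groupoid A) `` {tau A f}) \<and>

     universal_vertex_monoid TYPE('m) A (V_mon A) (\<lambda>v. rel_sim A `` {indicator {v}}) \<and>
     universal_vertex_monoid TYPE('m) A (S_typ (germ_groupoid A))
       (\<lambda>v. rel_sim_G (germ_groupoid A) `` {tau A (indicator {v})}) \<and>

     (\<exists>\<psi>\<in>preord_iso (tilde (V_mon A)) (W_mon A).
        \<forall>f\<in>CcV A. \<psi> (tilde_rel (V_mon A) `` {rel_sim A `` {f}}) = rel_approx A `` {f}) \<and>
     (\<exists>\<psi>\<in>preord_iso (tilde (V_mon A)) (S_B (germ_groupoid A)).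
        \<forall>f\<in>CcV A. \<psi> (tilde_rel (V_mon A) `` {rel_sim A `` {f}})
                  = rel_approx_B (germ_groupoid A) `` {tau A f})"
proof -
  interpret ss_graph A using assms by unfold_locales
  have V: "presents (CcV A) (\<lambda>f. rel_sim A `` {f}) (V_mon A)"
    using presents_MV by (simp add: V_mon_eq)
  have S: "presents (CcV A) (\<lambda>f. rel_sim_G GG `` {tau A f}) (S_typ GG)"
    using presents_MX by (simp add: S_typ_eq)
  have "equiv (CcV A) (rel_approx A)"
    using tilde_equiv[OF preordered_preV] unfolding tilde_rel_preV by (simp add: preV_def)
  moreover have "ordered_monoid (W_mon A)"
    unfolding W_mon_tilde by (rule tilde_ordered[OF preordered_preV])
  moreover have "\<forall>f\<in>CcV A. \<forall>g\<in>CcV A.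
      rel_approx A `` {f} \<otimes>\<^bsub>W_mon A\<^esub> rel_approx A `` {g} = rel_approx A `` {\<lambda>v. f v + g v} \<and>
      (ple (W_mon A) (rel_approx A `` {f}) (rel_approx A `` {g}) \<longleftrightarrow> (f, g) \<in> rel_precsim A)"
    using presents_W order_W by (simp add: presents_def)
  moreover have "\<forall>f\<in>CcV A. \<forall>g\<in>CcV A.
      rel_sim A `` {f} \<otimes>\<^bsub>V_mon A\<^esub> rel_sim A `` {g} = rel_sim A `` {\<lambda>v. f v + g v}"
    using V by (simp add: presents_def)
  moreover have "\<forall>f\<in>CcV A. tau A f \<in> Cc (inf_top A)"
    using tau_Cyl by (simp add: Cc_eq_Cyl)
  ultimately show ?thesis
    using preorder_rel_precsim equiv_rel_sim preordered_V iso_W_SB iso_V_S iso_tilde_W iso_tilde_SB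
      universal_of_presentation[OF V kernel_MV] universal_of_presentation[OF S kernel_MX]
    by blast
qed

end
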